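(* Every countable Borel equivalence relation that is treeable is classifiable by an abelian Polish group. In particular, every such equivalence relation is classifiable by $\ell_1$ (viewed as an abelian Polish group under addition with its norm topology).
   Context: A countable Borel equivalence relation $E$ on a standard Borel (Polish) space $X$ is a Borel equivalence relation all of whose classes are countable. $E$ is treeable if there is an acyclic Borel graph on $X$ whose connected components are exactly the $E$-classes. A Borel equivalence relation $E$ is classifiable by a Polish group $G$ if there is a continuous action of $G$ on a Polish space $Y$ and a Borel reduction from $E$ to the orbit equivalence relation $E^G_Y$, i.e. a Borel map $f$ with $x \mathrel{E} x' \iff f(x) \mathrel{E^G_Y} f(x')$. $\ell_1$ is the Banach space of absolutely summable real sequences. *)

theory Defs
  imports "HOL-Analysis.Analysis" "HOL-Algebra.Group_Action"
begin

section \<open>Polish topologies and standard Borel spaces\<close>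

definition polish_topology :: "'a topology \<Rightarrow> bool" where
  "polish_topology T \<longleftrightarrow> completely_metrizable_space T \<and> separable_space T"

definition borel_of :: "'a topology \<Rightarrow> 'a measure" where
  "borel_of T = sigma (topspace T) {U. openin T U}"

text \<open>A measurable space is represented by a term of type \<open>'a measure\<close>, of which only the
  carrier and the sigma-algebra are used.\<close>

definition standard_borel :: "'a measure \<Rightarrow> bool" where
  "standard_borel X \<longleftrightarrow>
     (\<exists>T. polish_topology T \<and> space X = topspace T \<and> sets X = sets (borel_of T))"


section \<open>Countable Borel equivalence relations and treeability\<close>

definition borel_equiv :: "'a measure \<Rightarrow> ('a \<times> 'a) set \<Rightarrow> bool" where
  "borel_equiv X E \<longleftrightarrow> equiv (space X) E \<and> E \<in> sets (X \<Otimes>\<^sub>M X)"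

definition countable_borel_equiv :: "'a measure \<Rightarrow> ('a \<times> 'a) set \<Rightarrow> bool" where
  "countable_borel_equiv X E \<longleftrightarrow> borel_equiv X E \<and> (\<forall>C \<in> space X // E. countable C)"

definition borel_graph :: "'a measure \<Rightarrow> ('a \<times> 'a) set \<Rightarrow> bool" where
  "borel_graph X R \<longleftrightarrow> R \<in> sets (X \<Otimes>\<^sub>M X) \<and> sym R \<and> irrefl R"

definition graph_cycle :: "('a \<times> 'a) set \<Rightarrow> 'a list \<Rightarrow> bool" where
  "graph_cycle R p \<longleftrightarrow> 3 \<le> length p \<and> distinct p \<and>
     successively (\<lambda>x y. (x, y) \<in> R) p \<and> (last p, hd p) \<in> R"

text \<open>Acyclicity is that of undirected graphs: the library constant \<^const>\<open>acyclic\<close> concerns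
  directed cycles and fails for every nonempty symmetric relation.\<close>

definition acyclic_graph :: "('a \<times> 'a) set \<Rightarrow> bool" where
  "acyclic_graph R \<longleftrightarrow> (\<nexists>p. graph_cycle R p)"

definition graph_components :: "'a set \<Rightarrow> ('a \<times> 'a) set \<Rightarrow> 'a set set" where
  "graph_components V R = {{y \<in> V. (x, y) \<in> R\<^sup>*} | x. x \<in> V}"

definition treeable :: "'a measure \<Rightarrow> ('a \<times> 'a) set \<Rightarrow> bool" where
  "treeable X E \<longleftrightarrow>
     (\<exists>R. borel_graph X R \<and> acyclic_graph R \<and> graph_components (space X) R = space X // E)"


section \<open>Polish groups, continuous actions, classifiability\<close>

definition polish_group :: "'g monoid \<Rightarrow> 'g topology \<Rightarrow> bool" where
  "polish_group G T \<longleftrightarrow>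
     group G \<and> topspace T = carrier G \<and> polish_topology T \<and>
     continuous_map (prod_topology T T) T (\<lambda>(g, h). g \<otimes>\<^bsub>G\<^esub> h) \<and>
     continuous_map T T (\<lambda>g. inv\<^bsub>G\<^esub> g)"

definition continuous_action ::
  "'g monoid \<Rightarrow> 'g topology \<Rightarrow> 'y topology \<Rightarrow> ('g \<Rightarrow> 'y \<Rightarrow> 'y) \<Rightarrow> bool" where
  "continuous_action G T Y \<phi> \<longleftrightarrow>
     group_action G (topspace Y) \<phi> \<and>
     continuous_map (prod_topology T Y) Y (\<lambda>(g, y). \<phi> g y)"

definition orbit_equiv :: "'g monoid \<Rightarrow> 'y set \<Rightarrow> ('g \<Rightarrow> 'y \<Rightarrow> 'y) \<Rightarrow> ('y \<times> 'y) set" where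
  "orbit_equiv G Y \<phi> = {(y, z). y \<in> Y \<and> z \<in> orbit G \<phi> y}"

definition borel_reduction ::
  "'a measure \<Rightarrow> ('a \<times> 'a) set \<Rightarrow> 'y measure \<Rightarrow> ('y \<times> 'y) set \<Rightarrow> ('a \<Rightarrow> 'y) \<Rightarrow> bool" where
  "borel_reduction X E Y F f \<longleftrightarrow>
     f \<in> X \<rightarrow>\<^sub>M Y \<and> (\<forall>x \<in> space X. \<forall>x' \<in> space X. (x, x') \<in> E \<longleftrightarrow> (f x, f x') \<in> F)"

text \<open>The existential quantifier over Polish spaces \<open>Y\<close> has to be placed at some type. Since every
  Polish space is homeomorphic to a subspace of the space of all real sequences, and \<open>Y\<close> ranges
  over all Polish topologies carried by arbitrary sets of real sequences, every
  Polish \<open>G\<close>-space is represented up to isomorphism.\<close>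

definition classifiable_by ::
  "'a measure \<Rightarrow> ('a \<times> 'a) set \<Rightarrow> 'g monoid \<Rightarrow> 'g topology \<Rightarrow> bool" where
  "classifiable_by X E G T \<longleftrightarrow>
     polish_group G T \<and>
     (\<exists>(Y :: (nat \<Rightarrow> real) topology) \<phi> f.
        polish_topology Y \<and> continuous_action G T Y \<phi> \<and>
        borel_reduction X E (borel_of Y) (orbit_equiv G (topspace Y) \<phi>) f)"

text \<open>As for \<open>Y\<close> above, quantifying over group structures and topologies on sets of real
  sequences covers all Polish groups up to isomorphism.\<close>

definition classifiable_by_abelian_polish_group :: "'a measure \<Rightarrow> ('a \<times> 'a) set \<Rightarrow> bool" where
  "classifiable_by_abelian_polish_group X E \<longleftrightarrow>
     (\<exists>(A :: (nat \<Rightarrow> real) monoid) T. comm_group A \<and> classifiable_by X E A T)"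


section \<open>The additive topological group of absolutely summable sequences\<close>

definition l1_set :: "(nat \<Rightarrow> real) set" where
  "l1_set = {x. (\<lambda>n. \<bar>x n\<bar>) summable_on UNIV}"

text \<open>With \<^const>\<open>infsum\<close> the norm is nonnegative even off \<open>l1_set\<close> (unlike with \<^const>\<open>suminf\<close>, which is
  unspecified on divergent series); \<^locale>\<open>Metric_space\<close> demands this of distances.\<close>

definition l1_norm :: "(nat \<Rightarrow> real) \<Rightarrow> real" where
  "l1_norm x = (\<Sum>\<^sub>\<infinity>n. \<bar>x n\<bar>)"

definition l1_dist :: "(nat \<Rightarrow> real) \<Rightarrow> (nat \<Rightarrow> real) \<Rightarrow> real" where
  "l1_dist x y = l1_norm (\<lambda>n. x n - y n)"

definition l1_group :: "(nat \<Rightarrow> real) monoid" where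
  "l1_group = \<lparr>carrier = l1_set, mult = (\<lambda>x y n. x n + y n), one = (\<lambda>n. 0)\<rparr>"

definition l1_topology :: "(nat \<Rightarrow> real) topology" where
  "l1_topology = Metric_space.mtopology l1_set l1_dist"

lemma l1_set_add: "x \<in> l1_set \<Longrightarrow> y \<in> l1_set \<Longrightarrow> (\<lambda>n. x n + y n) \<in> l1_set"
  unfolding l1_set_def
  by (auto intro!: summable_on_comparison_test[OF summable_on_add, of "\<lambda>n. \<bar>x n\<bar>" UNIV "\<lambda>n. \<bar>y n\<bar>"])

lemma l1_set_uminus: "x \<in> l1_set \<Longrightarrow> (\<lambda>n. - x n) \<in> l1_set"
  by (simp add: l1_set_def)

lemma l1_set_diff: "x \<in> l1_set \<Longrightarrow> y \<in> l1_set \<Longrightarrow> (\<lambda>n. x n - y n) \<in> l1_set"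
  using l1_set_add[of x "\<lambda>n. - y n"] l1_set_uminus[of y] by simp

lemma comm_group_l1: "comm_group l1_group"
proof (rule comm_groupI)
  fix x assume "x \<in> carrier l1_group"
  then show "\<exists>y \<in> carrier l1_group. y \<otimes>\<^bsub>l1_group\<^esub> x = \<one>\<^bsub>l1_group\<^esub>"
    by (intro bexI[of _ "\<lambda>n. - x n"]) (auto simp: l1_group_def l1_set_uminus)
qed (auto simp: l1_group_def l1_set_add algebra_simps, simp add: l1_set_def)

lemma Metric_space_l1: "Metric_space l1_set l1_dist"
proof
  fix x y :: "nat \<Rightarrow> real"
  show "0 \<le> l1_dist x y"
    by (simp add: l1_dist_def l1_norm_def infsum_nonneg)
  show "l1_dist x y = l1_dist y x"
    by (simp add: l1_dist_def l1_norm_def abs_minus_commute)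
next
  fix x y assume xy: "x \<in> l1_set" "y \<in> l1_set"
  then have *: "(\<lambda>n. \<bar>x n - y n\<bar>) summable_on UNIV"
    using l1_set_diff by (force simp: l1_set_def)
  show "l1_dist x y = 0 \<longleftrightarrow> x = y"
  proof
    assume "l1_dist x y = 0"
    then have "\<bar>x n - y n\<bar> = 0" for n
      using nonneg_infsum_le_0D[of "\<lambda>n. \<bar>x n - y n\<bar>" UNIV n] *
      by (simp add: l1_dist_def l1_norm_def)
    then show "x = y" by auto
  qed (simp add: l1_dist_def l1_norm_def)
next
  fix x y z assume xyz: "x \<in> l1_set" "y \<in> l1_set" "z \<in> l1_set"
  then have *: "(\<lambda>n. \<bar>x n - y n\<bar>) summable_on UNIV" "(\<lambda>n. \<bar>y n - z n\<bar>) summable_on UNIV"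
    "(\<lambda>n. \<bar>x n - z n\<bar>) summable_on UNIV"
    using l1_set_diff by (force simp: l1_set_def)+
  have "l1_dist x z \<le> (\<Sum>\<^sub>\<infinity>n. \<bar>x n - y n\<bar> + \<bar>y n - z n\<bar>)"
    unfolding l1_dist_def l1_norm_def
    by (rule infsum_mono) (use * in \<open>auto intro: summable_on_add\<close>)
  also have "\<dots> = l1_dist x y + l1_dist y z"
    unfolding l1_dist_def l1_norm_def by (rule infsum_add) (use * in auto)
  finally show "l1_dist x z \<le> l1_dist x y + l1_dist y z" .
qed

end

theory Submission
  imports Defs
begin

text \<open>By the Lusin--Novikov theorem each \<open>E\<close>-class is enumerated by Borel functions. This yields a
  symmetric Borel length on the edges of the forest for which balls are finite, so that for each
  scale \<open>2 ^ k\<close> there is a countable Borel coloring separating distinct vertices joined by a path of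
  length at most \<open>2 ^ k\<close>. Send an edge \<open>(u, v)\<close> to the element of \<open>\<ell>\<^sub>1\<close> whose component at scale \<open>k\<close> is
  \<open>2 ^ - k\<close> times its length, times the difference of the basis vectors indexed by the color pairs of
  \<open>(u, v)\<close> and \<open>(v, u)\<close>. By acyclicity, summing along paths defines a cocycle \<open>c\<close> on \<open>E\<close>, and
  \<open>c x y\<close> has norm at least \<open>1 / 2\<close> for \<open>x \<noteq> y\<close>: at a scale comparable to the length of the path
  no two of its edges interfere. Hence \<open>x\<close> can be recovered from the uniformly discrete set
  \<open>{c x y | y. (x, y) \<in> E}\<close>, labelled by the points \<open>y\<close>, and moving \<open>x\<close> within its class translates
  this set. Coding such sets by distance functions reduces \<open>E\<close> to the translation action of \<open>\<ell>\<^sub>1\<close> on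
  sequences of 1-Lipschitz functions.\<close>

section \<open>Standard Borel spaces and complete systems of covers\<close>

text \<open>The treeing may have infinite degree, and then balls for the edge-counting metric are
  infinite, out of reach of the colouring argument; lengths taken from the enumeration of a class
  repair this. The factor "length" in an edge weight pays for it: at the first scale
  \<open>2 ^ k\<close> above the total length \<open>W\<close> of a path, the edges contribute
  \<open>W / 2 ^ k\<close>, which is at least \<open>1 / 2\<close>, whereas a path of few but long
  edges would contribute next to nothing if edges were merely counted. All scales occur at once
  because no single one suits every path, and the factors \<open>2 ^ - k\<close> keep an edge weight
  summable. The labels are needed because different classes may have images that are translates of
  each other. The uniform gap matters because a distance function sees only the closure of a set:
  with gap \<open>1 / 2\<close>, a point within \<open>1 / 4\<close> of a given element is unique.
  Coding by functions on a countable dense set gives a closed subset of a countable power of the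
  unit interval, so no hyperspace of closed sets is involved. The enumeration of classes rests on
  separation arguments, run with countable covers in place of Polish refinements.\<close>

lemma sets_borel_of: "sets (borel_of T) = sigma_sets (topspace T) {U. openin T U}"
  unfolding borel_of_def by (rule sets_measure_of) (auto dest: openin_subset)

lemma space_borel_of [simp]: "space (borel_of T) = topspace T"
  unfolding borel_of_def by (rule space_measure_of) (auto dest: openin_subset)

section \<open>Second countability and products of standard Borel spaces\<close>

lemma polish_topology_second_countable:
  assumes "polish_topology T"
  shows "second_countable T"
proof -
  obtain M d where md: "Metric_space M d" and T: "T = Metric_space.mtopology M d"
    using assms unfolding polish_topology_def completely_metrizable_space_def by blast
  interpret Metric_space M d by (rule md)
  obtain S where S: "countable S" "S \<subseteq> M" "T closure_of S = M"
    using assms unfolding polish_topology_def separable_space_def T by auto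
  define \<B> where "\<B> = (\<lambda>(s, n::nat). mball s (1 / Suc n)) ` (S \<times> UNIV)"
  have "countable \<B>" using S(1) by (auto simp: \<B>_def)
  moreover have "\<forall>V\<in>\<B>. openin T V" by (auto simp: \<B>_def T)
  moreover have "\<exists>V\<in>\<B>. x \<in> V \<and> V \<subseteq> U" if U: "openin T U" "x \<in> U" for U x
  proof -
    obtain r where r: "r > 0" "mball x r \<subseteq> U" "x \<in> M"
      using U unfolding T openin_mtopology by blast
    obtain n where n: "1 / Suc n < r / 2"
      using nat_approx_posE[of "r/2"] r by auto
    have "x \<in> mtopology closure_of S" using S(3) r(3) unfolding T by simp
    then have "\<forall>e>0. \<exists>s\<in>S. s \<in> mball x e"
      unfolding metric_closure_of by simp
    then obtain s where s: "s \<in> S" "s \<in> mball x (1 / Suc n)"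
      by (metis of_nat_0_less_iff zero_less_Suc zero_less_divide_1_iff)
    have "mball s (1 / Suc n) \<subseteq> mball x r"
    proof
      fix y assume y: "y \<in> mball s (1 / Suc n)"
      have m: "x \<in> M" "s \<in> M" "y \<in> M" "d x s < 1 / Suc n" "d s y < 1 / Suc n" using s(2) y by (simp_all add: in_mball)
      have "d x y \<le> d x s + d s y" using m(1-3) by (rule triangle)
      then have "d x y < r" using m(4,5) n by linarith
      then show "y \<in> mball x r" using m by (simp add: in_mball)
    qed
    moreover have "x \<in> mball s (1 / Suc n)" using s by (auto simp: commute)
    ultimately show ?thesis using s(1) r by (auto simp: \<B>_def)
  qed
  ultimately show ?thesis unfolding second_countable_def by blast
qed

lemma polish_topology_prod:
  assumes "polish_topology S" "polish_topology T"
  shows "polish_topology (prod_topology S T)"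
proof -
  obtain A where A: "countable A" "A \<subseteq> topspace S" "S closure_of A = topspace S"
    using assms(1) unfolding polish_topology_def separable_space_def by blast
  obtain B where B: "countable B" "B \<subseteq> topspace T" "T closure_of B = topspace T"
    using assms(2) unfolding polish_topology_def separable_space_def by blast
  have "separable_space (prod_topology S T)"
    unfolding separable_space_def
    by (intro exI[of _ "A \<times> B"]) (use A B in \<open>simp add: closure_of_Times Sigma_mono\<close>)
  then show ?thesis
    using assms by (auto simp: polish_topology_def completely_metrizable_space_prod_topology)
qed

lemma countable_base_Union:
  assumes "countable \<B>" "\<And>x. x \<in> U \<Longrightarrow> \<exists>V\<in>\<B>. x \<in> V \<and> V \<subseteq> U" "\<And>V. V \<in> \<B> \<Longrightarrow> V \<in> sets M"
  shows "U \<in> sets M"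
proof -
  have "U = \<Union>{V \<in> \<B>. V \<subseteq> U}" using assms(2) by blast
  moreover have "\<Union>{V \<in> \<B>. V \<subseteq> U} \<in> sets M"
    using assms(1,3) by (intro sets.countable_Union) auto
  ultimately show ?thesis by simp
qed

text \<open>Second countability makes every open set of the product topology a countable union of
  open rectangles, hence a member of the product sigma-algebra; the other inclusion is measurability
  of the two projections. This allows the projection \<open>fst\<close> of a Borel relation to be
  treated as a Borel map on a standard Borel space.\<close>

lemma standard_borel_pair:
  assumes "standard_borel X" "standard_borel Y"
  shows "standard_borel (X \<Otimes>\<^sub>M Y)"
proof -
  obtain S where S: "polish_topology S" "space X = topspace S" "sets X = sets (borel_of S)"
    using assms(1) unfolding standard_borel_def by blast
  obtain T where T: "polish_topology T" "space Y = topspace T" "sets Y = sets (borel_of T)"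
    using assms(2) unfolding standard_borel_def by blast
  let ?P = "prod_topology S T"
  obtain A where A: "countable A" "\<And>V. V \<in> A \<Longrightarrow> openin S V"
    "\<And>U x. openin S U \<Longrightarrow> x \<in> U \<Longrightarrow> \<exists>V\<in>A. x \<in> V \<and> V \<subseteq> U"
    using polish_topology_second_countable[OF S(1)] unfolding second_countable_def by metis
  obtain B where B: "countable B" "\<And>V. V \<in> B \<Longrightarrow> openin T V"
    "\<And>U x. openin T U \<Longrightarrow> x \<in> U \<Longrightarrow> \<exists>V\<in>B. x \<in> V \<and> V \<subseteq> U"
    using polish_topology_second_countable[OF T(1)] unfolding second_countable_def by metis
  have open_sets: "U \<in> sets (borel_of R)" if "openin R U" for U and R :: "'c topology"
    using that by (auto simp: sets_borel_of)
  have op: "U \<in> sets (X \<Otimes>\<^sub>M Y)" if U: "openin ?P U" for U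
  proof (rule countable_base_Union)
    show "countable ((\<lambda>(a, b). a \<times> b) ` (A \<times> B))" using A(1) B(1) by auto
    show "V \<in> sets (X \<Otimes>\<^sub>M Y)" if "V \<in> (\<lambda>(a, b). a \<times> b) ` (A \<times> B)" for V
      using that A(2) B(2) S(3) T(3) by (auto intro!: pair_measureI simp: sets_borel_of)
    fix z assume z: "z \<in> U"
    obtain x y where xy: "z = (x, y)" by (cases z)
    have "\<forall>x y. (x, y) \<in> U \<longrightarrow>
        (\<exists>C D. openin S C \<and> openin T D \<and> x \<in> C \<and> y \<in> D \<and> C \<times> D \<subseteq> U)"
      using U by (simp add: openin_prod_topology_alt)
    then obtain C D where CD: "openin S C" "openin T D" "x \<in> C" "y \<in> D" "C \<times> D \<subseteq> U"
      using z xy by metis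
    obtain C' where "C' \<in> A" "x \<in> C'" "C' \<subseteq> C" using A(3)[OF CD(1,3)] by blast
    moreover obtain D' where "D' \<in> B" "y \<in> D'" "D' \<subseteq> D" using B(3)[OF CD(2,4)] by blast
    ultimately show "\<exists>V\<in>(\<lambda>(a, b). a \<times> b) ` (A \<times> B). z \<in> V \<and> V \<subseteq> U"
      using xy CD(5) by (intro bexI[of _ "C' \<times> D'"]) auto
  qed
  have m1: "fst \<in> borel_of ?P \<rightarrow>\<^sub>M X"
  proof -
    have "fst \<in> borel_of ?P \<rightarrow>\<^sub>M borel_of S"
      unfolding borel_of_def[of S]
    proof (rule measurable_measure_of)
      fix U assume "U \<in> {U. openin S U}"
      then have "openin ?P {z \<in> topspace ?P. fst z \<in> U}"
        using continuous_map_fst unfolding continuous_map_def by fast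
      moreover have "fst -` U \<inter> space (borel_of ?P) = {z \<in> topspace ?P. fst z \<in> U}" by auto
      ultimately show "fst -` U \<inter> space (borel_of ?P) \<in> sets (borel_of ?P)"
        by (simp add: sets_borel_of)
    qed (auto dest: openin_subset)
    then show ?thesis by (simp add: measurable_cong_sets[OF refl S(3)])
  qed
  have m2: "snd \<in> borel_of ?P \<rightarrow>\<^sub>M Y"
  proof -
    have "snd \<in> borel_of ?P \<rightarrow>\<^sub>M borel_of T"
      unfolding borel_of_def[of T]
    proof (rule measurable_measure_of)
      fix U assume "U \<in> {U. openin T U}"
      then have "openin ?P {z \<in> topspace ?P. snd z \<in> U}"
        using continuous_map_snd unfolding continuous_map_def by fast
      moreover have "snd -` U \<inter> space (borel_of ?P) = {z \<in> topspace ?P. snd z \<in> U}" by auto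
      ultimately show "snd -` U \<inter> space (borel_of ?P) \<in> sets (borel_of ?P)"
        by (simp add: sets_borel_of)
    qed (auto dest: openin_subset)
    then show ?thesis by (simp add: measurable_cong_sets[OF refl T(3)])
  qed
  have sp: "space (X \<Otimes>\<^sub>M Y) = topspace ?P" by (simp add: space_pair_measure S T)
  have idm: "id \<in> borel_of ?P \<rightarrow>\<^sub>M X \<Otimes>\<^sub>M Y"
    using measurable_Pair[OF m1 m2] by (simp add: id_def)
  then have "S \<in> sets (borel_of ?P)" if "S \<in> sets (X \<Otimes>\<^sub>M Y)" for S
  proof -
    have "id -` S \<inter> space (borel_of ?P) \<in> sets (borel_of ?P)"
      using idm that by (rule measurable_sets)
    moreover have "S \<subseteq> topspace ?P" using sets.sets_into_space[OF that] sp by simp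
    ultimately show ?thesis by (simp add: Int_absorb2 del: topspace_prod_topology)
  qed
  then have "sets (X \<Otimes>\<^sub>M Y) \<subseteq> sets (borel_of ?P)" by blast
  moreover have "sets (borel_of ?P) \<subseteq> sets (X \<Otimes>\<^sub>M Y)"
    unfolding sets_borel_of sp[symmetric] by (rule sets.sigma_sets_subset) (auto intro: op)
  ultimately show ?thesis
    using polish_topology_prod[OF S(1) T(1)] sp unfolding standard_borel_def by blast
qed

text \<open>A substitute for refinements of the Polish topology: enlarging such a family of covers is easier
  than making Borel sets clopen, and it still turns nested nonempty sets into points.\<close>

definition complete_covers :: "'a measure \<Rightarrow> 'a set set set \<Rightarrow> bool" where
  "complete_covers M \<U> \<longleftrightarrow> countable \<U> \<and> \<U> \<noteq> {} \<and>
     (\<forall>C\<in>\<U>. countable C \<and> C \<subseteq> sets M \<and> \<Union>C = space M) \<and>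
     (\<forall>W. (\<forall>C\<in>\<U>. W C \<in> C) \<and> (\<forall>\<F>. finite \<F> \<and> \<F> \<subseteq> \<U> \<and> \<F> \<noteq> {} \<longrightarrow> (\<Inter>C\<in>\<F>. W C) \<noteq> {}) \<longrightarrow>
        (\<exists>z. (\<Inter>C\<in>\<U>. W C) = {z}))"

lemma complete_coversD:
  assumes "complete_covers M \<U>" "\<And>C. C \<in> \<U> \<Longrightarrow> W C \<in> C"
    "\<And>\<F>. finite \<F> \<Longrightarrow> \<F> \<subseteq> \<U> \<Longrightarrow> \<F> \<noteq> {} \<Longrightarrow> (\<Inter>C\<in>\<F>. W C) \<noteq> {}"
  shows "\<exists>z. (\<Inter>C\<in>\<U>. W C) = {z}"
proof -
  have "\<forall>W. (\<forall>C\<in>\<U>. W C \<in> C) \<and> (\<forall>\<F>. finite \<F> \<and> \<F> \<subseteq> \<U> \<and> \<F> \<noteq> {} \<longrightarrow> (\<Inter>C\<in>\<F>. W C) \<noteq> {}) \<longrightarrow>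
      (\<exists>z. (\<Inter>C\<in>\<U>. W C) = {z})"
    using assms(1) unfolding complete_covers_def by (elim conjE)
  then show ?thesis using assms(2,3) by simp
qed

text \<open>A stand-in for clopenness: whether the limit of a selection lies in \<open>S\<close> can
  be read off from the one member selected from this cover.\<close>

definition decides :: "'a set set set \<Rightarrow> 'a set \<Rightarrow> bool" where
  "decides \<U> S \<longleftrightarrow> (\<exists>C\<in>\<U>. \<forall>U\<in>C. U \<subseteq> S \<or> U \<inter> S = {})"

text \<open>The common part \<B> is what allows families found for different sets to be merged by
  \<open>complete_covers_Union\<close>.\<close>

definition decidable_over :: "'a measure \<Rightarrow> 'a set set set \<Rightarrow> 'a set \<Rightarrow> bool" where
  "decidable_over M \<B> S \<longleftrightarrow> (\<exists>\<U>. complete_covers M \<U> \<and> \<B> \<subseteq> \<U> \<and> decides \<U> S)"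

text \<open>The limit points of a selection from different members of the family agree because they all
  agree with the limit point of its restriction to \<open>\<B>\<close>.\<close>

lemma complete_covers_Union:
  assumes c: "countable \<AA>" "\<AA> \<noteq> {}" and b: "complete_covers M \<B>"
    and u: "\<And>\<U>. \<U> \<in> \<AA> \<Longrightarrow> complete_covers M \<U> \<and> \<B> \<subseteq> \<U>"
  shows "complete_covers M (\<Union>\<AA>)"
  unfolding complete_covers_def
proof (intro conjI allI impI)
  show "countable (\<Union>\<AA>)" using c u unfolding complete_covers_def by (metis (no_types, lifting) countable_UN image_ident)
  show "\<Union>\<AA> \<noteq> {}" using c b u by (fastforce simp: complete_covers_def)
  show "\<forall>C\<in>\<Union>\<AA>. countable C \<and> C \<subseteq> sets M \<and> \<Union> C = space M" using u unfolding complete_covers_def by blast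
  fix W assume "(\<forall>C\<in>\<Union>\<AA>. W C \<in> C) \<and>
       (\<forall>\<F>. finite \<F> \<and> \<F> \<subseteq> \<Union>\<AA> \<and> \<F> \<noteq> {} \<longrightarrow> (\<Inter>C\<in>\<F>. W C) \<noteq> {})"
    note W = conjunct1[OF this] conjunct2[OF this]
  have "\<exists>z. (\<Inter>C\<in>\<U>. W C) = {z}" if "\<U> \<in> \<AA>" for \<U>
  proof (rule complete_coversD[of M])
    show "complete_covers M \<U>" using u that by blast
    show "W C \<in> C" if "C \<in> \<U>" for C using W(1) that \<open>\<U> \<in> \<AA>\<close> by blast
    show "(\<Inter>C\<in>\<F>. W C) \<noteq> {}" if "finite \<F>" "\<F> \<subseteq> \<U>" "\<F> \<noteq> {}" for \<F>
      using W(2)[rule_format, of \<F>] that Union_upper[OF \<open>\<U> \<in> \<AA>\<close>] by auto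
  qed
  then obtain z where z: "\<And>\<U>. \<U> \<in> \<AA> \<Longrightarrow> (\<Inter>C\<in>\<U>. W C) = {z \<U>}" by metis
  obtain \<U>0 where U0: "\<U>0 \<in> \<AA>" using c by auto
  have "\<exists>z0. (\<Inter>C\<in>\<B>. W C) = {z0}"
  proof (rule complete_coversD[OF b])
    have B: "\<B> \<subseteq> \<Union>\<AA>" using u U0 by blast
    show "W C \<in> C" if "C \<in> \<B>" for C using W(1) that B by blast
    show "(\<Inter>C\<in>\<F>. W C) \<noteq> {}" if "finite \<F>" "\<F> \<subseteq> \<B>" "\<F> \<noteq> {}" for \<F>
      using W(2)[rule_format, of \<F>] that B by auto
  qed
  then obtain z0 where z0: "(\<Inter>C\<in>\<B>. W C) = {z0}" by blast
  have "z \<U> = z0" if "\<U> \<in> \<AA>" for \<U>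
  proof -
    have "(\<Inter>C\<in>\<U>. W C) \<subseteq> (\<Inter>C\<in>\<B>. W C)" using u[OF that] by blast
    then show ?thesis using z[OF that] z0 by simp
  qed
  then have zW: "(\<Inter>C\<in>\<U>. W C) = {z0}" if "\<U> \<in> \<AA>" for \<U> using z that by simp
  have "(\<Inter>C\<in>\<Union>\<AA>. W C) = (\<Inter>\<U>\<in>\<AA>. \<Inter>C\<in>\<U>. W C)" by blast
  also have "\<dots> = {z0}" using zW U0 by auto
  finally show "\<exists>z. (\<Inter>C\<in>\<Union>\<AA>. W C) = {z}" by blast
qed

lemma decidable_over_simultaneously:
  assumes b: "complete_covers M \<B>" and S: "countable \<S>" "\<And>S. S \<in> \<S> \<Longrightarrow> decidable_over M \<B> S"
  shows "\<exists>\<U>. complete_covers M \<U> \<and> \<B> \<subseteq> \<U> \<and> (\<forall>S\<in>\<S>. decides \<U> S)"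
proof -
  obtain u where u: "\<And>S. S \<in> \<S> \<Longrightarrow> complete_covers M (u S) \<and> \<B> \<subseteq> u S \<and> decides (u S) S"
    using S(2) unfolding decidable_over_def by metis
  have "complete_covers M (\<Union>(insert \<B> (u ` \<S>)))"
    by (rule complete_covers_Union[OF _ _ b]) (use S b u in auto)
  moreover have "\<forall>S\<in>\<S>. decides (\<Union>(insert \<B> (u ` \<S>))) S"
  proof
    fix S assume "S \<in> \<S>"
    then show "decides (\<Union>(insert \<B> (u ` \<S>))) S" using u[of S] by (auto simp: decides_def)
  qed
  ultimately show ?thesis by blast
qed

lemma decidable_over_compl:
  assumes "decidable_over M \<B> S" shows "decidable_over M \<B> (space M - S)"
proof -
  obtain \<U> where u: "complete_covers M \<U>" "\<B> \<subseteq> \<U>" "decides \<U> S"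
    using assms unfolding decidable_over_def by blast
  then obtain C where C: "C \<in> \<U>" "\<And>U. U \<in> C \<Longrightarrow> U \<subseteq> S \<or> U \<inter> S = {}" unfolding decides_def by blast
  have "\<And>U. U \<in> C \<Longrightarrow> U \<subseteq> space M" using u(1) C(1) unfolding complete_covers_def by blast
  then have "decides \<U> (space M - S)" using C unfolding decides_def by blast
  then show ?thesis using u unfolding decidable_over_def by blast
qed

text \<open>A selection from a family deciding every \<open>S i\<close> already has a limit point.
  Adding one cover, made of the \<open>S i\<close> and the complement of their union, could spoil
  completeness only if the member selected from it missed this point, and the finite intersection
  property rules that out.\<close>

lemma decidable_over_Union:
  assumes b: "complete_covers M \<B>" and S: "\<And>i::nat. S i \<in> sets M" "\<And>i. decidable_over M \<B> (S i)"
  shows "decidable_over M \<B> (\<Union>i. S i)"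
proof -
  obtain \<U> where u: "complete_covers M \<U>" "\<B> \<subseteq> \<U>" "\<And>i. decides \<U> (S i)"
    using decidable_over_simultaneously[OF b, of "range S"] S by auto
  define D where "D = insert (space M - (\<Union>i. S i)) (range S)"
  have "complete_covers M (insert D \<U>)"
    unfolding complete_covers_def
  proof (intro conjI allI impI)
    show "countable (insert D \<U>)" using u by (auto simp: complete_covers_def)
    have "countable D" "D \<subseteq> sets M" "\<Union>D = space M"
      using S sets.sets_into_space[OF S(1)] by (auto simp: D_def)
    then show "\<forall>C\<in>insert D \<U>. countable C \<and> C \<subseteq> sets M \<and> \<Union> C = space M"
      using u by (auto simp: complete_covers_def)
    fix W assume "(\<forall>C\<in>insert D \<U>. W C \<in> C) \<and>
       (\<forall>\<F>. finite \<F> \<and> \<F> \<subseteq> insert D \<U> \<and> \<F> \<noteq> {} \<longrightarrow> (\<Inter>C\<in>\<F>. W C) \<noteq> {})"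
    note W = conjunct1[OF this] conjunct2[OF this]
    have "\<exists>z. (\<Inter>C\<in>\<U>. W C) = {z}"
    proof (rule complete_coversD[OF u(1)])
      show "W C \<in> C" if "C \<in> \<U>" for C using W(1) that by blast
      show "(\<Inter>C\<in>\<F>. W C) \<noteq> {}" if "finite \<F>" "\<F> \<subseteq> \<U>" "\<F> \<noteq> {}" for \<F>
        using W(2)[rule_format, of \<F>] that by auto
    qed
    then obtain z where z: "(\<Inter>C\<in>\<U>. W C) = {z}" by blast
    \<comment> \<open>The member selected from the cover deciding \<open>S i\<close> contains
      \<open>z\<close>, lies on one side of \<open>S i\<close> and meets \<open>W D\<close>; hence
      \<open>W D\<close> has a point on the same side of \<open>S i\<close> as
      \<open>z\<close>.\<close>
    have loc: "(z \<in> S i \<and> \<not> W D \<inter> S i = {}) \<or> (z \<notin> S i \<and> \<not> W D \<subseteq> S i)" for i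
    proof -
      obtain C where C: "C \<in> \<U>" "\<And>U. U \<in> C \<Longrightarrow> U \<subseteq> S i \<or> U \<inter> S i = {}"
        using u(3)[of i] unfolding decides_def by blast
      have "(\<Inter>C\<in>{C, D}. W C) \<noteq> {}" using W(2)[rule_format, of "{C, D}"] C(1) by simp
      then have "W C \<inter> W D \<noteq> {}" by auto
      moreover have "z \<in> W C" using z C(1) by blast
      moreover have "W C \<in> C" using W(1) C(1) by simp
      ultimately show ?thesis using C(2) by blast
    qed
    have "z \<in> W D"
    proof -
      have WD: "W D \<in> D" using W(1) by simp
      obtain C where C: "C \<in> \<U>" using u(1) by (auto simp: complete_covers_def)
      then have "z \<in> W C" "W C \<in> C" using W(1) z by auto
      then have "z \<in> space M" using u(1) C unfolding complete_covers_def by blast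
      then show ?thesis using loc WD unfolding D_def by auto blast
    qed
    then show "\<exists>z. (\<Inter>C\<in>insert D \<U>. W C) = {z}" using z by auto
  qed auto
  moreover have "decides (insert D \<U>) (\<Union>i. S i)"
    unfolding decides_def by (rule bexI[of _ D]) (auto simp: D_def)
  ultimately show ?thesis using u(2) unfolding decidable_over_def by blast
qed

text \<open>Covers by closed sets make completeness of the metric applicable, and they suffice to
  decide open sets. The covers added for countable unions need not be closed, so the induction over
  the sigma-algebra carries completeness of the family rather than closedness of its
  members.\<close>

lemma standard_borel_complete_covers:
  assumes "standard_borel M"
  shows "\<exists>\<B>. complete_covers M \<B> \<and> (\<forall>S\<in>sets M. decidable_over M \<B> S)"
proof -
  obtain T where T: "polish_topology T" "space M = topspace T" "sets M = sets (borel_of T)"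
    using assms unfolding standard_borel_def by blast
  obtain X d where md: "Metric_space X d" and mc: "Metric_space.mcomplete X d"
    and Td: "T = Metric_space.mtopology X d"
    using T(1) unfolding polish_topology_def completely_metrizable_space_def by blast
  interpret Metric_space X d by (rule md)
  have sp: "space M = X" using T(2) Td by simp
  obtain Q where Q: "countable Q" "Q \<subseteq> X" "T closure_of Q = X"
    using T(1) unfolding polish_topology_def separable_space_def Td by auto
  have dense: "\<exists>q\<in>Q. d q x < e" if "x \<in> X" "e > 0" for x e
  proof -
    have "x \<in> mtopology closure_of Q" using Q Td that by auto
    then show ?thesis unfolding metric_closure_of using that by (auto simp: commute in_mball)
  qed
  have opens: "U \<in> sets M" if "openin T U" for U using that T(3) by (auto simp: sets_borel_of)
  have closeds: "U \<in> sets M" if "closedin T U" for U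
  proof -
    have "space M - (topspace T - U) \<in> sets M"
      using that by (intro sets.compl_sets opens) auto
    then show ?thesis using that T(2) by (simp add: double_diff closedin_def)
  qed
  define K where "K n = (\<lambda>q. mcball q (1 / Suc n)) ` Q" for n :: nat
  have Kcov: "countable (K n)" "K n \<subseteq> sets M" "\<Union>(K n) = space M" "\<And>C. C \<in> K n \<Longrightarrow> closedin T C" for n
  proof -
    show "countable (K n)" using Q by (auto simp: K_def)
    show cl: "closedin T C" if "C \<in> K n" for C using that by (auto simp: K_def Td)
    then show "K n \<subseteq> sets M" using closeds by blast
    show "\<Union>(K n) = space M"
    proof
      show "space M \<subseteq> \<Union>(K n)"
      proof
        fix x assume "x \<in> space M"
        then obtain q where q: "q \<in> Q" "d q x < 1 / Suc n" using dense[of x "1 / Suc n"] sp by auto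
        then show "x \<in> \<Union>(K n)" using \<open>x \<in> space M\<close> sp Q(2) by (auto simp: K_def intro!: bexI[of _ q])
      qed
    qed (auto simp: K_def sp)
  qed
  \<comment> \<open>The covers \<open>K n\<close> put arbitrarily small sets into every selection,
    so the nested-set form of completeness yields exactly one point.\<close>
  have closed_complete: "complete_covers M \<U>"
    if u: "countable \<U>" "range K \<subseteq> \<U>" "\<And>C. C \<in> \<U> \<Longrightarrow> countable C \<and> \<Union>C = space M"
      "\<And>C U. C \<in> \<U> \<Longrightarrow> U \<in> C \<Longrightarrow> closedin T U" for \<U>
    unfolding complete_covers_def
  proof (intro conjI allI impI)
    show "\<U> \<noteq> {}" using u(2) by blast
    show "\<forall>C\<in>\<U>. countable C \<and> C \<subseteq> sets M \<and> \<Union> C = space M"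
      using u(3,4) closeds by (simp add: subset_eq)
    fix W assume "(\<forall>C\<in>\<U>. W C \<in> C) \<and> (\<forall>\<F>. finite \<F> \<and> \<F> \<subseteq> \<U> \<and> \<F> \<noteq> {} \<longrightarrow> (\<Inter>C\<in>\<F>. W C) \<noteq> {})"
    note W = conjunct1[OF this] conjunct2[OF this]
    have small: "\<exists>q\<in>Q. W (K n) = mcball q (1 / Suc n)" for n
    proof -
      have "W (K n) \<in> K n" using W(1) u(2) by blast
      then show ?thesis by (auto simp: K_def)
    qed
    define e where "e = from_nat_into \<U>"
    have e: "range e = \<U>" using range_from_nat_into[of \<U>] u(1,2) unfolding e_def by blast
    have eW: "closedin mtopology (W (e k))" for k
      using u(4)[of "e k" "W (e k)"] W(1) Td e by (metis rangeI)
    define V where "V n = (\<Inter>k\<le>n. W (e k))" for n :: nat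
    have "\<exists>l. l \<in> X \<and> \<Inter>(range V) = {l}"
    proof (rule mc[unfolded mcomplete_nest_sing, rule_format], intro conjI allI impI)
      show "closedin mtopology (V n)" for n
        unfolding V_def using eW by (intro closedin_Inter) auto
      show "V n \<noteq> {}" for n
        using W(2)[rule_format, of "e ` {..n}"] e by (auto simp: V_def)
      show "decseq V" by (auto simp: V_def decseq_def)
      fix r :: real assume "r > 0"
      then obtain n where n: "1 / Suc n < r" using nat_approx_posE by blast
      obtain q where "W (K n) = mcball q (1 / Suc n)" using small by blast
      moreover obtain m where "K n = e m" using e u(2) by blast
      ultimately have "V m \<subseteq> mcball q (1 / Suc n)" by (auto simp: V_def)
      also have "\<dots> \<subseteq> mcball q r" using n by (intro mcball_subset_concentric) simp
      finally show "\<exists>n a. V n \<subseteq> mcball a r" by blast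
    qed
    moreover have "\<Inter>(range V) = (\<Inter>C\<in>\<U>. W C)" using e by (auto simp: V_def)
    ultimately show "\<exists>z. (\<Inter>C\<in>\<U>. W C) = {z}" by auto
  qed (use u in auto)
  have base: "complete_covers M (range K)"
  proof (rule closed_complete)
    show "countable C \<and> \<Union>C = space M" if "C \<in> range K" for C
      using that Kcov(1,3) by (metis rangeE)
    show "closedin T U" if "C \<in> range K" "U \<in> C" for C U using that Kcov(4) by blast
  qed auto
  have opd: "decidable_over M (range K) U" if U: "openin T U" for U
  proof -
    \<comment> \<open>An open set is exhausted by the small closed balls around points of the dense
      set that it contains; with the closed complement they form a countable closed cover deciding
      it.\<close>
    define D where "D = insert (space M - U) ((\<lambda>(q, n). mcball q (1 / Suc n)) ` {(q, n::nat). q \<in> Q \<and> mcball q (1 / Suc n) \<subseteq> U})"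
    have cov: "x \<in> \<Union>D" if x: "x \<in> U" for x
    proof -
      obtain r where r: "r > 0" "mball x r \<subseteq> U" "x \<in> X" using U x unfolding Td openin_mtopology by blast
      obtain n where n: "1 / Suc n < r / 2" using nat_approx_posE[of "r/2"] r by auto
      obtain q where q: "q \<in> Q" "d q x < 1 / Suc n" using dense[of x "1 / Suc n"] r by auto
      have "mcball q (1 / Suc n) \<subseteq> mball x r"
      proof
        fix y assume y: "y \<in> mcball q (1 / Suc n)"
        then have "d x y \<le> d x q + d q y" using r by (intro triangle) auto
        then show "y \<in> mball x r" using y q n r by (auto simp: commute simp del: of_nat_Suc)
      qed
      then have "mcball q (1 / Suc n) \<in> D" using r q unfolding D_def by blast
      moreover have "x \<in> mcball q (1 / Suc n)" using q r Q by auto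
      ultimately show ?thesis by blast
    qed
    have U': "U \<subseteq> space M" using U T(2) openin_subset by auto
    have "complete_covers M (insert D (range K))"
    proof (rule closed_complete)
      have "countable {(q, n::nat). q \<in> Q \<and> mcball q (1 / Suc n) \<subseteq> U}"
        by (rule countable_subset[of _ "Q \<times> UNIV"]) (use Q in auto)
      then have "countable D" unfolding D_def by auto
      moreover have "\<Union>D = space M" using cov U' unfolding D_def by auto
      ultimately show "countable C \<and> \<Union>C = space M" if "C \<in> insert D (range K)" for C
        using that Kcov(1,3) by (metis insertE rangeE)
      have "closedin T (space M - U)" using U T(2) by auto
      moreover have "closedin T (mcball q r)" for q r unfolding Td by (rule closedin_mcball)
      ultimately have "closedin T V" if "V \<in> D" for V
        using that unfolding D_def by fastforce
      then show "closedin T V" if "C \<in> insert D (range K)" "V \<in> C" for C V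
        using that Kcov(4) by blast
    qed auto
    moreover have "decides (insert D (range K)) U"
      unfolding decides_def by (rule bexI[of _ D]) (auto simp: D_def)
    ultimately show ?thesis unfolding decidable_over_def by blast
  qed
  have "decidable_over M (range K) S" if "S \<in> sets M" for S
  proof -
    have "S \<in> sigma_sets (space M) {U. openin T U}" using that T by (simp add: sets_borel_of)
    then show ?thesis
    proof (induction rule: sigma_sets.induct)
      case (Basic a) then show ?case using opd by simp
    next
      case Empty show ?case using opd by simp
    next
      case (Compl a) then show ?case by (intro decidable_over_compl)
    next
      case (Union a)
      then show ?case using T by (intro decidable_over_Union[OF base]) (auto simp: sets_borel_of)
    qed
  qed
  then show ?thesis using base by blast
qed

corollary standard_borel_deciding_covers:
  assumes "standard_borel M" "countable \<S>" "\<S> \<subseteq> sets M"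
  obtains \<U> where "complete_covers M \<U>" "\<And>S. S \<in> \<S> \<Longrightarrow> decides \<U> S"
proof -
  obtain \<B> where "complete_covers M \<B>" "\<forall>S\<in>sets M. decidable_over M \<B> S"
    using standard_borel_complete_covers[OF assms(1)] by blast
  then show ?thesis
    using decidable_over_simultaneously[of M \<B> \<S>] assms that by blast
qed

lemma standard_borel_separating:
  assumes "standard_borel M"
  obtains \<S> where "countable \<S>" "\<S> \<subseteq> sets M"
    "\<And>x y. x \<in> space M \<Longrightarrow> y \<in> space M \<Longrightarrow> x \<noteq> y \<Longrightarrow> \<exists>S\<in>\<S>. x \<in> S \<and> y \<notin> S"
proof -
  obtain T where T: "polish_topology T" "space M = topspace T" "sets M = sets (borel_of T)"
    using assms unfolding standard_borel_def by blast
  obtain A where A: "countable A" "\<And>V. V \<in> A \<Longrightarrow> openin T V"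
    "\<And>U x. openin T U \<Longrightarrow> x \<in> U \<Longrightarrow> \<exists>V\<in>A. x \<in> V \<and> V \<subseteq> U"
    using polish_topology_second_countable[OF T(1)] unfolding second_countable_def by metis
  have "Hausdorff_space T"
    using T(1) by (simp add: polish_topology_def completely_metrizable_imp_metrizable_space metrizable_imp_Hausdorff_space)
  then have "\<exists>S\<in>A. x \<in> S \<and> y \<notin> S" if "x \<in> space M" "y \<in> space M" "x \<noteq> y" for x y
    using that A(3) T(2) unfolding Hausdorff_space_def disjnt_iff by (metis subsetD)
  then show ?thesis using A T(3) by (intro that[of A]) (auto simp: sets_borel_of)
qed

section \<open>Separation and injective images\<close>

lemma sets_Collect_Ball_countable:
  assumes "countable I" "\<And>i. i \<in> I \<Longrightarrow> {x \<in> space M. P i x} \<in> sets M"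
  shows "{x \<in> space M. \<forall>i\<in>I. P i x} \<in> sets M"
proof (cases "I = {}")
  case False
  then have "{x \<in> space M. \<forall>i\<in>I. P i x} = (\<Inter>i\<in>I. {x \<in> space M. P i x})" by blast
  also have "\<dots> \<in> sets M" using assms False by (intro sets.countable_INT') auto
  finally show ?thesis .
qed simp

lemma complete_covers_basic:
  assumes "complete_covers M \<U>"
  shows "countable \<U>" "\<U> \<noteq> {}" "C \<in> \<U> \<Longrightarrow> countable C" "C \<in> \<U> \<Longrightarrow> \<Union>C = space M" "C \<in> \<U> \<Longrightarrow> C \<subseteq> sets M"
proof -
  have "countable \<U> \<and> \<U> \<noteq> {} \<and> (\<forall>C\<in>\<U>. countable C \<and> C \<subseteq> sets M \<and> \<Union>C = space M)"
    using assms unfolding complete_covers_def by (elim conjE) (intro conjI)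
  then show "countable \<U>" "\<U> \<noteq> {}" "C \<in> \<U> \<Longrightarrow> countable C" "C \<in> \<U> \<Longrightarrow> \<Union>C = space M" "C \<in> \<U> \<Longrightarrow> C \<subseteq> sets M"
    by auto
qed

text \<open>Finitely many selected members contain a common \<open>U n\<close>, so the selection has
  a limit. This limit need not belong to the sets \<open>U n\<close>, which may fail to be closed in
  any sense; only for decided sets can membership be transferred.\<close>

lemma complete_covers_branch:
  assumes c: "complete_covers M \<U>"
    and W: "\<And>n. W n \<in> from_nat_into \<U> n"
    and U: "\<And>n. U (Suc n) \<subseteq> U n \<inter> W n" "\<And>n. U n \<noteq> {}"
  obtains z where "z \<in> space M"
    "\<And>S. decides \<U> S \<Longrightarrow> z \<in> S \<Longrightarrow> \<exists>n. U n \<subseteq> S"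
    "\<And>S. decides \<U> S \<Longrightarrow> z \<notin> S \<Longrightarrow> \<exists>n. U n \<inter> S = {}"
proof -
  note cu = complete_covers_basic(1,2)[OF c] and cov = complete_covers_basic(4)[OF c]
  have dec: "U n \<subseteq> U m" if "m \<le> n" for m n
    by (rule lift_Suc_antimono_le[of U]) (use U(1) that in auto)
  define w where "w C = W (to_nat_on \<U> C)" for C
  have w: "w C \<in> C" if "C \<in> \<U>" for C
    using W[of "to_nat_on \<U> C"] cu that by (simp add: w_def)
  have Uw: "U n \<subseteq> w C" if "to_nat_on \<U> C < n" for C n
    using U(1)[of "to_nat_on \<U> C"] dec[of "Suc (to_nat_on \<U> C)" n] that unfolding w_def by auto
  have "\<exists>z. (\<Inter>C\<in>\<U>. w C) = {z}"
  proof (rule complete_coversD[OF c w])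
    fix \<F> assume F: "finite \<F>" "\<F> \<subseteq> \<U>" "\<F> \<noteq> {}"
    define n where "n = Suc (Max (to_nat_on \<U> ` \<F>))"
    have "U n \<subseteq> w C" if "C \<in> \<F>" for C
      using F that by (intro Uw) (simp add: n_def less_Suc_eq_le)
    then show "(\<Inter>C\<in>\<F>. w C) \<noteq> {}" using U(2)[of n] by blast
  qed
  then obtain z where z: "(\<Inter>C\<in>\<U>. w C) = {z}" by blast
  then have zw: "z \<in> w C" if "C \<in> \<U>" for C using that by blast
  show ?thesis
  proof (rule that)
    obtain C where "C \<in> \<U>" using cu by blast
    then show "z \<in> space M" using zw w cov by blast
  next
    fix S assume "decides \<U> S"
    then obtain C where C: "C \<in> \<U>" "\<And>V. V \<in> C \<Longrightarrow> V \<subseteq> S \<or> V \<inter> S = {}"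
      unfolding decides_def by blast
    note 1 = C(2)[OF w[OF C(1)]] zw[OF C(1)] Uw[of C "Suc (to_nat_on \<U> C)"]
    show "\<exists>n. U n \<subseteq> S" if "z \<in> S" using 1 that by (intro exI[of _ "Suc (to_nat_on \<U> C)"]) auto
    show "\<exists>n. U n \<inter> S = {}" if "z \<notin> S" using 1 that by (intro exI[of _ "Suc (to_nat_on \<U> C)"]) auto
  qed
qed

text \<open>Lusin's separation argument: inseparability of two sets passes to some pair of pieces
  when both are cut by a countable cover. Cutting along all covers gives limits \<open>z\<close> in
  \<open>A\<close> and \<open>z'\<close> in \<open>A'\<close>; their images differ, and a set
  separating these images separates the pieces at some finite stage, a contradiction.\<close>

lemma borel_separation:
  fixes \<pi> :: "'a \<Rightarrow> 'b"
  assumes M: "standard_borel M" and \<S>: "countable \<S>" "\<S> \<subseteq> sets N"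
    "\<And>x y. x \<in> space N \<Longrightarrow> y \<in> space N \<Longrightarrow> x \<noteq> y \<Longrightarrow> \<exists>S\<in>\<S>. x \<in> S \<and> y \<notin> S"
    and \<pi>: "\<pi> \<in> M \<rightarrow>\<^sub>M N" and A: "A \<in> sets M" "A' \<in> sets M" "\<pi> ` A \<inter> \<pi> ` A' = {}"
  shows "\<exists>B\<in>sets N. \<pi> ` A \<subseteq> B \<and> B \<inter> \<pi> ` A' = {}"
proof (rule ccontr)
  define sep where "sep U U' \<longleftrightarrow> (\<exists>B\<in>sets N. \<pi> ` U \<subseteq> B \<and> B \<inter> \<pi> ` U' = {})" for U U'
  assume "\<not> (\<exists>B\<in>sets N. \<pi> ` A \<subseteq> B \<and> B \<inter> \<pi> ` A' = {})"
  then have nsep: "\<not> sep A A'" by (simp add: sep_def)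
  have "countable (insert A (insert A' ((\<lambda>S. \<pi> -` S \<inter> space M) ` \<S>)))"
    "insert A (insert A' ((\<lambda>S. \<pi> -` S \<inter> space M) ` \<S>)) \<subseteq> sets M"
    using \<S> A \<pi> by (auto intro: measurable_sets)
  then obtain \<U> where u: "complete_covers M \<U>" and dec: "decides \<U> A" "decides \<U> A'"
    "\<And>S. S \<in> \<S> \<Longrightarrow> decides \<U> (\<pi> -` S \<inter> space M)"
    using standard_borel_deciding_covers[OF M] by (metis (no_types, lifting) image_eqI insertCI)
  define e where "e = from_nat_into \<U>"
  have e: "e n \<in> \<U>" for n using from_nat_into[OF complete_covers_basic(2)[OF u]] by (simp add: e_def)
  \<comment> \<open>If all pairs of pieces had separators \<open>b V V'\<close>, the union over
    \<open>V\<close> of the intersections over \<open>V'\<close> would separate the whole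
    sets.\<close>
  have step: "\<exists>V\<in>C. \<exists>V'\<in>C. \<not> sep (U \<inter> V) (U' \<inter> V')"
    if n: "\<not> sep U U'" and C: "C \<in> \<U>" and s: "U \<subseteq> space M" "U' \<subseteq> space M" for U U' C
  proof (rule ccontr)
    have Cc: "countable C" "\<Union>C = space M" using complete_covers_basic(3,4)[OF u C] by auto
    have "C \<noteq> {}"
    proof
      assume "C = {}"
      then have "U = {}" using Cc s by auto
      then show False using n by (auto simp: sep_def intro!: bexI[of _ "{}"])
    qed
    assume "\<not> ?thesis"
    then have "\<forall>V\<in>C. \<forall>V'\<in>C. \<exists>B\<in>sets N. \<pi> ` (U \<inter> V) \<subseteq> B \<and> B \<inter> \<pi> ` (U' \<inter> V') = {}"
      by (simp add: sep_def)
    then obtain b where b: "\<And>V V'. V \<in> C \<Longrightarrow> V' \<in> C \<Longrightarrow>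
        b V V' \<in> sets N \<and> \<pi> ` (U \<inter> V) \<subseteq> b V V' \<and> b V V' \<inter> \<pi> ` (U' \<inter> V') = {}"
      by metis
    have "(\<Inter>V'\<in>C. b V V') \<in> sets N" if "V \<in> C" for V
      using b that Cc(1) \<open>C \<noteq> {}\<close> by (intro sets.countable_INT') auto
    then have "(\<Union>V\<in>C. \<Inter>V'\<in>C. b V V') \<in> sets N"
      using Cc(1) by (intro sets.countable_UN') auto
    moreover have "\<pi> ` U \<subseteq> (\<Union>V\<in>C. \<Inter>V'\<in>C. b V V')"
    proof
      fix y assume "y \<in> \<pi> ` U"
      then obtain x where x: "x \<in> U" "y = \<pi> x" by blast
      then obtain V where "V \<in> C" "x \<in> V" using s Cc by blast
      then show "y \<in> (\<Union>V\<in>C. \<Inter>V'\<in>C. b V V')" using b x by blast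
    qed
    moreover have "(\<Union>V\<in>C. \<Inter>V'\<in>C. b V V') \<inter> \<pi> ` U' = {}"
    proof -
      have False if x: "x \<in> U'" "V \<in> C" "\<And>V'. V' \<in> C \<Longrightarrow> \<pi> x \<in> b V V'" for x V
      proof -
        obtain V' where "V' \<in> C" "x \<in> V'" using s Cc x by blast
        then show False using b[of V V'] x by blast
      qed
      then show ?thesis by blast
    qed
    ultimately show False using n unfolding sep_def by blast
  qed
  have "\<exists>f. \<forall>n. (\<not> sep (fst (f n)) (snd (f n)) \<and> fst (f n) \<subseteq> A \<and> snd (f n) \<subseteq> A') \<and>
     (\<exists>V\<in>e n. \<exists>V'\<in>e n. f (Suc n) = (fst (f n) \<inter> V, snd (f n) \<inter> V'))"
  proof (rule dependent_nat_choice)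
    show "\<exists>x. \<not> sep (fst x) (snd x) \<and> fst x \<subseteq> A \<and> snd x \<subseteq> A'"
      using nsep by (intro exI[of _ "(A, A')"]) auto
  next
    fix x n assume x: "\<not> sep (fst x) (snd x) \<and> fst x \<subseteq> A \<and> snd x \<subseteq> A'"
    then obtain V V' where "V \<in> e n" "V' \<in> e n" "\<not> sep (fst x \<inter> V) (snd x \<inter> V')"
      using step[OF _ e, of "fst x" "snd x" n] A(1,2)[THEN sets.sets_into_space] by (meson subset_trans)
    then show "\<exists>y. (\<not> sep (fst y) (snd y) \<and> fst y \<subseteq> A \<and> snd y \<subseteq> A') \<and>
       (\<exists>V\<in>e n. \<exists>V'\<in>e n. y = (fst x \<inter> V, snd x \<inter> V'))"
      using x by (intro exI[of _ "(fst x \<inter> V, snd x \<inter> V')"]) auto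
  qed
  then obtain f where f: "\<And>n. \<not> sep (fst (f n)) (snd (f n))" "\<And>n. fst (f n) \<subseteq> A" "\<And>n. snd (f n) \<subseteq> A'"
    "\<And>n. \<exists>V\<in>e n. \<exists>V'\<in>e n. f (Suc n) = (fst (f n) \<inter> V, snd (f n) \<inter> V')" by metis
  then obtain V V' where V: "\<And>n. V n \<in> e n" "\<And>n. V' n \<in> e n"
    "\<And>n. f (Suc n) = (fst (f n) \<inter> V n, snd (f n) \<inter> V' n)" by metis
  have sep1: "sep {} U'" for U' by (auto simp: sep_def intro!: bexI[of _ "{}"])
  have sep2: "sep U {}" if "U \<subseteq> A" for U
    unfolding sep_def using that sets.sets_into_space[OF A(1)] measurable_space[OF \<pi>]
    by (intro bexI[of _ "space N"]) auto
  have ne: "fst (f n) \<noteq> {}" "snd (f n) \<noteq> {}" for n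
    using f(1)[of n] sep1[of "snd (f n)"] sep2[OF f(2)[of n]] by metis+
  obtain z where z: "z \<in> space M" "\<And>S. decides \<U> S \<Longrightarrow> z \<in> S \<Longrightarrow> \<exists>n. fst (f n) \<subseteq> S"
    "\<And>S. decides \<U> S \<Longrightarrow> z \<notin> S \<Longrightarrow> \<exists>n. fst (f n) \<inter> S = {}"
    using complete_covers_branch[OF u, of V "\<lambda>n. fst (f n)"] V ne by (auto simp: e_def)
  obtain z' where z': "z' \<in> space M" "\<And>S. decides \<U> S \<Longrightarrow> z' \<in> S \<Longrightarrow> \<exists>n. snd (f n) \<subseteq> S"
    "\<And>S. decides \<U> S \<Longrightarrow> z' \<notin> S \<Longrightarrow> \<exists>n. snd (f n) \<inter> S = {}"
    using complete_covers_branch[OF u, of V' "\<lambda>n. snd (f n)"] V ne by (auto simp: e_def)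
  have "z \<in> A" using z(3)[OF dec(1)] f(2) ne by blast
  moreover have "z' \<in> A'" using z'(3)[OF dec(2)] f(3) ne by blast
  ultimately have "\<pi> z \<noteq> \<pi> z'" using A(3) by blast
  then obtain S where S: "S \<in> \<S>" "\<pi> z \<in> S" "\<pi> z' \<notin> S"
    using \<S>(3)[of "\<pi> z" "\<pi> z'"] measurable_space[OF \<pi> z(1)] measurable_space[OF \<pi> z'(1)] by blast
  obtain n where n: "fst (f n) \<subseteq> \<pi> -` S \<inter> space M" using z(2)[OF dec(3)[OF S(1)]] z(1) S by auto
  obtain m where m: "snd (f m) \<inter> (\<pi> -` S \<inter> space M) = {}" using z'(3)[OF dec(3)[OF S(1)]] S by auto
  have d: "fst (f (n + m)) \<subseteq> fst (f n)" "snd (f (n + m)) \<subseteq> snd (f m)"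
    by (rule lift_Suc_antimono_le[of "\<lambda>n. fst (f n)"], simp_all add: V(3))
      (rule lift_Suc_antimono_le[of "\<lambda>n. snd (f n)"], simp_all add: V(3))
  have "sep (fst (f (n + m))) (snd (f (n + m)))"
    unfolding sep_def
  proof (intro bexI[of _ S] conjI)
    show "\<pi> ` fst (f (n + m)) \<subseteq> S" using d n by blast
    have "snd (f (n + m)) \<subseteq> space M" using f(3) A(2)[THEN sets.sets_into_space] by blast
    then show "S \<inter> \<pi> ` snd (f (n + m)) = {}" using d m by blast
  qed (use S \<S> in blast)
  then show False using f(1) by blast
qed

text \<open>Separating the images of the members of the covers recovers, from a point of the image, the
  covers' selection that determines its preimage.\<close>

theorem lusin_souslin:
  fixes \<pi> :: "'a \<Rightarrow> 'b"
  assumes M: "standard_borel M" and \<S>: "countable \<S>" "\<S> \<subseteq> sets N"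
    "\<And>x y. x \<in> space N \<Longrightarrow> y \<in> space N \<Longrightarrow> x \<noteq> y \<Longrightarrow> \<exists>S\<in>\<S>. x \<in> S \<and> y \<notin> S"
    and \<pi>: "\<pi> \<in> M \<rightarrow>\<^sub>M N" and Q: "Q \<in> sets M" "inj_on \<pi> Q"
  shows "\<pi> ` Q \<in> sets N"
proof (cases "space M = {}")
  case True
  then have "Q = {}" using Q sets.sets_into_space by blast
  then show ?thesis by simp
next
  case False
  define P where "P S = \<pi> -` S \<inter> space M" for S
  have "countable (insert Q (P ` \<S>))" "insert Q (P ` \<S>) \<subseteq> sets M"
    using \<S> Q \<pi> by (auto simp: P_def intro: measurable_sets)
  then obtain \<U> where u: "complete_covers M \<U>" and dec: "decides \<U> Q"
    "\<And>S. S \<in> \<S> \<Longrightarrow> decides \<U> (P S)"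
    using standard_borel_deciding_covers[OF M] by (metis (no_types, lifting) image_eqI insertCI)
  define e where "e = from_nat_into \<U>"
  have e: "e n \<in> \<U>" for n using from_nat_into[OF complete_covers_basic(2)[OF u]] by (simp add: e_def)
  have re: "range e = \<U>"
    unfolding e_def using complete_covers_basic(1,2)[OF u] by (intro range_from_nat_into)
  have Cc: "countable (e n)" "\<Union>(e n) = space M" "e n \<subseteq> sets M" for n
    using complete_covers_basic(3-5)[OF u e] by auto
  define V where "V n i = from_nat_into (e n) i" for n i
  have rV: "range (V n) = e n" for n
  proof -
    have "e n \<noteq> {}" using Cc(2)[of n] False by auto
    then show ?thesis using Cc(1)[of n] unfolding V_def by (simp add: range_from_nat_into)
  qed
  \<comment> \<open>Injectivity on \<open>Q\<close> makes the images of
    \<open>Q \<inter> V n i\<close> and \<open>Q - V n i\<close> disjoint, so the separator detects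
    from \<open>\<pi> z\<close> whether \<open>z\<close> lies in \<open>V n i\<close>.\<close>
  have "\<exists>B\<in>sets N. \<pi> ` (Q \<inter> V n i) \<subseteq> B \<and> B \<inter> \<pi> ` (Q - V n i) = {}" for n i
  proof (rule borel_separation[OF M \<S> \<pi>])
    have "V n i \<in> sets M" using rV[of n] Cc[of n] by blast
    then show "Q \<inter> V n i \<in> sets M" "Q - V n i \<in> sets M" using Q by auto
    show "\<pi> ` (Q \<inter> V n i) \<inter> \<pi> ` (Q - V n i) = {}" using Q(2) by (auto dest: inj_onD)
  qed
  then obtain B where B: "\<And>n i. B n i \<in> sets N" "\<And>n i. \<pi> ` (Q \<inter> V n i) \<subseteq> B n i"
    "\<And>n i. B n i \<inter> \<pi> ` (Q - V n i) = {}" by metis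
  define \<iota> where "\<iota> n x = (LEAST i. x \<in> B n i)" for n x
  have \<iota>: "\<iota> n \<in> N \<rightarrow>\<^sub>M count_space UNIV" for n
    unfolding \<iota>_def using B(1) by (intro measurable_Least) (auto simp: pred_sets1 pred_def Int_def[symmetric])
  have setM: "{x \<in> space N. R (\<iota> n x)} \<in> sets N" for n and R :: "nat \<Rightarrow> bool"
  proof -
    have "\<iota> n -` {i. R i} \<inter> space N \<in> sets N" using \<iota> by (rule measurable_sets) simp
    moreover have "\<iota> n -` {i. R i} \<inter> space N = {x \<in> space N. R (\<iota> n x)}" by blast
    ultimately show ?thesis by (rule subst[rotated])
  qed
  have decx: "\<exists>n. \<forall>i. V n i \<subseteq> S \<or> V n i \<inter> S = {}" if "decides \<U> S" for S
    using that rV re unfolding decides_def by (metis (no_types, lifting) rangeE rangeI)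
  then obtain q where q: "\<And>i. V q i \<subseteq> Q \<or> V q i \<inter> Q = {}" using dec(1) by meson
  obtain r where r: "\<And>S i. S \<in> \<S> \<Longrightarrow> V (r S) i \<subseteq> P S \<or> V (r S) i \<inter> P S = {}"
  proof -
    have "\<forall>S\<in>\<S>. \<exists>n. \<forall>i. V n i \<subseteq> P S \<or> V n i \<inter> P S = {}"
      using decx dec(2) by simp
    from bchoice[OF this] show ?thesis using that by blast
  qed
  \<comment> \<open>The first \<open>n + 1\<close> indices are recorded in a list: there are
    countably many lists, and the truth of \<open>FIP n l\<close> does not depend on
    \<open>x\<close>, which makes the condition in \<open>K\<close> measurable.\<close>
  define FIP where "FIP n l \<longleftrightarrow> (\<Inter>k\<le>n. V k (l ! k)) \<noteq> {}" for n l
  \<comment> \<open>The conditions say in turn that the selection read off from \<open>x\<close> is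
    defined, that it has a limit point, that this point lies in \<open>Q\<close>, and that its image
    belongs to the same separating sets as \<open>x\<close>, hence equals \<open>x\<close>.\<close>
  define K where "K = {x \<in> space N. (\<forall>n. \<exists>i. x \<in> B n i) \<and>
     (\<forall>n. \<exists>l::nat list. FIP n l \<and> (\<forall>k\<in>{..n}. \<iota> k x = l ! k)) \<and>
     V q (\<iota> q x) \<subseteq> Q \<and> (\<forall>S\<in>\<S>. x \<in> S \<longleftrightarrow> V (r S) (\<iota> (r S) x) \<subseteq> P S)}"
  have "K \<in> sets N"
  proof -
    have "{x \<in> space N. x \<in> B n i} \<in> sets N" for n i
    proof -
      have "{x \<in> space N. x \<in> B n i} = B n i" using sets.sets_into_space[OF B(1)[of n i]] by blast
      then show ?thesis using B(1)[of n i] by (rule ssubst)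
    qed
    then have 1: "{x \<in> space N. \<forall>n. \<exists>i. x \<in> B n i} \<in> sets N"
      by (intro sets.sets_Collect_countable_All sets.sets_Collect_countable_Ex)
    have "{x \<in> space N. \<iota> k x = j} \<in> sets N" for k j
      using setM[of "\<lambda>i. i = j" k] .
    then have 2: "{x \<in> space N. \<forall>n. \<exists>l::nat list. FIP n l \<and> (\<forall>k\<in>{..n}. \<iota> k x = l ! k)} \<in> sets N"
      by (intro sets.sets_Collect_countable_All sets.sets_Collect_countable_Ex sets.sets_Collect_conj
          sets.sets_Collect_const sets.sets_Collect_finite_All) auto
    have 3: "{x \<in> space N. V q (\<iota> q x) \<subseteq> Q} \<in> sets N"
      by (rule setM)
    have 4: "{x \<in> space N. x \<in> S \<longleftrightarrow> V (r S) (\<iota> (r S) x) \<subseteq> P S} \<in> sets N" if "S \<in> \<S>" for S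
    proof -
      have "S \<in> sets N" using that \<S> by blast
      moreover have "{x \<in> space N. V (r S) (\<iota> (r S) x) \<subseteq> P S} \<in> sets N"
        by (rule setM)
      ultimately have "(S \<inter> {x \<in> space N. V (r S) (\<iota> (r S) x) \<subseteq> P S}) \<union>
          (space N - (S \<union> {x \<in> space N. V (r S) (\<iota> (r S) x) \<subseteq> P S})) \<in> sets N" by auto
      moreover have "(S \<inter> {x \<in> space N. V (r S) (\<iota> (r S) x) \<subseteq> P S}) \<union>
          (space N - (S \<union> {x \<in> space N. V (r S) (\<iota> (r S) x) \<subseteq> P S})) =
          {x \<in> space N. x \<in> S \<longleftrightarrow> V (r S) (\<iota> (r S) x) \<subseteq> P S}"
        using sets.sets_into_space[OF \<open>S \<in> sets N\<close>] by blast
      ultimately show ?thesis by simp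
    qed
    have 5: "{x \<in> space N. \<forall>S\<in>\<S>. x \<in> S \<longleftrightarrow> V (r S) (\<iota> (r S) x) \<subseteq> P S} \<in> sets N"
      using \<S>(1) 4 by (rule sets_Collect_Ball_countable)
    show ?thesis unfolding K_def using 1 2 3 5 by (intro sets.sets_Collect_conj)
  qed
  moreover have "\<pi> ` Q = K"
  proof
    show "\<pi> ` Q \<subseteq> K"
    proof
      fix x assume "x \<in> \<pi> ` Q"
      then obtain z where z: "z \<in> Q" "x = \<pi> z" by blast
      have zM: "z \<in> space M" using z Q sets.sets_into_space by blast
      have ex: "\<exists>i. x \<in> B n i" for n
      proof -
        obtain i where "z \<in> V n i" using zM Cc(2)[of n] rV[of n] by blast
        then show ?thesis using B(2)[of n i] z by blast
      qed
      have "x \<in> B n (\<iota> n x)" for n unfolding \<iota>_def using ex LeastI_ex by fast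
      then have zV: "z \<in> V n (\<iota> n x)" for n using B(3)[of n "\<iota> n x"] z by blast
      have fip: "\<exists>l::nat list. FIP n l \<and> (\<forall>k\<in>{..n}. \<iota> k x = l ! k)" for n
      proof (intro exI conjI)
        have l: "map (\<lambda>k. \<iota> k x) [0..<Suc n] ! k = \<iota> k x" if "k \<le> n" for k
          using that by (simp del: upt_Suc)
        show "\<forall>k\<in>{..n}. \<iota> k x = map (\<lambda>k. \<iota> k x) [0..<Suc n] ! k" using l by simp
        have "z \<in> (\<Inter>k\<le>n. V k (map (\<lambda>k. \<iota> k x) [0..<Suc n] ! k))"
        proof
          fix k assume "k \<in> {..n}"
          then show "z \<in> V k (map (\<lambda>k. \<iota> k x) [0..<Suc n] ! k)" using zV l by simp
        qed
        then show "FIP n (map (\<lambda>k. \<iota> k x) [0..<Suc n])" unfolding FIP_def by blast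
      qed
      have "V q (\<iota> q x) \<subseteq> Q" using q[of "\<iota> q x"] zV[of q] z by blast
      moreover have "x \<in> S \<longleftrightarrow> V (r S) (\<iota> (r S) x) \<subseteq> P S" if "S \<in> \<S>" for S
        using r[OF that, of "\<iota> (r S) x"] zV[of "r S"] z zM unfolding P_def by blast
      ultimately show "x \<in> K"
        unfolding K_def using ex fip z zM measurable_space[OF \<pi>] by simp
    qed
    show "K \<subseteq> \<pi> ` Q"
    proof
      fix x assume x: "x \<in> K"
      then have xN: "x \<in> space N" and xS: "\<And>S. S \<in> \<S> \<Longrightarrow> x \<in> S \<longleftrightarrow> V (r S) (\<iota> (r S) x) \<subseteq> P S"
        unfolding K_def by simp_all
      define U where "U n = (\<Inter>k<n. V k (\<iota> k x))" for n
      have Une: "U n \<noteq> {}" for n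
      proof -
        obtain l :: "nat list" where "FIP n l" and l: "\<forall>k\<in>{..n}. \<iota> k x = l ! k"
          using x unfolding K_def by blast
        then have "(\<Inter>k\<le>n. V k (l ! k)) \<noteq> {}" by (simp add: FIP_def)
        moreover from l have "U n \<supseteq> (\<Inter>k\<le>n. V k (l ! k))" by (force simp: U_def)
        ultimately show ?thesis by blast
      qed
      have Usub: "U n \<subseteq> V k (\<iota> k x)" if "k < n" for k n using that by (auto simp: U_def)
      have Udec: "U n \<subseteq> U m" if "m \<le> n" for m n using that by (auto simp: U_def)
      obtain z where z: "z \<in> space M" "\<And>S. decides \<U> S \<Longrightarrow> z \<in> S \<Longrightarrow> \<exists>n. U n \<subseteq> S"
        "\<And>S. decides \<U> S \<Longrightarrow> z \<notin> S \<Longrightarrow> \<exists>n. U n \<inter> S = {}"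
      proof (rule complete_covers_branch[OF u, of "\<lambda>k. V k (\<iota> k x)" U])
        show "V n (\<iota> n x) \<in> from_nat_into \<U> n" for n using rV[of n] by (auto simp: e_def)
        show "U (Suc n) \<subseteq> U n \<inter> V n (\<iota> n x)" for n using Usub[of n "Suc n"] Udec[of n "Suc n"] by auto
      qed (use Une in auto)
      have meet: "U n \<inter> V k (\<iota> k x) \<noteq> {}" for n k
        using Une[of "max n (Suc k)"] Udec[of n "max n (Suc k)"] Usub[of k "max n (Suc k)"] by fastforce
      have "z \<in> Q"
      proof (rule ccontr)
        assume "z \<notin> Q"
        then obtain n where "U n \<inter> Q = {}" using z(3) dec(1) by blast
        moreover have "V q (\<iota> q x) \<subseteq> Q" using x unfolding K_def by simp
        ultimately show False using meet[of n q] by blast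
      qed
      moreover have "\<pi> z = x"
      proof (rule ccontr)
        assume "\<pi> z \<noteq> x"
        then obtain S where S: "S \<in> \<S>" "\<pi> z \<in> S" "x \<notin> S"
          using \<S>(3)[of "\<pi> z" x] measurable_space[OF \<pi> z(1)] xN by blast
        obtain n where "U n \<subseteq> P S" using z(2)[OF dec(2)[OF S(1)]] S z(1) by (auto simp: P_def)
        then have "V (r S) (\<iota> (r S) x) \<subseteq> P S" using meet[of n "r S"] r[OF S(1), of "\<iota> (r S) x"] by blast
        then show False using xS[OF S(1)] S by blast
      qed
      ultimately show "x \<in> \<pi> ` Q" by blast
    qed
  qed
  ultimately show ?thesis by simp
qed

section \<open>Borel sets with countable sections\<close>

text \<open>Separation of the images \<open>\<pi> ` U i\<close> by Borel sets with empty intersection, up to discarding a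
  set in \<open>\<I>\<close> from each \<open>U i\<close>.\<close>

definition separable_mod ::
  "'b measure \<Rightarrow> ('a \<Rightarrow> 'b) \<Rightarrow> 'a set set \<Rightarrow> 'i set \<Rightarrow> ('i \<Rightarrow> 'a set) \<Rightarrow> bool" where
  "separable_mod N \<pi> \<I> I U \<longleftrightarrow>
     (\<exists>B. (\<forall>i\<in>I. B i \<in> sets N \<and> U i - \<pi> -` B i \<in> \<I>) \<and> (\<Inter>i\<in>I. B i) = {})"

text \<open>The sigma-ideal generated by Borel sets that meet each fibre at most once. Its members
  need not be Borel, so remainders in a separation can be tested for membership without a
  measurability check.\<close>

definition injective_ideal :: "'a measure \<Rightarrow> ('a \<Rightarrow> 'b) \<Rightarrow> 'a set set" where
  "injective_ideal M \<pi> = {A. \<exists>\<C>. countable \<C> \<and> \<C> \<subseteq> sets M \<and> (\<forall>C\<in>\<C>. inj_on \<pi> C) \<and> A \<subseteq> \<Union>\<C>}"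

section \<open>Separability modulo the ideal under refining and splitting\<close>

lemma injective_ideal_subset:
  assumes "A \<in> injective_ideal M \<pi>" "B \<subseteq> A"
  shows "B \<in> injective_ideal M \<pi>"
proof -
  obtain \<C> where "countable \<C>" "\<C> \<subseteq> sets M" "\<forall>C\<in>\<C>. inj_on \<pi> C" "A \<subseteq> \<Union>\<C>"
    using assms(1) unfolding injective_ideal_def by (elim CollectE exE conjE)
  then show ?thesis
    unfolding injective_ideal_def using assms(2) by (intro CollectI exI[of _ \<C>] conjI) (assumption+, blast)
qed

lemma injective_ideal_empty: "{} \<in> injective_ideal M \<pi>"
  unfolding injective_ideal_def by (intro CollectI exI[of _ "{}"]) simp

lemma injective_ideal_UN:
  assumes "countable K" "\<And>k. k \<in> K \<Longrightarrow> A k \<in> injective_ideal M \<pi>"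
  shows "(\<Union>k\<in>K. A k) \<in> injective_ideal M \<pi>"
proof -
  have "\<forall>k\<in>K. \<exists>\<C>. countable \<C> \<and> \<C> \<subseteq> sets M \<and> (\<forall>C\<in>\<C>. inj_on \<pi> C) \<and> A k \<subseteq> \<Union>\<C>"
    using assms(2) unfolding injective_ideal_def by blast
  from bchoice[OF this] obtain c where
    c: "\<forall>k\<in>K. countable (c k) \<and> c k \<subseteq> sets M \<and> (\<forall>C\<in>c k. inj_on \<pi> C) \<and> A k \<subseteq> \<Union>(c k)" ..
  have "countable (\<Union>k\<in>K. c k)" using assms(1) c by auto
  moreover have "(\<Union>k\<in>K. c k) \<subseteq> sets M" "\<forall>C\<in>(\<Union>k\<in>K. c k). inj_on \<pi> C"
    using c by (simp_all add: UN_subset_iff)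
  moreover have "(\<Union>k\<in>K. A k) \<subseteq> \<Union>(\<Union>k\<in>K. c k)"
  proof
    fix x assume "x \<in> (\<Union>k\<in>K. A k)"
    then obtain k where k: "k \<in> K" "x \<in> A k" by blast
    then have "x \<in> \<Union>(c k)" using bspec[OF c k(1)] by blast
    then show "x \<in> \<Union>(\<Union>k\<in>K. c k)" using k by blast
  qed
  ultimately show ?thesis unfolding injective_ideal_def by (intro CollectI exI[of _ "\<Union>k\<in>K. c k"] conjI)
qed

lemma separable_mod_cong:
  assumes "\<And>i. i \<in> I \<Longrightarrow> U i = V i"
  shows "separable_mod N \<pi> \<I> I U \<longleftrightarrow> separable_mod N \<pi> \<I> I V"
proof -
  have "(\<forall>i\<in>I. B i \<in> sets N \<and> U i - \<pi> -` B i \<in> \<I>) \<longleftrightarrow> (\<forall>i\<in>I. B i \<in> sets N \<and> V i - \<pi> -` B i \<in> \<I>)" for B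
    by (rule ball_cong[OF refl]) (simp only: assms)
  then show ?thesis unfolding separable_mod_def by (simp only:)
qed

text \<open>Separators for the pieces are combined by union at the coordinate \<open>i\<close> and
  by intersection at all others. A point common to the combined separators would lie in the
  \<open>i\<close>-th separator of some piece \<open>k\<close>, hence in all separators of that same
  \<open>k\<close>.\<close>

lemma separable_mod_refine:
  assumes K: "countable K" "K \<noteq> {}" and i: "i \<in> I" and U: "U i \<subseteq> (\<Union>k\<in>K. V k)"
    and sep: "\<And>k. k \<in> K \<Longrightarrow> separable_mod N \<pi> (injective_ideal M \<pi>) I (U(i := U i \<inter> V k))"
  shows "separable_mod N \<pi> (injective_ideal M \<pi>) I U"
proof -
  have "\<forall>k\<in>K. \<exists>B. (\<forall>l\<in>I. B l \<in> sets N \<and> (U(i := U i \<inter> V k)) l - \<pi> -` B l \<in> injective_ideal M \<pi>) \<and> (\<Inter>l\<in>I. B l) = {}"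
    using sep unfolding separable_mod_def by simp
  from bchoice[OF this] obtain B where B:
    "\<And>k l. k \<in> K \<Longrightarrow> l \<in> I \<Longrightarrow> B k l \<in> sets N"
    "\<And>k l. k \<in> K \<Longrightarrow> l \<in> I \<Longrightarrow> (U(i := U i \<inter> V k)) l - \<pi> -` B k l \<in> injective_ideal M \<pi>"
    "\<And>k. k \<in> K \<Longrightarrow> (\<Inter>l\<in>I. B k l) = {}"
    by blast
  define B' where "B' l = (if l = i then \<Union>k\<in>K. B k l else \<Inter>k\<in>K. B k l)" for l
  have "B' l \<in> sets N" if "l \<in> I" for l
  proof (cases "l = i")
    case True
    have "(\<Union>k\<in>K. B k l) \<in> sets N" using K B(1) that by (intro sets.countable_UN') auto
    then show ?thesis using True by (simp add: B'_def)
  next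
    case False
    have "(\<Inter>k\<in>K. B k l) \<in> sets N" using K B(1) that by (intro sets.countable_INT') auto
    then show ?thesis using False by (simp add: B'_def)
  qed
  moreover have "U l - \<pi> -` B' l \<in> injective_ideal M \<pi>" if l: "l \<in> I" for l
  proof -
    have "(\<Union>k\<in>K. (U(i := U i \<inter> V k)) l - \<pi> -` B k l) \<in> injective_ideal M \<pi>"
      using K B(2) l by (intro injective_ideal_UN) auto
    moreover have "U l - \<pi> -` B' l \<subseteq> (\<Union>k\<in>K. (U(i := U i \<inter> V k)) l - \<pi> -` B k l)"
    proof
      fix x assume x: "x \<in> U l - \<pi> -` B' l"
      show "x \<in> (\<Union>k\<in>K. (U(i := U i \<inter> V k)) l - \<pi> -` B k l)"
      proof (cases "l = i")
        case True
        then obtain k where "k \<in> K" "x \<in> V k" using x U by blast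
        then show ?thesis using x True by (auto simp: B'_def)
      next
        case False
        then show ?thesis using x by (auto simp: B'_def)
      qed
    qed
    ultimately show ?thesis by (rule injective_ideal_subset)
  qed
  moreover have "(\<Inter>l\<in>I. B' l) = {}"
  proof (rule ccontr)
    assume "(\<Inter>l\<in>I. B' l) \<noteq> {}"
    then obtain x where x: "\<And>l. l \<in> I \<Longrightarrow> x \<in> B' l" by blast
    then obtain k where k: "k \<in> K" "x \<in> B k i" using i by (force simp: B'_def)
    have "x \<in> B k l" if "l \<in> I" for l
      using x[OF that] k by (cases "l = i") (auto simp: B'_def)
    then show False using B(3)[OF k(1)] by blast
  qed
  ultimately show ?thesis unfolding separable_mod_def by blast
qed

text \<open>If every splitting of one coordinate is separable, then the points of \<open>U i\<close> lying over the
  intersection of the remaining separators form a set on which \<open>\<pi>\<close> is injective modulo the ideal,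
  so they may be discarded.\<close>

lemma separable_mod_split:
  assumes \<T>: "countable \<T>" "\<T> \<noteq> {}" "\<T> \<subseteq> sets M"
    "\<And>x y. x \<in> space M \<Longrightarrow> y \<in> space M \<Longrightarrow> x \<noteq> y \<Longrightarrow> \<exists>T\<in>\<T>. x \<in> T \<and> y \<notin> T"
    and \<pi>: "\<pi> \<in> M \<rightarrow>\<^sub>M N" and U: "U i \<in> sets M" and I: "finite I" "i \<in> I"
    and ab: "a \<notin> I - {i}" "b \<notin> I - {i}" "a \<noteq> b"
    and sep: "\<And>T. T \<in> \<T> \<Longrightarrow> separable_mod N \<pi> (injective_ideal M \<pi>) (insert a (insert b (I - {i})))
        (U(a := U i \<inter> T, b := U i - T))"
  shows "separable_mod N \<pi> (injective_ideal M \<pi>) I U"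
proof -
  let ?I = "injective_ideal M \<pi>"
  define J where "J = I - {i}"
  have J: "finite J" "a \<notin> J" "b \<notin> J" "i \<notin> J" "I = insert i J" using I ab by (auto simp: J_def)
  have "\<forall>T\<in>\<T>. \<exists>B. (\<forall>l\<in>insert a (insert b J). B l \<in> sets N \<and>
      (U(a := U i \<inter> T, b := U i - T)) l - \<pi> -` B l \<in> ?I) \<and> (\<Inter>l\<in>insert a (insert b J). B l) = {}"
    using sep unfolding separable_mod_def J_def by simp
  from bchoice[OF this] obtain B where B: "\<forall>T\<in>\<T>. (\<forall>l\<in>insert a (insert b J). B T l \<in> sets N \<and>
      (U(a := U i \<inter> T, b := U i - T)) l - \<pi> -` B T l \<in> ?I) \<and> (\<Inter>l\<in>insert a (insert b J). B T l) = {}"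
    by blast
  have B1: "B T l \<in> sets N" if "T \<in> \<T>" "l \<in> J" for T l using B that by simp
  have B2: "U l - \<pi> -` B T l \<in> ?I" if "T \<in> \<T>" "l \<in> J" for T l
  proof -
    have "(U(a := U i \<inter> T, b := U i - T)) l - \<pi> -` B T l \<in> ?I" using B that by simp
    then show ?thesis using that J by (auto split: if_splits)
  qed
  have Ba: "(U i \<inter> T) - \<pi> -` B T a \<in> ?I" and Bb: "(U i - T) - \<pi> -` B T b \<in> ?I"
    and Be: "(\<Inter>l\<in>insert a (insert b J). B T l) = {}" if "T \<in> \<T>" for T
    using B that \<open>a \<noteq> b\<close> by auto
  define C where "C l = (\<Inter>T\<in>\<T>. B T l)" for l
  have C: "C l \<in> sets N" "U l - \<pi> -` C l \<in> ?I" if "l \<in> J" for l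
  proof -
    show "C l \<in> sets N" unfolding C_def using \<T> B1 that by (intro sets.countable_INT') auto
    have "(\<Union>T\<in>\<T>. U l - \<pi> -` B T l) \<in> ?I" using \<T>(1) B2 that by (intro injective_ideal_UN) auto
    moreover have "U l - \<pi> -` C l \<subseteq> (\<Union>T\<in>\<T>. U l - \<pi> -` B T l)" by (auto simp: C_def)
    ultimately show "U l - \<pi> -` C l \<in> ?I" by (rule injective_ideal_subset)
  qed
  define D where "D = {y \<in> space N. \<forall>l\<in>J. y \<in> C l}"
  have D: "D \<in> sets N"
    unfolding D_def
  proof (rule sets_Collect_Ball_countable)
    show "countable J" using J(1) by (rule countable_finite)
    fix l assume "l \<in> J"
    then have "space N \<inter> C l \<in> sets N" using C(1) by auto
    then show "{y \<in> space N. y \<in> C l} \<in> sets N" by (simp add: Int_def)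
  qed
  have "(\<Union>T\<in>\<T>. ((U i \<inter> T) - \<pi> -` B T a)) \<in> ?I" "(\<Union>T\<in>\<T>. ((U i - T) - \<pi> -` B T b)) \<in> ?I"
    using \<T>(1) Ba Bb by (auto intro!: injective_ideal_UN)
  then obtain \<C> \<C>' where
    C1: "countable \<C>" "\<C> \<subseteq> sets M" "\<forall>C\<in>\<C>. inj_on \<pi> C" "(\<Union>T\<in>\<T>. ((U i \<inter> T) - \<pi> -` B T a)) \<subseteq> \<Union>\<C>" and
    C2: "countable \<C>'" "\<C>' \<subseteq> sets M" "\<forall>C\<in>\<C>'. inj_on \<pi> C" "(\<Union>T\<in>\<T>. ((U i - T) - \<pi> -` B T b)) \<subseteq> \<Union>\<C>'"
    unfolding injective_ideal_def by (elim CollectE exE conjE)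
  define R where "R = U i \<inter> (\<pi> -` D \<inter> space M) - \<Union>(\<C> \<union> \<C>')"
  have Rm: "R \<in> sets M"
    unfolding R_def using C1(1,2) C2(1,2)
    by (intro sets.Diff[OF sets.Int[OF U measurable_sets[OF \<pi> D]]] sets.countable_Union) simp_all
  \<comment> \<open>A set \<open>T\<close> splitting \<open>z\<close> from \<open>w\<close> puts one
    point into \<open>U i \<inter> T\<close> and the other into \<open>U i - T\<close>; as neither
    is in the exceptional sets, their common image would lie in every separator belonging to
    \<open>T\<close>.\<close>
  have "z = w" if zw: "z \<in> R" "w \<in> R" "\<pi> z = \<pi> w" for z w
  proof (rule ccontr)
    assume "z \<noteq> w"
    have zM: "z \<in> space M" "w \<in> space M" using zw unfolding R_def by blast+
    then obtain T where T: "T \<in> \<T>" "z \<in> T" "w \<notin> T" using \<T>(4) \<open>z \<noteq> w\<close> by metis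
    have zi: "z \<in> U i" "w \<in> U i" using zw unfolding R_def by blast+
    have "\<pi> z \<in> B T a"
    proof (rule ccontr)
      assume "\<pi> z \<notin> B T a"
      then have "z \<in> \<Union>\<C>" using C1(4) T zi by blast
      then show False using zw unfolding R_def by blast
    qed
    moreover have "\<pi> w \<in> B T b"
    proof (rule ccontr)
      assume "\<pi> w \<notin> B T b"
      then have "w \<in> \<Union>\<C>'" using C2(4) T zi by blast
      then show False using zw unfolding R_def by blast
    qed
    moreover have "\<pi> z \<in> B T l" if "l \<in> J" for l
    proof -
      have "\<pi> z \<in> D" using zw unfolding R_def by blast
      then show ?thesis using that T unfolding D_def C_def by blast
    qed
    ultimately have "\<pi> z \<in> (\<Inter>l\<in>insert a (insert b J). B T l)" using zw(3) by simp
    then show False unfolding Be[OF T(1)] by (rule emptyE)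
  qed
  then have Rinj: "inj_on \<pi> R" by (rule inj_onI)
  have Di: "U i - \<pi> -` (space N - D) \<in> ?I"
  proof -
    have "U i - \<pi> -` (space N - D) \<subseteq> \<Union>(insert R (\<C> \<union> \<C>'))"
      using sets.sets_into_space[OF U] measurable_space[OF \<pi>] unfolding R_def by auto
    moreover have "countable (insert R (\<C> \<union> \<C>'))" using C1 C2 by simp
    moreover have "insert R (\<C> \<union> \<C>') \<subseteq> sets M" using C1 C2 Rm by simp
    moreover have "\<forall>C\<in>insert R (\<C> \<union> \<C>'). inj_on \<pi> C" using C1(3) C2(3) Rinj by blast
    ultimately show ?thesis unfolding injective_ideal_def by blast
  qed
  \<comment> \<open>The part of \<open>U i\<close> over \<open>D\<close> has just been shown to lie
    in the ideal, so the complement of \<open>D\<close> can serve at \<open>i\<close>; it is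
    disjoint from the intersection of the other separators.\<close>
  define B' where "B' l = (if l = i then space N - D else C l)" for l
  have "B' l \<in> sets N \<and> U l - \<pi> -` B' l \<in> ?I" if "l \<in> I" for l
    using that C D Di J by (auto simp: B'_def)
  moreover have "(\<Inter>l\<in>I. B' l) = {}"
  proof (rule ccontr)
    assume "(\<Inter>l\<in>I. B' l) \<noteq> {}"
    then obtain x where x: "\<And>l. l \<in> I \<Longrightarrow> x \<in> B' l" by blast
    have "x \<in> space N - D" using x[OF I(2)] by (simp add: B'_def)
    moreover have "x \<in> C l" if "l \<in> J" for l
    proof -
      have "l \<in> I" "l \<noteq> i" using that J by auto
      then show ?thesis using x[of l] by (simp add: B'_def)
    qed
    ultimately show False unfolding D_def by blast
  qed
  ultimately show ?thesis unfolding separable_mod_def by blast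
qed

text \<open>The contrapositive of \<open>separable_mod_refine\<close>, applied to one coordinate
  after another: each coordinate is shrunk into a single member of the cover while inseparability
  survives.\<close>

lemma not_separable_mod_refine_all:
  assumes "finite J" "J \<subseteq> I" and C: "countable C" "C \<noteq> {}" "\<And>i. i \<in> I \<Longrightarrow> U i \<subseteq> \<Union>C"
    and "\<not> separable_mod N \<pi> (injective_ideal M \<pi>) I U"
  shows "\<exists>V. (\<forall>i\<in>J. V i \<in> C) \<and>
    \<not> separable_mod N \<pi> (injective_ideal M \<pi>) I (\<lambda>i. if i \<in> J then U i \<inter> V i else U i)"
  using assms(1,2)
proof (induction J)
  case empty
  then show ?case using assms(6) by simp
next
  case (insert j J)
  then obtain V where V: "\<forall>i\<in>J. V i \<in> C"
    "\<not> separable_mod N \<pi> (injective_ideal M \<pi>) I (\<lambda>i. if i \<in> J then U i \<inter> V i else U i)" by blast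
  let ?U = "\<lambda>i. if i \<in> J then U i \<inter> V i else U i"
  have jI: "j \<in> I" using insert by blast
  have "\<exists>W\<in>C. \<not> separable_mod N \<pi> (injective_ideal M \<pi>) I (?U(j := ?U j \<inter> W))"
  proof (rule ccontr)
    assume "\<not> ?thesis"
    then have a: "separable_mod N \<pi> (injective_ideal M \<pi>) I (?U(j := ?U j \<inter> W))" if "W \<in> C" for W
      using that by blast
    have "?U j \<subseteq> (\<Union>W\<in>C. W)" using C(3)[OF jI] by auto
    from separable_mod_refine[OF C(1,2) jI this a]
    have "separable_mod N \<pi> (injective_ideal M \<pi>) I ?U" .
    then show False using V(2) by simp
  qed
  then obtain W where W: "W \<in> C" "\<not> separable_mod N \<pi> (injective_ideal M \<pi>) I (?U(j := ?U j \<inter> W))" by blast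
  have "?U(j := ?U j \<inter> W) = (\<lambda>i. if i \<in> insert j J then U i \<inter> (V(j := W)) i else U i)"
    using insert(2) by (auto simp: fun_eq_iff)
  then show ?case using W V(1) insert(2) by (intro exI[of _ "V(j := W)"]) auto
qed

text \<open>The contrapositive of \<open>separable_mod_split\<close>, applied to one node after
  another. The new bit is put in front, so \<open>tl\<close> recovers the parent of a node.\<close>

lemma not_separable_mod_split_all:
  fixes U :: "bool list \<Rightarrow> 'a set"
  assumes \<T>: "countable \<T>" "\<T> \<noteq> {}" "\<T> \<subseteq> sets M"
    "\<And>x y. x \<in> space M \<Longrightarrow> y \<in> space M \<Longrightarrow> x \<noteq> y \<Longrightarrow> \<exists>T\<in>\<T>. x \<in> T \<and> y \<notin> T"
    and \<pi>: "\<pi> \<in> M \<rightarrow>\<^sub>M N" and U: "\<And>s. length s = n \<Longrightarrow> U s \<in> sets M"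
    and ns: "\<not> separable_mod N \<pi> (injective_ideal M \<pi>) {s. length s = n} U"
  shows "\<exists>T. (\<forall>s. length s = n \<longrightarrow> T s \<in> \<T>) \<and>
    \<not> separable_mod N \<pi> (injective_ideal M \<pi>) {s. length s = Suc n}
      (\<lambda>s. if hd s then U (tl s) \<inter> T (tl s) else U (tl s) - T (tl s))"
proof -
  let ?sep = "separable_mod N \<pi> (injective_ideal M \<pi>)"
  define F where "F T s = (if length s = n then U s
      else if hd s then U (tl s) \<inter> T (tl s) else U (tl s) - T (tl s))" for T s
  \<comment> \<open>The index set midway through the induction: nodes of length \<open>n\<close> not
    yet split, together with both children of those already split. \<open>F\<close> tells the two
    kinds apart by their length.\<close>
  define L :: "bool list set \<Rightarrow> bool list set" where "L J = {s. length s = n} - J \<union> (Cons True ` J \<union> Cons False ` J)" for J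
  have fin: "finite {s :: bool list. length s = k}" for k
    using finite_lists_length_eq[of "UNIV :: bool set" k] by simp
  have "\<exists>T. (\<forall>s\<in>J. T s \<in> \<T>) \<and> \<not> ?sep (L J) (F T)" if "finite J" "J \<subseteq> {s. length s = n}" for J
    using that
  proof (induction J)
    case empty
    have "?sep (L {}) (F T) \<longleftrightarrow> ?sep {s. length s = n} U" for T
    proof -
      have "L {} = {s. length s = n}" by (auto simp: L_def)
      moreover have "?sep {s. length s = n} (F T) \<longleftrightarrow> ?sep {s. length s = n} U"
        by (rule separable_mod_cong) (simp add: F_def)
      ultimately show ?thesis by (simp only:)
    qed
    then show ?case using ns by simp
  next
    case (insert s J)
    then obtain T where T: "\<forall>s\<in>J. T s \<in> \<T>" "\<not> ?sep (L J) (F T)" by blast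
    have s: "length s = n" "s \<notin> J" using insert by auto
    have J: "\<And>s. s \<in> J \<Longrightarrow> length s = n" using insert by blast
    let ?a = "True # s" and ?b = "False # s"
    let ?U = "\<lambda>T0. (F T)(?a := F T s \<inter> T0, ?b := F T s - T0)"
    have ex: "\<exists>T0\<in>\<T>. \<not> ?sep (insert ?a (insert ?b (L J - {s}))) (?U T0)"
    proof (rule ccontr)
      assume c: "\<not> ?thesis"
      have "?sep (L J) (F T)"
      proof (rule separable_mod_split[OF \<T> \<pi>])
        show "F T s \<in> sets M" using s U by (simp add: F_def)
        have "L J \<subseteq> {s. length s = n} \<union> {s. length s = Suc n}" using J by (auto simp: L_def)
        then show "finite (L J)" using fin[of n] fin[of "Suc n"] by (meson finite_UnI finite_subset)
        show "s \<in> L J" using s by (simp add: L_def)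
        show "?a \<notin> L J - {s}" "?b \<notin> L J - {s}" using s by (auto simp: L_def)
        show "?a \<noteq> ?b" by simp
        show "?sep (insert ?a (insert ?b (L J - {s}))) (?U T0)" if "T0 \<in> \<T>" for T0 using c that by blast
      qed
      then show False using T(2) by simp
    qed
    then obtain T0 where T0: "T0 \<in> \<T>" "\<not> ?sep (insert ?a (insert ?b (L J - {s}))) (?U T0)" by blast
    have Ls: "insert ?a (insert ?b (L J - {s})) = L (insert s J)"
    proof -
      have "s \<notin> Cons True ` J \<union> Cons False ` J"
      proof
        assume "s \<in> Cons True ` J \<union> Cons False ` J"
        then obtain b t where "s = b # t" "t \<in> J" by blast
        then show False using J[of t] s(1) by simp
      qed
      then show ?thesis unfolding L_def by blast
    qed
    have "?sep (L (insert s J)) (?U T0) \<longleftrightarrow> ?sep (L (insert s J)) (F (T(s := T0)))"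
    proof (rule separable_mod_cong)
      fix t assume t: "t \<in> L (insert s J)"
      show "?U T0 t = F (T(s := T0)) t"
      proof (cases "length t = n")
        case True
        have "t \<noteq> s"
        proof
          assume "t = s"
          then have "s \<in> Cons True ` insert s J \<union> Cons False ` insert s J" using t unfolding L_def by blast
          then obtain b u where u: "s = b # u" "u \<in> insert s J" by blast
          then have "length u = n" using J[of u] s(1) by (cases "u = s") simp_all
          then show False using u s(1) by simp
        qed
        then show ?thesis using True s by (auto simp: F_def)
      next
        case False
        then have "t \<in> Cons True ` insert s J \<union> Cons False ` insert s J" using t unfolding L_def by blast
        then obtain b u where u: "t = b # u" "u \<in> insert s J" by blast
        then have "length u = n" using J[of u] s(1) by (cases "u = s") simp_all
        then show ?thesis using u s by (cases b) (auto simp: F_def)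
      qed
    qed
    then have "\<not> ?sep (L (insert s J)) (F (T(s := T0)))" using T0(2) unfolding Ls by (simp only: not_False_eq_True)
    moreover have "\<forall>t\<in>insert s J. (T(s := T0)) t \<in> \<T>" using T0(1) T(1) by simp
    ultimately show ?case by blast
  qed
  from this[OF fin[of n] order_refl] obtain T where
    T: "\<forall>s\<in>{s. length s = n}. T s \<in> \<T>" "\<not> ?sep (L {s. length s = n}) (F T)" by blast
  have "L {s. length s = n} = {s. length s = Suc n}"
    unfolding L_def
  proof (intro equalityI subsetI)
    fix t :: "bool list" assume "t \<in> {s. length s = Suc n}"
    then obtain b s where "t = b # s" "length s = n" by (auto simp: length_Suc_conv)
    then show "t \<in> {s. length s = n} - {s. length s = n} \<union>
        (Cons True ` {s. length s = n} \<union> Cons False ` {s. length s = n})" by (cases b) auto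
  qed auto
  moreover have "?sep {s. length s = Suc n} (F T) \<longleftrightarrow>
      ?sep {s. length s = Suc n} (\<lambda>s. if hd s then U (tl s) \<inter> T (tl s) else U (tl s) - T (tl s))"
    by (rule separable_mod_cong) (simp add: F_def)
  ultimately show ?thesis using T by (intro exI[of _ T]) simp
qed

text \<open>Otherwise the one-element family \<open>E\<close> is not separable modulo the ideal, and splitting and
  refining produce a Cantor scheme all of whose branches lie over the same point.\<close>

theorem lusin_novikov:
  fixes \<pi> :: "'a \<Rightarrow> 'b"
  assumes M: "standard_borel M" and \<S>: "countable \<S>" "\<S> \<subseteq> sets N"
    "\<And>x y. x \<in> space N \<Longrightarrow> y \<in> space N \<Longrightarrow> x \<noteq> y \<Longrightarrow> \<exists>S\<in>\<S>. x \<in> S \<and> y \<notin> S"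
    and \<pi>: "\<pi> \<in> M \<rightarrow>\<^sub>M N" and E: "E \<in> sets M" and cs: "\<And>y. countable {z \<in> E. \<pi> z = y}"
  shows "E \<in> injective_ideal M \<pi>"
proof (rule ccontr)
  let ?sep = "separable_mod N \<pi> (injective_ideal M \<pi>)"
  assume nE: "E \<notin> injective_ideal M \<pi>"
  define P where "P S = \<pi> -` S \<inter> space M" for S
  obtain \<T>0 where T0: "countable \<T>0" "\<T>0 \<subseteq> sets M"
    "\<And>x y. x \<in> space M \<Longrightarrow> y \<in> space M \<Longrightarrow> x \<noteq> y \<Longrightarrow> \<exists>S\<in>\<T>0. x \<in> S \<and> y \<notin> S"
    using standard_borel_separating[OF M] by metis
  \<comment> \<open>Inserting \<open>{}\<close> ensures nonemptiness even when the space has at most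
    one point.\<close>
  define \<T> where "\<T> = insert {} \<T>0"
  have \<T>: "countable \<T>" "\<T> \<noteq> {}" "\<T> \<subseteq> sets M"
    "\<And>x y. x \<in> space M \<Longrightarrow> y \<in> space M \<Longrightarrow> x \<noteq> y \<Longrightarrow> \<exists>T\<in>\<T>. x \<in> T \<and> y \<notin> T"
  proof -
    show "\<exists>T\<in>\<T>. x \<in> T \<and> y \<notin> T" if "x \<in> space M" "y \<in> space M" "x \<noteq> y" for x y
      using T0(3)[OF that] unfolding \<T>_def by blast
  qed (use T0 in \<open>auto simp: \<T>_def\<close>)
  have "countable (insert E (\<T> \<union> P ` \<S>))" using \<S> \<T> by simp
  moreover have "insert E (\<T> \<union> P ` \<S>) \<subseteq> sets M"
    using \<S>(2) E \<T>(3) measurable_sets[OF \<pi>] unfolding P_def by blast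
  ultimately obtain \<U> where u: "complete_covers M \<U>"
    and dec: "\<And>S. S \<in> insert E (\<T> \<union> P ` \<S>) \<Longrightarrow> decides \<U> S"
    using standard_borel_deciding_covers[OF M] by metis
  define e where "e = from_nat_into \<U>"
  have e: "e n \<in> \<U>" for n using from_nat_into[OF complete_covers_basic(2)[OF u]] by (simp add: e_def)
  have ec: "countable (e n)" "\<Union>(e n) = space M" "e n \<subseteq> sets M" for n
    using complete_covers_basic(3-5)[OF u e] by auto
  have "E \<noteq> {}" using nE injective_ideal_empty by metis
  then have "space M \<noteq> {}" using sets.sets_into_space[OF E] by blast
  then have ene: "e n \<noteq> {}" for n using ec(2)[of n] by auto
  have "\<exists>f. \<forall>n. ((\<not> ?sep {s. length s = n} (f n)) \<and> (\<forall>s. length s = n \<longrightarrow> f n s \<in> sets M \<and> f n s \<subseteq> E)) \<and>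
     (\<forall>s. length s = n \<longrightarrow> (\<exists>T\<in>\<T>. \<forall>b. \<exists>V\<in>e n. f (Suc n) (b # s) = (if b then f n s \<inter> T else f n s - T) \<inter> V))"
  proof (rule dependent_nat_choice)
    \<comment> \<open>With a single coordinate the only separator has to be empty, so separability
      would put all of \<open>E\<close> into the ideal.\<close>
    have "\<not> ?sep {s. length s = 0} (\<lambda>_. E)"
    proof
      assume "?sep {s. length s = 0} (\<lambda>_. E)"
      then obtain B where "E - \<pi> -` B [] \<in> injective_ideal M \<pi>" "B [] = {}"
        unfolding separable_mod_def by auto
      then show False using nE by simp
    qed
    then show "\<exists>f. \<not> ?sep {s. length s = 0} f \<and> (\<forall>s. length s = 0 \<longrightarrow> f s \<in> sets M \<and> f s \<subseteq> E)"
      using E by (intro exI[of _ "\<lambda>_. E"]) auto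
  next
    fix U :: "bool list \<Rightarrow> 'a set" and n
    assume U: "\<not> ?sep {s. length s = n} U \<and> (\<forall>s. length s = n \<longrightarrow> U s \<in> sets M \<and> U s \<subseteq> E)"
    have Um: "U s \<in> sets M" "U s \<subseteq> E" if "length s = n" for s using U that by blast+
    have "\<exists>T. (\<forall>s. length s = n \<longrightarrow> T s \<in> \<T>) \<and> \<not> ?sep {s. length s = Suc n}
      (\<lambda>s. if hd s then U (tl s) \<inter> T (tl s) else U (tl s) - T (tl s))"
      by (rule not_separable_mod_split_all[OF \<T> \<pi> Um(1) conjunct1[OF U]])
    then obtain T where T0: "\<forall>s. length s = n \<longrightarrow> T s \<in> \<T>" and nsep: "\<not> ?sep {s. length s = Suc n}
      (\<lambda>s. if hd s then U (tl s) \<inter> T (tl s) else U (tl s) - T (tl s))"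
      by (elim exE conjE)
    then have T: "T s \<in> \<T>" if "length s = n" for s using that by simp
    let ?U = "\<lambda>s. if hd s then U (tl s) \<inter> T (tl s) else U (tl s) - T (tl s)"
    have Tm: "T s \<in> sets M" if "length s = n" for s using T[OF that] \<T>(3) by blast
    have U'm: "?U s \<in> sets M" "?U s \<subseteq> E" if "length s = Suc n" for s
    proof -
      have "length (tl s) = n" using that by simp
      from Um[OF this] Tm[OF this] show "?U s \<in> sets M" "?U s \<subseteq> E" by auto
    qed
    have "finite {s :: bool list. length s = Suc n}"
      using finite_lists_length_eq[of "UNIV :: bool set" "Suc n"] by simp
    moreover have "?U s \<subseteq> \<Union>(e n)" if "s \<in> {s. length s = Suc n}" for s
      using U'm(1)[of s] that sets.sets_into_space ec(2)[of n] by (metis mem_Collect_eq)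
    ultimately have "\<exists>V. (\<forall>s\<in>{s. length s = Suc n}. V s \<in> e n) \<and>
      \<not> ?sep {s. length s = Suc n} (\<lambda>s. if s \<in> {s. length s = Suc n} then ?U s \<inter> V s else ?U s)"
      by (rule not_separable_mod_refine_all[OF _ order_refl ec(1) ene _ nsep])
    then obtain V where V: "\<forall>s\<in>{s. length s = Suc n}. V s \<in> e n"
      "\<not> ?sep {s. length s = Suc n} (\<lambda>s. if s \<in> {s. length s = Suc n} then ?U s \<inter> V s else ?U s)"
      by (elim exE conjE)
    let ?f = "\<lambda>s. if s \<in> {s. length s = Suc n} then ?U s \<inter> V s else ?U s"
    have fs: "?f s \<in> sets M \<and> ?f s \<subseteq> E" if s: "length s = Suc n" for s
    proof -
      have "V s \<in> sets M" using V(1) s ec(3)[of n] by blast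
      then have "?U s \<inter> V s \<in> sets M" using U'm(1)[OF s] by (rule sets.Int[rotated])
      moreover have "?U s \<inter> V s \<subseteq> E" using U'm(2)[OF s] by blast
      moreover have "?f s = ?U s \<inter> V s" using s by simp
      ultimately show ?thesis by (simp only:)
    qed
    have fb: "\<exists>T\<in>\<T>. \<forall>b. \<exists>W\<in>e n. ?f (b # s) = (if b then U s \<inter> T else U s - T) \<inter> W" if s: "length s = n" for s
    proof (rule bexI[of _ "T s"], rule allI)
      fix b
      have "V (b # s) \<in> e n" using V(1) s by simp
      then show "\<exists>W\<in>e n. ?f (b # s) = (if b then U s \<inter> T s else U s - T s) \<inter> W"
        by (intro bexI[of _ "V (b # s)"]) (simp_all add: s)
    qed (rule T[OF s])
    show "\<exists>f. (\<not> ?sep {s. length s = Suc n} f \<and> (\<forall>s. length s = Suc n \<longrightarrow> f s \<in> sets M \<and> f s \<subseteq> E)) \<and>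
       (\<forall>s. length s = n \<longrightarrow> (\<exists>T\<in>\<T>. \<forall>b. \<exists>V\<in>e n. f (b # s) = (if b then U s \<inter> T else U s - T) \<inter> V))"
      by (rule exI[of _ ?f]) (intro conjI allI impI V(2) fs fb)
  qed
  then obtain f where f0: "\<forall>n. ((\<not> ?sep {s. length s = n} (f n)) \<and> (\<forall>s. length s = n \<longrightarrow> f n s \<in> sets M \<and> f n s \<subseteq> E)) \<and>
     (\<forall>s. length s = n \<longrightarrow> (\<exists>T\<in>\<T>. \<forall>b. \<exists>V\<in>e n. f (Suc n) (b # s) = (if b then f n s \<inter> T else f n s - T) \<inter> V))"
    by (elim exE)
  have f: "\<not> ?sep {s. length s = n} (f n)"
    "length s = n \<Longrightarrow> f n s \<in> sets M \<and> f n s \<subseteq> E"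
    "length s = n \<Longrightarrow> \<exists>T\<in>\<T>. \<forall>b. \<exists>V\<in>e n. f (Suc n) (b # s) = (if b then f n s \<inter> T else f n s - T) \<inter> V" for n s
    using f0[rule_format, of n] by simp_all
  define Q where "Q n s T V \<longleftrightarrow> T \<in> \<T> \<and> (\<forall>b. V b \<in> e n \<and>
      f (Suc n) (b # s) = (if b then f n s \<inter> T else f n s - T) \<inter> V b)" for n s T V
  have "\<exists>T V. Q n s T V" if s: "length s = n" for n s
  proof -
    obtain T where T: "T \<in> \<T>" "\<forall>b. \<exists>V. V \<in> e n \<and> f (Suc n) (b # s) = (if b then f n s \<inter> T else f n s - T) \<inter> V"
      using f(3)[OF s] by (elim bexE) (simp only: Bex_def)
    from choice[OF T(2)] T(1) show ?thesis unfolding Q_def by blast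
  qed
  then have "\<forall>p. \<exists>q. length (snd p) = fst p \<longrightarrow> Q (fst p) (snd p) (fst q) (snd q)" by simp
  from choice[OF this] obtain g where g: "\<forall>p. length (snd p) = fst p \<longrightarrow> Q (fst p) (snd p) (fst (g p)) (snd (g p))" ..
  define T where "T n s = fst (g (n, s))" for n s
  define V where "V n s = snd (g (n, s))" for n s
  have QTV: "Q n s (T n s) (V n s)" if "length s = n" for n s
    using g[rule_format, of "(n, s)"] that by (simp add: T_def V_def)
  have T: "T n s \<in> \<T>" and V: "V n s b \<in> e n" and
    fSuc: "f (Suc n) (b # s) = (if b then f n s \<inter> T n s else f n s - T n s) \<inter> V n s b"
    if "length s = n" for n s b
    using QTV[OF that] unfolding Q_def by blast+
  have fsub: "f n s \<subseteq> space M" if "length s = n" for n s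
    using conjunct1[OF f(2)[OF that]] by (rule sets.sets_into_space)
  \<comment> \<open>Two nodes on different sides of the preimage of \<open>S\<close> already
    separate the whole level, with \<open>S\<close>, its complement and the full space as
    separators. Inseparability of each level thus forces all branches over the same point.\<close>
  have sepI: "?sep {s. length s = n} (f n)"
    if "length s = n" "length t = n" "s \<noteq> t" "S \<in> \<S>" "f n s \<subseteq> P S" "f n t \<inter> P S = {}" for n s t S
    unfolding separable_mod_def
  proof (intro exI[of _ "\<lambda>r. if r = s then S else if r = t then space N - S else space N"] conjI ballI)
    fix r :: "bool list" assume r: "r \<in> {s. length s = n}"
    have S: "S \<in> sets N" using that(4) \<S>(2) by (rule subsetD[rotated])
    then show "(if r = s then S else if r = t then space N - S else space N) \<in> sets N" by auto
    have "f n r - \<pi> -` (if r = s then S else if r = t then space N - S else space N) = {}"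
    proof -
      have N: "\<pi> x \<in> space N" "x \<in> space M" if "x \<in> f n r" for x
      proof -
        show "x \<in> space M" using fsub[of r n] r that by blast
        then show "\<pi> x \<in> space N" by (rule measurable_space[OF \<pi>])
      qed
      show ?thesis
      proof (cases "r = s")
        case True
        then show ?thesis using that(5) unfolding P_def by auto
      next
        case False
        then show ?thesis using N that(6) unfolding P_def by (cases "r = t") auto
      qed
    qed
    then show "f n r - \<pi> -` (if r = s then S else if r = t then space N - S else space N) \<in> injective_ideal M \<pi>"
      using injective_ideal_empty by metis
  next
    show "(\<Inter>r\<in>{s :: bool list. length s = n}. if r = s then S else if r = t then space N - S else space N) = {}"
    proof (rule ccontr)
      assume "\<not> ?thesis"
      then obtain x where x: "\<And>r. length r = n \<Longrightarrow> x \<in> (if r = s then S else if r = t then space N - S else space N)"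
        by blast
      show False using x[of s] x[of t] that(1-3) by simp
    qed
  qed
  have fne: "f n s \<noteq> {}" if s: "length s = n" for n s
  proof
    assume em: "f n s = {}"
    have "?sep {s. length s = n} (f n)"
      unfolding separable_mod_def
    proof (intro exI[of _ "\<lambda>r. if r = s then {} else space N"] conjI ballI)
      fix r :: "bool list" assume r: "r \<in> {s. length s = n}"
      have "f n r - \<pi> -` (if r = s then {} else space N) = {}"
        using fsub[of r n] r measurable_space[OF \<pi>] em by auto
      then show "f n r - \<pi> -` (if r = s then {} else space N) \<in> injective_ideal M \<pi>"
        using injective_ideal_empty by metis
      show "(if r = s then {} else space N) \<in> sets N" by simp
    next
      show "(\<Inter>r\<in>{s :: bool list. length s = n}. if r = s then {} else space N) = {}" using s by (auto split: if_splits)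
    qed
    then show False using f(1) by blast
  qed
  \<comment> \<open>Reversed because the newest bit stands at the front of a node.\<close>
  define node where "node a n = rev (map a [0..<n])" for a :: "nat \<Rightarrow> bool" and n
  have node: "length (node a n) = n" "node a (Suc n) = a n # node a n" for a n
    by (simp_all add: node_def)
  define B where "B a n = f n (node a n)" for a n
  have BSuc: "B a (Suc n) = (if a n then B a n \<inter> T n (node a n) else B a n - T n (node a n)) \<inter> V n (node a n) (a n)" for a n
    unfolding B_def node(2) by (rule fSuc) (simp add: node)
  have Bne: "B a n \<noteq> {}" for a n unfolding B_def by (rule fne) (simp add: node)
  have Bdec: "B a n \<subseteq> B a m" if "m \<le> n" for a m n
    by (rule lift_Suc_antimono_le[of "B a"]) (use that BSuc in auto)
  have "\<exists>z. z \<in> space M \<and> (\<forall>S. decides \<U> S \<longrightarrow> z \<in> S \<longrightarrow> (\<exists>n. B a n \<subseteq> S)) \<and>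
      (\<forall>S. decides \<U> S \<longrightarrow> z \<notin> S \<longrightarrow> (\<exists>n. B a n \<inter> S = {}))" for a
  proof (rule complete_covers_branch[OF u, of "\<lambda>n. V n (node a n) (a n)" "B a"])
    show "V n (node a n) (a n) \<in> from_nat_into \<U> n" for n
      using V[of "node a n" n] node(1) by (simp add: e_def)
    show "B a (Suc n) \<subseteq> B a n \<inter> V n (node a n) (a n)" for n unfolding BSuc by auto
    show "B a n \<noteq> {}" for n by (rule Bne)
  qed blast
  then obtain z where zM: "\<And>a. z a \<in> space M"
    and zin: "\<And>a S. decides \<U> S \<Longrightarrow> z a \<in> S \<Longrightarrow> \<exists>n. B a n \<subseteq> S"
    and zout: "\<And>a S. decides \<U> S \<Longrightarrow> z a \<notin> S \<Longrightarrow> \<exists>n. B a n \<inter> S = {}"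
    by metis
  have zin': "z a \<in> S" if d: "decides \<U> S" and m: "B a m \<subseteq> S" for a S m
  proof (rule ccontr)
    assume "z a \<notin> S"
    then obtain n where "B a n \<inter> S = {}" using zout[OF d] by blast
    then show False using Bdec[of n "max m n" a] Bdec[of m "max m n" a] Bne[of a "max m n"] m by fastforce
  qed
  have zout': "z a \<notin> S" if d: "decides \<U> S" and m: "B a m \<inter> S = {}" for a S m
  proof
    assume "z a \<in> S"
    then obtain n where "B a n \<subseteq> S" using zin[OF d] by blast
    then show False using Bdec[of n "max m n" a] Bdec[of m "max m n" a] Bne[of a "max m n"] m by fastforce
  qed
  have zE: "z a \<in> E" for a
  proof (rule zin')
    show "decides \<U> E" using dec by blast
    show "B a 0 \<subseteq> E" unfolding B_def using f(2)[of "node a 0" 0] node(1) by blast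
  qed
  \<comment> \<open>The limits need not lie in the sets of the scheme, but the set splitting the
    first node at which the branches part is decided by the covers, so the limits fall on different
    sides of it.\<close>
  have zinj: "z a \<noteq> z b" if "a \<noteq> b" for a b
  proof -
    have "\<exists>n. a n \<noteq> b n" using that by blast
    then obtain n where n: "a n \<noteq> b n" "\<And>m. m < n \<Longrightarrow> a m = b m"
      using exists_least_iff[of "\<lambda>n. a n \<noteq> b n"] by blast
    then have nn: "node a n = node b n" unfolding node_def by simp
    have dT: "decides \<U> (T n (node a n))" using T[of "node a n" n] node(1) dec by blast
    have "z c \<in> T n (node a n) \<longleftrightarrow> c n" if "node c n = node a n" for c
      using zin'[OF dT, of c "Suc n"] zout'[OF dT, of c "Suc n"] BSuc[of c n] that
      by (cases "c n") auto
    then have "z a \<in> T n (node a n) \<longleftrightarrow> a n" "z b \<in> T n (node a n) \<longleftrightarrow> b n" using nn by auto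
    then show ?thesis using n(1) by auto
  qed
  have zpi: "\<pi> (z a) = \<pi> (z b)" for a b
  proof (rule ccontr)
    assume "\<pi> (z a) \<noteq> \<pi> (z b)"
    then obtain S where S: "S \<in> \<S>" "\<pi> (z a) \<in> S" "\<pi> (z b) \<notin> S"
      using \<S>(3)[OF measurable_space[OF \<pi> zM] measurable_space[OF \<pi> zM]] by metis
    have dS: "decides \<U> (P S)" using dec S(1) by blast
    have "z a \<in> P S" "z b \<notin> P S" using S zM by (auto simp: P_def)
    then obtain n m where nm: "B a n \<subseteq> P S" "B b m \<inter> P S = {}" using zin[OF dS] zout[OF dS] by metis
    define k where "k = max n m"
    have k: "B a k \<subseteq> P S" "B b k \<inter> P S = {}"
      using nm Bdec[of n k a] Bdec[of m k b] unfolding k_def by auto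
    have "node a k \<noteq> node b k"
    proof
      assume "node a k = node b k"
      then have "B a k = B b k" by (simp add: B_def)
      then show False using k Bne[of a k] by auto
    qed
    then have "?sep {s. length s = k} (f k)"
      using sepI[of "node a k" k "node b k" S] k S(1) node(1) unfolding B_def by blast
    then show False using f(1) by blast
  qed
  define C where "C = {w \<in> E. \<pi> w = \<pi> (z (\<lambda>_. True))}"
  have "countable C" unfolding C_def by (rule cs)
  moreover have "range z \<subseteq> C" using zE zpi unfolding C_def by blast
  ultimately have "countable (range z)" by (rule countable_subset[rotated])
  moreover have "inj z" using zinj by (meson injI)
  ultimately have "countable (UNIV :: (nat \<Rightarrow> bool) set)" by (rule countable_image_inj_on)
  then obtain g :: "nat \<Rightarrow> nat \<Rightarrow> bool" where g: "range g = UNIV"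
    using range_from_nat_into[OF UNIV_not_empty] by blast
  obtain k where "g k = (\<lambda>n. \<not> g n n)" using surjD[OF g, of "\<lambda>n. \<not> g n n"] by metis
  then have "g k k = (\<not> g k k)" by (rule fun_cong)
  then show False by simp
qed

text \<open>The countably many Borel sets given by \<open>lusin_novikov\<close> cut \<open>E\<close>
  into graphs of partial functions. Their domains, and preimages under them, are injective images
  under \<open>fst\<close>, hence measurable by \<open>lusin_souslin\<close>.\<close>

theorem countable_sections_enumeration:
  assumes X: "standard_borel X" and E: "E \<in> sets (X \<Otimes>\<^sub>M X)" and r: "\<And>x. x \<in> space X \<Longrightarrow> (x, x) \<in> E"
    and cs: "\<And>x. countable (E `` {x})"
  obtains g :: "nat \<Rightarrow> 'a \<Rightarrow> 'a" where "\<And>n. g n \<in> X \<rightarrow>\<^sub>M X"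
    "\<And>x. x \<in> space X \<Longrightarrow> E `` {x} = range (\<lambda>n. g n x)"
proof -
  let ?M = "X \<Otimes>\<^sub>M X"
  have M: "standard_borel ?M" by (rule standard_borel_pair[OF X X])
  obtain \<S> where \<S>: "countable \<S>" "\<S> \<subseteq> sets X"
    "\<And>x y. x \<in> space X \<Longrightarrow> y \<in> space X \<Longrightarrow> x \<noteq> y \<Longrightarrow> \<exists>S\<in>\<S>. x \<in> S \<and> y \<notin> S"
    using standard_borel_separating[OF X] by metis
  have fm: "fst \<in> ?M \<rightarrow>\<^sub>M X" by (rule measurable_fst)
  have EX: "x \<in> space X" "y \<in> space X" if "(x, y) \<in> E" for x y
    using sets.sets_into_space[OF E] that by (auto simp: space_pair_measure)
  have cE: "countable {z \<in> E. fst z = y}" for y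
  proof -
    have "{z \<in> E. fst z = y} = Pair y ` (E `` {y})" by force
    then show ?thesis using cs[of y] by simp
  qed
  have "E \<in> injective_ideal ?M fst"
    by (rule lusin_novikov[OF M \<S>(1,2) _ fm E cE]) (rule \<S>(3))
  then obtain \<C> where C: "countable \<C>" "\<C> \<subseteq> sets ?M" "\<forall>C\<in>\<C>. inj_on fst C" "E \<subseteq> \<Union>\<C>"
    unfolding injective_ideal_def by (elim CollectE exE conjE)
  define P where "P n = from_nat_into (insert {} \<C>) n \<inter> E" for n
  have rP: "range (from_nat_into (insert {} \<C>)) = insert {} \<C>"
    using C(1) by (intro range_from_nat_into) auto
  have Pin: "from_nat_into (insert {} \<C>) n \<in> insert {} \<C>" for n using rP by blast
  have Pm: "P n \<in> sets ?M" for n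
    unfolding P_def using Pin[of n] C(2) E by (intro sets.Int) auto
  have Pinj: "inj_on fst (P n)" for n
    unfolding P_def using Pin[of n] C(3) by (auto intro: inj_on_subset)
  have PE: "(\<Union>n. P n) = E"
  proof
    show "E \<subseteq> (\<Union>n. P n)"
    proof
      fix z assume z: "z \<in> E"
      then obtain D where D: "D \<in> \<C>" "z \<in> D" using C(4) by blast
      then obtain n where "D = from_nat_into (insert {} \<C>) n" using rP by blast
      then show "z \<in> (\<Union>n. P n)" using z D unfolding P_def by blast
    qed
  qed (auto simp: P_def)
  define D where "D n = fst ` P n" for n
  have im: "fst ` (P n \<inter> B) \<in> sets X" if "B \<in> sets ?M" for n B
    by (rule lusin_souslin[OF M \<S>(1,2) _ fm], rule \<S>(3)) (use Pm that Pinj in \<open>auto intro: inj_on_subset\<close>)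
  have Dm: "D n \<in> sets X" for n
    using im[OF Pm[of n], of n] by (simp add: D_def)
  \<comment> \<open>Off the domain, the default \<open>x\<close> stays in the section because
    \<open>(x, x)\<close> belongs to \<open>E\<close>.\<close>
  define g where "g n x = (if x \<in> D n then THE y. (x, y) \<in> P n else x)" for n x
  have gP: "g n x = y" if "(x, y) \<in> P n" for n x y
  proof -
    have "x \<in> D n" using that by (force simp: D_def)
    moreover have "(THE y. (x, y) \<in> P n) = y"
    proof (rule the_equality)
      show "(x, y) \<in> P n" by (rule that)
      fix y' assume "(x, y') \<in> P n"
      from inj_onD[OF Pinj _ this that] show "y' = y" by simp
    qed
    ultimately show ?thesis by (simp add: g_def)
  qed
  have gE: "(x, g n x) \<in> E" if x: "x \<in> space X" for n x
  proof (cases "x \<in> D n")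
    case True
    then obtain y where "(x, y) \<in> P n" by (auto simp: D_def)
    then show ?thesis using gP[of x y n] PE by auto
  next
    case False
    then show ?thesis using r[OF x] by (simp add: g_def)
  qed
  show ?thesis
  proof (rule that)
    show "g n \<in> X \<rightarrow>\<^sub>M X" for n
    proof (rule measurableI)
      show "g n x \<in> space X" if "x \<in> space X" for x using gE[OF that] EX by blast
      fix S assume S: "S \<in> sets X"
      have "g n -` S \<inter> space X = fst ` (P n \<inter> (space X \<times> S)) \<union> (S - D n)"
      proof (intro equalityI subsetI)
        fix x assume x: "x \<in> g n -` S \<inter> space X"
        show "x \<in> fst ` (P n \<inter> (space X \<times> S)) \<union> (S - D n)"
        proof (cases "x \<in> D n")
          case True
          then obtain y where y: "(x, y) \<in> P n" by (auto simp: D_def)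
          then have "(x, y) \<in> P n \<inter> (space X \<times> S)" using gP[OF y] x by auto
          then show ?thesis by force
        next
          case False
          then show ?thesis using x by (simp add: g_def)
        qed
      next
        fix x assume x: "x \<in> fst ` (P n \<inter> (space X \<times> S)) \<union> (S - D n)"
        show "x \<in> g n -` S \<inter> space X"
        proof (cases "x \<in> D n")
          case True
          then obtain y where y: "(x, y) \<in> P n" "x \<in> space X" "y \<in> S" using x by auto
          then show ?thesis using gP[OF y(1)] by simp
        next
          case False
          then have "x \<in> S" using x by (auto simp: D_def)
          then show ?thesis using False sets.sets_into_space[OF S] by (auto simp: g_def)
        qed
      qed
      moreover have "space X \<times> S \<in> sets ?M" using S by (intro pair_measureI) auto
      ultimately show "g n -` S \<inter> space X \<in> sets X" using im[of "space X \<times> S" n] S Dm[of n] by auto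
    qed
    show "E `` {x} = range (\<lambda>n. g n x)" if x: "x \<in> space X" for x
    proof (intro equalityI subsetI)
      fix y assume "y \<in> E `` {x}"
      then obtain n where "(x, y) \<in> P n" using PE by blast
      then show "y \<in> range (\<lambda>n. g n x)" using gP by blast
    qed (use gE[OF x] in auto)
  qed
qed

section \<open>The Polish group of absolutely summable sequences\<close>

interpretation l1: Metric_space l1_set l1_dist
  by (rule Metric_space_l1)

lemma l1_norm_bound:
  assumes "\<And>F. finite F \<Longrightarrow> (\<Sum>n\<in>F. \<bar>x n\<bar>) \<le> b"
  shows "x \<in> l1_set" "l1_norm x \<le> b"
proof -
  have "(\<lambda>n. \<bar>x n\<bar>) summable_on UNIV"
    by (rule nonneg_bdd_above_summable_on) (use assms in \<open>auto intro!: bdd_aboveI[of _ b]\<close>)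
  then show "x \<in> l1_set" "l1_norm x \<le> b"
    unfolding l1_set_def l1_norm_def using assms by (auto intro!: infsum_le_finite_sums)
qed

lemma sum_le_l1_norm: "x \<in> l1_set \<Longrightarrow> finite F \<Longrightarrow> (\<Sum>n\<in>F. \<bar>x n\<bar>) \<le> l1_norm x"
  unfolding l1_set_def l1_norm_def by (rule finite_sum_le_infsum) auto

lemma sum_le_l1_dist:
  "x \<in> l1_set \<Longrightarrow> y \<in> l1_set \<Longrightarrow> finite F \<Longrightarrow> (\<Sum>n\<in>F. \<bar>x n - y n\<bar>) \<le> l1_dist x y"
  unfolding l1_dist_def by (rule sum_le_l1_norm[OF l1_set_diff])

lemma l1_dist_add_right [simp]: "l1_dist (\<lambda>n. x n + z n) (\<lambda>n. y n + z n) = l1_dist x y"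
  by (simp add: l1_dist_def)

lemma l1_dist_add_add:
  assumes "x \<in> l1_set" "y \<in> l1_set" "x' \<in> l1_set" "y' \<in> l1_set"
  shows "l1_dist (\<lambda>n. x n + y n) (\<lambda>n. x' n + y' n) \<le> l1_dist x x' + l1_dist y y'"
proof -
  have "l1_dist (\<lambda>n. x n + y n) (\<lambda>n. x' n + y' n) \<le>
      l1_dist (\<lambda>n. x n + y n) (\<lambda>n. x' n + y n) + l1_dist (\<lambda>n. x' n + y n) (\<lambda>n. x' n + y' n)"
    using assms by (intro l1.triangle l1_set_add)
  moreover have "l1_dist (\<lambda>n. x' n + y n) (\<lambda>n. x' n + y' n) = l1_dist y y'" by (simp add: l1_dist_def)
  ultimately show ?thesis by simp
qed

lemma l1_complete: "l1.mcomplete"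
  unfolding l1.mcomplete_def
proof (intro allI impI)
  fix \<sigma> assume "l1.MCauchy \<sigma>"
  then have \<sigma>: "\<And>n. \<sigma> n \<in> l1_set" and
    ca: "\<And>e. e > 0 \<Longrightarrow> \<exists>N. \<forall>n n'. N \<le> n \<longrightarrow> N \<le> n' \<longrightarrow> l1_dist (\<sigma> n) (\<sigma> n') < e"
    unfolding l1.MCauchy_def by auto
  have coord: "\<bar>\<sigma> n k - \<sigma> m k\<bar> \<le> l1_dist (\<sigma> n) (\<sigma> m)" for n m k
    using sum_le_l1_dist[OF \<sigma> \<sigma>, of "{k}" n m] by simp
  have "Cauchy (\<lambda>n. \<sigma> n k)" for k
  proof (rule metric_CauchyI)
    fix e :: real assume "e > 0"
    then obtain N where "\<forall>n n'. N \<le> n \<longrightarrow> N \<le> n' \<longrightarrow> l1_dist (\<sigma> n) (\<sigma> n') < e" using ca by blast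
    then show "\<exists>M. \<forall>m\<ge>M. \<forall>n\<ge>M. dist (\<sigma> m k) (\<sigma> n k) < e"
      using coord[of _ k] by (intro exI[of _ N]) (metis dist_real_def le_less_trans)
  qed
  then have "\<exists>l. (\<lambda>n. \<sigma> n k) \<longlonglongrightarrow> l" for k
    using Cauchy_convergent_iff convergent_def by blast
  then obtain X where X: "\<And>k. (\<lambda>n. \<sigma> n k) \<longlonglongrightarrow> X k" by metis
  \<comment> \<open>Bounds on sums over finite index sets survive coordinatewise limits, and the
    bound \<open>e\<close> is the same for all finite sets.\<close>
  have lim: "(\<lambda>k. \<sigma> n k - X k) \<in> l1_set \<and> l1_norm (\<lambda>k. \<sigma> n k - X k) \<le> e"
    if "\<And>n'. N \<le> n' \<Longrightarrow> l1_dist (\<sigma> n) (\<sigma> n') \<le> e" for n N e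
  proof -
    have "(\<Sum>k\<in>F. \<bar>\<sigma> n k - X k\<bar>) \<le> e" if F: "finite F" for F
    proof (rule LIMSEQ_le_const2)
      show "(\<lambda>m. \<Sum>k\<in>F. \<bar>\<sigma> n k - \<sigma> m k\<bar>) \<longlonglongrightarrow> (\<Sum>k\<in>F. \<bar>\<sigma> n k - X k\<bar>)"
        by (intro tendsto_intros X)
      show "\<exists>M. \<forall>m\<ge>M. (\<Sum>k\<in>F. \<bar>\<sigma> n k - \<sigma> m k\<bar>) \<le> e"
        using sum_le_l1_dist[OF \<sigma> \<sigma> F] that \<open>\<And>n'. N \<le> n' \<Longrightarrow> l1_dist (\<sigma> n) (\<sigma> n') \<le> e\<close>
        by (intro exI[of _ N]) (meson order_trans)
    qed
    then show ?thesis using l1_norm_bound[of "\<lambda>k. \<sigma> n k - X k" e] by blast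
  qed
  have Xl: "X \<in> l1_set"
  proof -
    obtain N where N: "\<forall>n n'. N \<le> n \<longrightarrow> N \<le> n' \<longrightarrow> l1_dist (\<sigma> n) (\<sigma> n') < 1" using ca[of 1] by auto
    have "(\<lambda>k. \<sigma> N k - X k) \<in> l1_set" using lim[of N N 1] N by (simp add: less_imp_le)
    from l1_set_diff[OF \<sigma>[of N] this] show ?thesis by simp
  qed
  have "limitin l1.mtopology \<sigma> X sequentially"
    unfolding l1.limit_metric_sequentially
  proof (intro conjI allI impI Xl)
    fix e :: real assume "e > 0"
    then obtain N where N: "\<forall>n n'. N \<le> n \<longrightarrow> N \<le> n' \<longrightarrow> l1_dist (\<sigma> n) (\<sigma> n') < e / 2"
      using ca[of "e / 2"] by auto
    have "l1_dist (\<sigma> n) X \<le> e / 2" if "n \<ge> N" for n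
      using lim[of N n "e / 2"] N that by (simp add: l1_dist_def less_imp_le)
    then show "\<exists>N. \<forall>n\<ge>N. \<sigma> n \<in> l1_set \<and> l1_dist (\<sigma> n) X < e"
      using \<sigma> \<open>e > 0\<close> by (intro exI[of _ N]) (force intro: le_less_trans)
  qed
  then show "\<exists>x. limitin l1.mtopology \<sigma> x sequentially" by blast
qed

section \<open>A countable dense set and the topological group structure\<close>

definition l1_dense :: "nat \<Rightarrow> nat \<Rightarrow> real" where
  "l1_dense i = (let r = from_nat i :: rat list in (\<lambda>n. if n < length r then of_rat (r ! n) else 0))"

lemma l1_finite_support:
  assumes "\<And>n. n \<ge> N \<Longrightarrow> x n = 0"
  shows "x \<in> l1_set"
proof (rule l1_norm_bound)
  fix F :: "nat set" assume "finite F"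
  have "(\<Sum>n\<in>F. \<bar>x n\<bar>) = (\<Sum>n\<in>F \<inter> {..<N}. \<bar>x n\<bar>)"
    using \<open>finite F\<close> assms by (intro sum.mono_neutral_right) (auto simp: not_less)
  also have "\<dots> \<le> (\<Sum>n<N. \<bar>x n\<bar>)" by (rule sum_mono2) auto
  finally show "(\<Sum>n\<in>F. \<bar>x n\<bar>) \<le> (\<Sum>n<N. \<bar>x n\<bar>)" .
qed

lemma l1_dense_in [simp]: "l1_dense i \<in> l1_set"
  by (rule l1_finite_support[of "length (from_nat i :: rat list)"]) (simp add: l1_dense_def Let_def)

lemma l1_dense_approx:
  assumes x: "x \<in> l1_set" and e: "e > 0"
  obtains i where "l1_dist x (l1_dense i) < e"
proof -
  have sm: "(\<lambda>n. \<bar>x n\<bar>) summable_on UNIV" using x by (simp add: l1_set_def)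
  have hs: "((\<lambda>n. \<bar>x n\<bar>) has_sum l1_norm x) UNIV"
    unfolding l1_norm_def using sm by (rule has_sum_infsum)
  obtain F where F: "finite F" "\<And>G. finite G \<Longrightarrow> F \<subseteq> G \<Longrightarrow> dist (sum (\<lambda>n. \<bar>x n\<bar>) G) (l1_norm x) < e / 4"
    using tendstoD[OF hs[unfolded has_sum_def], of "e / 4"] e
    unfolding eventually_finite_subsets_at_top by auto
  obtain N where N: "F \<subseteq> {..<N}" using finite_nat_bounded[OF F(1)] by blast
  have tail: "(\<Sum>n\<in>G. \<bar>x n\<bar>) \<le> e / 4" if G: "finite G" "G \<inter> {..<N} = {}" for G
  proof -
    have "(\<Sum>n\<in>G \<union> {..<N}. \<bar>x n\<bar>) = (\<Sum>n\<in>G. \<bar>x n\<bar>) + (\<Sum>n<N. \<bar>x n\<bar>)"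
      using G by (intro sum.union_disjoint) auto
    moreover have "(\<Sum>n\<in>G \<union> {..<N}. \<bar>x n\<bar>) \<le> l1_norm x" using x G by (intro sum_le_l1_norm) auto
    moreover have "dist (\<Sum>n<N. \<bar>x n\<bar>) (l1_norm x) < e / 4" using F(2)[of "{..<N}"] N by simp
    ultimately show ?thesis unfolding dist_real_def by linarith
  qed
  \<comment> \<open>The errors at the first \<open>N\<close> coordinates add up to at most
    \<open>e / 4\<close>, as does the tail; \<open>N + 1\<close> avoids division by zero.\<close>
  define d where "d = e / (4 * (real N + 1))"
  have "d > 0" using e by (simp add: d_def)
  have "\<exists>r :: rat. \<bar>x n - of_rat r\<bar> < d" for n
  proof -
    obtain r where "x n - d < of_rat r" "of_rat r < x n" using of_rat_dense[of "x n - d" "x n"] \<open>d > 0\<close> by auto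
    then show ?thesis by (intro exI[of _ r]) auto
  qed
  then obtain r :: "nat \<Rightarrow> rat" where r: "\<And>n. \<bar>x n - of_rat (r n)\<bar> < d" by metis
  define i where "i = to_nat (map r [0..<N])"
  have q: "l1_dense i n = (if n < N then of_rat (r n) else 0)" for n
    by (simp add: l1_dense_def i_def)
  have "l1_dist x (l1_dense i) \<le> e / 2"
    unfolding l1_dist_def
  proof (rule l1_norm_bound(2))
    fix G :: "nat set" assume G: "finite G"
    have "(\<Sum>n\<in>G. \<bar>x n - l1_dense i n\<bar>) =
        (\<Sum>n\<in>G \<inter> {..<N}. \<bar>x n - l1_dense i n\<bar>) + (\<Sum>n\<in>G - {..<N}. \<bar>x n - l1_dense i n\<bar>)"
      using G by (subst sum.union_disjoint[symmetric]) (auto simp: Int_Diff_Un)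
    also have "(\<Sum>n\<in>G - {..<N}. \<bar>x n - l1_dense i n\<bar>) = (\<Sum>n\<in>G - {..<N}. \<bar>x n\<bar>)"
      by (rule sum.cong) (auto simp: q)
    also have "\<dots> \<le> e / 4" using G by (intro tail) auto
    also have "(\<Sum>n\<in>G \<inter> {..<N}. \<bar>x n - l1_dense i n\<bar>) \<le> (\<Sum>n\<in>G \<inter> {..<N}. d)"
      by (rule sum_mono) (use r in \<open>auto simp: q intro: less_imp_le\<close>)
    also have "\<dots> \<le> real N * d"
    proof -
      have "card (G \<inter> {..<N}) \<le> card {..<N}" by (rule card_mono) auto
      then show ?thesis using \<open>d > 0\<close> by (simp add: mult_right_mono)
    qed
    also have "\<dots> \<le> e / 4"
    proof -
      have "real N * d \<le> (real N + 1) * d" using \<open>d > 0\<close> by (simp add: mult_right_mono)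
      also have "\<dots> = e / 4" by (simp add: d_def field_simps)
      finally show ?thesis .
    qed
    finally show "(\<Sum>n\<in>G. \<bar>x n - l1_dense i n\<bar>) \<le> e / 2" by simp
  qed
  then show ?thesis using e that[of i] by simp
qed

lemma polish_l1_topology: "polish_topology l1_topology"
  unfolding polish_topology_def
proof
  show "completely_metrizable_space l1_topology"
    unfolding l1_topology_def completely_metrizable_space_def
    using l1_complete Metric_space_l1 by blast
  have "x \<in> l1.mtopology closure_of (range l1_dense)" if x: "x \<in> l1_set" for x
    unfolding l1.metric_closure_of
  proof (intro CollectI conjI allI impI x)
    fix e :: real assume "e > 0"
    then obtain i where "l1_dist x (l1_dense i) < e" using l1_dense_approx[OF x] by blast
    then show "\<exists>y\<in>range l1_dense. y \<in> l1.mball x e" using x by auto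
  qed
  then show "separable_space l1_topology"
    unfolding separable_space_def l1_topology_def
    by (intro exI[of _ "range l1_dense"]) (auto dest: l1.metric_closure_of[THEN equalityD1, THEN subsetD])
qed

lemma polish_group_l1: "polish_group l1_group l1_topology"
  unfolding polish_group_def
proof (intro conjI)
  interpret G: comm_group l1_group by (rule comm_group_l1)
  show "group l1_group" ..
  show "topspace l1_topology = carrier l1_group" by (simp add: l1_topology_def l1_group_def)
  show "polish_topology l1_topology" by (rule polish_l1_topology)
  show "continuous_map (prod_topology l1_topology l1_topology) l1_topology (\<lambda>(g, h). g \<otimes>\<^bsub>l1_group\<^esub> h)"
    unfolding l1_topology_def l1.continuous_map_to_metric
  proof (intro ballI allI impI)
    fix p :: "(nat \<Rightarrow> real) \<times> (nat \<Rightarrow> real)" and e :: real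
    assume "p \<in> topspace (prod_topology l1.mtopology l1.mtopology)" and e: "e > 0"
    then obtain g h where p: "p = (g, h)" "g \<in> l1_set" "h \<in> l1_set" by (cases p) auto
    let ?U = "l1.mball g (e / 2) \<times> l1.mball h (e / 2)"
    have "openin (prod_topology l1.mtopology l1.mtopology) ?U" by (simp add: openin_prod_Times_iff)
    moreover have "p \<in> ?U" using p e by simp
    moreover have "(case y of (g, h) \<Rightarrow> g \<otimes>\<^bsub>l1_group\<^esub> h) \<in> l1.mball (case p of (g, h) \<Rightarrow> g \<otimes>\<^bsub>l1_group\<^esub> h) e"
      if "y \<in> ?U" for y
    proof -
      obtain g' h' where y: "y = (g', h')" "g' \<in> l1_set" "h' \<in> l1_set" "l1_dist g g' < e / 2" "l1_dist h h' < e / 2"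
        using \<open>y \<in> ?U\<close> by (cases y) auto
      have "l1_dist (\<lambda>n. g n + h n) (\<lambda>n. g' n + h' n) < e"
        using l1_dist_add_add[OF p(2,3) y(2,3)] y(4,5) by linarith
      then show ?thesis using p y by (simp add: l1_group_def l1_set_add)
    qed
    ultimately show "\<exists>U. openin (prod_topology l1.mtopology l1.mtopology) U \<and> p \<in> U \<and>
        (\<forall>y\<in>U. (case y of (g, h) \<Rightarrow> g \<otimes>\<^bsub>l1_group\<^esub> h) \<in> l1.mball (case p of (g, h) \<Rightarrow> g \<otimes>\<^bsub>l1_group\<^esub> h) e)"
      by blast
  qed
  have inv: "inv\<^bsub>l1_group\<^esub> g = (\<lambda>n. - g n)" if "g \<in> l1_set" for g
    by (rule G.inv_equality) (use that in \<open>auto simp: l1_group_def l1_set_uminus\<close>)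
  show "continuous_map l1_topology l1_topology (\<lambda>g. inv\<^bsub>l1_group\<^esub> g)"
    unfolding l1_topology_def l1.continuous_map_to_metric
  proof (intro ballI allI impI)
    fix g :: "nat \<Rightarrow> real" and e :: real assume g: "g \<in> topspace l1.mtopology" and e: "e > 0"
    have "inv\<^bsub>l1_group\<^esub> y \<in> l1.mball (inv\<^bsub>l1_group\<^esub> g) e" if "y \<in> l1.mball g e" for y
    proof -
      have "y \<in> l1_set" "g \<in> l1_set" "l1_dist g y < e" using that by auto
      moreover have "l1_dist (\<lambda>n. - g n) (\<lambda>n. - y n) = l1_dist g y"
        by (simp add: l1_dist_def l1_norm_def abs_minus_commute)
      ultimately show ?thesis by (simp add: inv l1_set_uminus)
    qed
    then show "\<exists>U. openin l1.mtopology U \<and> g \<in> U \<and> (\<forall>y\<in>U. inv\<^bsub>l1_group\<^esub> y \<in> l1.mball (inv\<^bsub>l1_group\<^esub> g) e)"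
      using g e by (intro exI[of _ "l1.mball g e"]) auto
  qed
qed

section \<open>The universal space of Lipschitz functions\<close>

text \<open>A sequence \<open>u\<close> encodes the functions \<open>u\<^sub>m\<close> on \<open>l1_set\<close> determined by
  \<open>u\<^sub>m (l1_dense i) = u (prod_encode (i, m))\<close>; the extension from the dense set is McShane's.\<close>

definition lip_space :: "(nat \<Rightarrow> real) set" where
  "lip_space = {u. (\<forall>p. 0 \<le> u p \<and> u p \<le> 1) \<and>
     (\<forall>i j m. \<bar>u (prod_encode (i, m)) - u (prod_encode (j, m))\<bar> \<le> l1_dist (l1_dense i) (l1_dense j))}"

definition lip_ext :: "(nat \<Rightarrow> real) \<Rightarrow> (nat \<Rightarrow> real) \<Rightarrow> nat \<Rightarrow> real" where
  "lip_ext u a m = (INF i. u (prod_encode (i, m)) + l1_dist a (l1_dense i))"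

text \<open>Translation by \<open>a\<close> does not preserve the dense set, so the translated
  function is read off from the extension.\<close>

definition lip_translate :: "(nat \<Rightarrow> real) \<Rightarrow> (nat \<Rightarrow> real) \<Rightarrow> nat \<Rightarrow> real" where
  "lip_translate a u p = (case prod_decode p of (i, m) \<Rightarrow> lip_ext u (\<lambda>n. l1_dense i n + a n) m)"

lemma lip_ext_near:
  assumes u: "u \<in> lip_space" and a: "a \<in> l1_set"
  shows "\<bar>lip_ext u a m - u (prod_encode (i, m))\<bar> \<le> l1_dist a (l1_dense i)"
proof -
  let ?f = "\<lambda>j. u (prod_encode (j, m)) + l1_dist a (l1_dense j)"
  have ge: "u (prod_encode (i, m)) - l1_dist a (l1_dense i) \<le> ?f j" for j
  proof -
    have "\<bar>u (prod_encode (i, m)) - u (prod_encode (j, m))\<bar> \<le> l1_dist (l1_dense i) (l1_dense j)"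
      using u by (simp add: lip_space_def)
    moreover have "l1_dist (l1_dense i) (l1_dense j) \<le> l1_dist (l1_dense i) a + l1_dist a (l1_dense j)"
      using a by (intro l1.triangle) auto
    moreover have "l1_dist (l1_dense i) a = l1_dist a (l1_dense i)" by (rule l1.commute)
    ultimately show ?thesis by linarith
  qed
  then have "u (prod_encode (i, m)) - l1_dist a (l1_dense i) \<le> lip_ext u a m"
    unfolding lip_ext_def by (intro cINF_greatest) auto
  moreover have "lip_ext u a m \<le> ?f i"
    unfolding lip_ext_def using ge by (intro cINF_lower bdd_belowI2) auto
  ultimately show ?thesis by linarith
qed

lemma lip_ext_dense [simp]: "u \<in> lip_space \<Longrightarrow> lip_ext u (l1_dense i) m = u (prod_encode (i, m))"
  using lip_ext_near[of u "l1_dense i" m i] by simp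

text \<open>Two 1-Lipschitz functions that agree on a dense set agree. This identifies extensions,
  in particular those of translates and of the coded distance functions, without computing
  infima.\<close>

lemma lip_ext_unique:
  assumes u: "u \<in> lip_space" and a: "a \<in> l1_set"
    and h: "\<And>b c. b \<in> l1_set \<Longrightarrow> c \<in> l1_set \<Longrightarrow> \<bar>h b - h c\<bar> \<le> l1_dist b c"
    and hu: "\<And>i. h (l1_dense i) = u (prod_encode (i, m))"
  shows "lip_ext u a m = h a"
proof (rule ccontr)
  assume "lip_ext u a m \<noteq> h a"
  then have "\<bar>lip_ext u a m - h a\<bar> / 2 > 0" by simp
  then obtain i where i: "l1_dist a (l1_dense i) < \<bar>lip_ext u a m - h a\<bar> / 2"
    using l1_dense_approx[OF a] by blast
  have "\<bar>h a - h (l1_dense i)\<bar> \<le> l1_dist a (l1_dense i)" using a by (intro h) auto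
  then have "\<bar>lip_ext u a m - h a\<bar> \<le> l1_dist a (l1_dense i) + l1_dist a (l1_dense i)"
    using lip_ext_near[OF u a, of m i] unfolding hu by linarith
  then show False using i by simp
qed

lemma lip_ext_lipschitz:
  assumes u: "u \<in> lip_space" and a: "a \<in> l1_set" and b: "b \<in> l1_set"
  shows "\<bar>lip_ext u a m - lip_ext u b m\<bar> \<le> l1_dist a b"
proof (rule field_le_epsilon)
  fix e :: real assume "e > 0"
  then obtain i where i: "l1_dist a (l1_dense i) < e / 2"
    using l1_dense_approx[OF a, of "e / 2"] by auto
  have "l1_dist b (l1_dense i) \<le> l1_dist b a + l1_dist a (l1_dense i)"
    using a b by (intro l1.triangle) auto
  then show "\<bar>lip_ext u a m - lip_ext u b m\<bar> \<le> l1_dist a b + e"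
    using lip_ext_near[OF u a, of m i] lip_ext_near[OF u b, of m i] i l1.commute[of a b] by linarith
qed

lemma lip_ext_bounds:
  assumes u: "u \<in> lip_space" and a: "a \<in> l1_set"
  shows "0 \<le> lip_ext u a m" "lip_ext u a m \<le> 1"
proof -
  have u01: "0 \<le> u p" "u p \<le> 1" for p using u by (simp_all add: lip_space_def)
  show "0 \<le> lip_ext u a m" unfolding lip_ext_def using u01 by (intro cINF_greatest) auto
  show "lip_ext u a m \<le> 1"
  proof (rule field_le_epsilon)
    fix e :: real assume "e > 0"
    then obtain i where "l1_dist a (l1_dense i) < e" using l1_dense_approx[OF a] by blast
    then show "lip_ext u a m \<le> 1 + e"
      using lip_ext_near[OF u a, of m i] u01(2)[of "prod_encode (i, m)"] by linarith
  qed
qed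

lemma lip_translate_in:
  assumes u: "u \<in> lip_space" and a: "a \<in> l1_set"
  shows "lip_translate a u \<in> lip_space"
proof -
  have q: "(\<lambda>n. l1_dense i n + a n) \<in> l1_set" for i using a by (intro l1_set_add) auto
  have "\<bar>lip_translate a u (prod_encode (i, m)) - lip_translate a u (prod_encode (j, m))\<bar>
      \<le> l1_dist (l1_dense i) (l1_dense j)" for i j m
    using lip_ext_lipschitz[OF u q q, of i m j] by (simp add: lip_translate_def)
  moreover have "0 \<le> lip_translate a u p \<and> lip_translate a u p \<le> 1" for p
    using lip_ext_bounds[OF u q] by (simp add: lip_translate_def split: prod.split)
  ultimately show ?thesis by (simp add: lip_space_def)
qed

lemma lip_ext_translate:
  assumes u: "u \<in> lip_space" and a: "a \<in> l1_set" and b: "b \<in> l1_set"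
  shows "lip_ext (lip_translate a u) b m = lip_ext u (\<lambda>n. b n + a n) m"
proof (rule lip_ext_unique[OF lip_translate_in[OF u a] b])
  show "\<bar>lip_ext u (\<lambda>n. b n + a n) m - lip_ext u (\<lambda>n. c n + a n) m\<bar> \<le> l1_dist b c"
    if "b \<in> l1_set" "c \<in> l1_set" for b c
    using lip_ext_lipschitz[OF u l1_set_add[OF that(1) a] l1_set_add[OF that(2) a], of m] by simp
qed (simp add: lip_translate_def)

lemma lip_translate_zero:
  assumes "u \<in> lip_space"
  shows "lip_translate (\<lambda>n. 0) u = u"
proof
  fix p
  obtain i m where p: "p = prod_encode (i, m)" by (metis prod_decode_inverse surj_pair)
  show "lip_translate (\<lambda>n. 0) u p = u p" using assms by (simp add: lip_translate_def p)
qed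

lemma lip_translate_add:
  assumes u: "u \<in> lip_space" and a: "a \<in> l1_set" and b: "b \<in> l1_set"
  shows "lip_translate a (lip_translate b u) = lip_translate (\<lambda>n. a n + b n) u"
proof
  fix p
  obtain i m where p: "prod_decode p = (i, m)" by (cases "prod_decode p")
  have "lip_ext (lip_translate b u) (\<lambda>n. l1_dense i n + a n) m =
      lip_ext u (\<lambda>n. (l1_dense i n + a n) + b n) m"
    by (rule lip_ext_translate[OF u b l1_set_add[OF l1_dense_in a]])
  then show "lip_translate a (lip_translate b u) p = lip_translate (\<lambda>n. a n + b n) u p"
    by (simp add: lip_translate_def p add.assoc)
qed

text \<open>Restricted to \<open>lip_space\<close> because the elements of \<open>Bij\<close> have
  to be extensional.\<close>

definition lip_action :: "(nat \<Rightarrow> real) \<Rightarrow> (nat \<Rightarrow> real) \<Rightarrow> nat \<Rightarrow> real" where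
  "lip_action a = (\<lambda>u\<in>lip_space. lip_translate a u)"

definition lip_topology :: "(nat \<Rightarrow> real) topology" where
  "lip_topology = top_of_set lip_space"

lemma topspace_lip_topology [simp]: "topspace lip_topology = lip_space"
  by (simp add: lip_topology_def)

lemma lip_action_Bij:
  assumes a: "a \<in> l1_set"
  shows "lip_action a \<in> Bij lip_space"
proof -
  have inverse: "lip_translate b (lip_translate c u) = u"
    if "u \<in> lip_space" "b \<in> l1_set" "c \<in> l1_set" "\<And>n. b n + c n = 0" for b c u
    using lip_translate_add[OF that(1-3)] lip_translate_zero[OF that(1)] that(4) by simp
  have "bij_betw (lip_action a) lip_space lip_space"
  proof (rule bij_betw_byWitness[where f' = "lip_translate (\<lambda>n. - a n)"])
    show "\<forall>u\<in>lip_space. lip_translate (\<lambda>n. - a n) (lip_action a u) = u"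
      using a by (simp add: lip_action_def inverse l1_set_uminus)
    show "\<forall>u\<in>lip_space. lip_action a (lip_translate (\<lambda>n. - a n) u) = u"
      using a by (simp add: lip_action_def inverse l1_set_uminus lip_translate_in)
    show "lip_action a ` lip_space \<subseteq> lip_space"
      using a by (auto simp: lip_action_def lip_translate_in)
    show "lip_translate (\<lambda>n. - a n) ` lip_space \<subseteq> lip_space"
      using a by (auto simp: lip_translate_in l1_set_uminus)
  qed
  then show ?thesis by (simp add: Bij_def lip_action_def)
qed

lemma lip_group_action: "group_action l1_group lip_space lip_action"
  unfolding group_action_def group_hom_def group_hom_axioms_def
proof (intro conjI)
  show "group l1_group" using comm_group_l1 by (rule comm_group.axioms(2))
  show "group (BijGroup lip_space)" by (rule group_BijGroup)
  show "lip_action \<in> hom l1_group (BijGroup lip_space)"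
  proof (rule homI)
    show "lip_action a \<in> carrier (BijGroup lip_space)" if "a \<in> carrier l1_group" for a
      using that lip_action_Bij by (simp add: BijGroup_def l1_group_def)
    fix a b assume "a \<in> carrier l1_group" "b \<in> carrier l1_group"
    then have ab: "a \<in> l1_set" "b \<in> l1_set" by (simp_all add: l1_group_def)
    have "lip_action (\<lambda>n. a n + b n) = compose lip_space (lip_action a) (lip_action b)"
      using ab by (auto simp: lip_action_def compose_def lip_translate_add lip_translate_in fun_eq_iff)
    then show "lip_action (a \<otimes>\<^bsub>l1_group\<^esub> b) = lip_action a \<otimes>\<^bsub>BijGroup lip_space\<^esub> lip_action b"
      using ab by (simp add: BijGroup_def l1_group_def lip_action_Bij)
  qed
qed

text \<open>As all functions are 1-Lipschitz, a change of the group element costs at most its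
  distance, uniformly in \<open>u\<close>. Closeness of \<open>u\<close> and \<open>v\<close> at one
  dense point near the translated argument therefore controls a coordinate of the result.\<close>

lemma lip_continuous_action: "continuous_action l1_group l1_topology lip_topology lip_action"
  unfolding continuous_action_def
proof
  show "group_action l1_group (topspace lip_topology) lip_action" by (simp add: lip_group_action)
  let ?X = "prod_topology l1_topology lip_topology"
  have top: "topspace ?X = l1_set \<times> lip_space" by (simp add: l1_topology_def)
  have "continuous_map ?X euclideanreal (\<lambda>z. (case z of (a, u) \<Rightarrow> lip_action a u) p)" for p
    unfolding mtopology_is_euclidean[symmetric] Met_TC.continuous_map_to_metric
  proof (intro ballI allI impI)
    fix z and e :: real assume "z \<in> topspace ?X" and e: "e > 0"
    then obtain a u where z: "z = (a, u)" and a: "a \<in> l1_set" and u: "u \<in> lip_space"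
      unfolding top by blast
    obtain i m where p: "prod_decode p = (i, m)" by (cases "prod_decode p")
    have act: "lip_action b v p = lip_ext v (\<lambda>n. l1_dense i n + b n) m" if "v \<in> lip_space" for b v
      using that by (simp add: lip_action_def lip_translate_def p)
    have qa: "(\<lambda>n. l1_dense i n + b n) \<in> l1_set" if "b \<in> l1_set" for b using that by (intro l1_set_add) auto
    \<comment> \<open>The quarters of \<open>e\<close> are spent on passing to
      \<open>l1_dense j\<close> for \<open>u\<close> and for \<open>v\<close>, on replacing
      \<open>u\<close> by \<open>v\<close> there, and on replacing \<open>a\<close> by
      \<open>b\<close>.\<close>
    obtain j where j: "l1_dist (\<lambda>n. l1_dense i n + a n) (l1_dense j) < e / 4"
      using l1_dense_approx[OF qa[OF a], of "e / 4"] e by auto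
    let ?k = "prod_encode (j, m)"
    let ?U = "l1.mball a (e / 4) \<times> (lip_space \<inter> {v. \<bar>v ?k - u ?k\<bar> < e / 4})"
    have "open {v :: nat \<Rightarrow> real. \<bar>v ?k - u ?k\<bar> < e / 4}"
      by (intro open_Collect_less continuous_intros continuous_on_product_coordinates)
    then have "openin lip_topology (lip_space \<inter> {v. \<bar>v ?k - u ?k\<bar> < e / 4})"
      unfolding lip_topology_def by (rule openin_open_Int)
    then have "openin ?X ?U" by (simp add: openin_prod_Times_iff l1_topology_def)
    moreover have "z \<in> ?U" using z a u e by simp
    moreover have "(case y of (a, u) \<Rightarrow> lip_action a u) p \<in> Met_TC.mball ((case z of (a, u) \<Rightarrow> lip_action a u) p) e"
      if y: "y \<in> ?U" for y
    proof -
      obtain b v where y: "y = (b, v)" and b: "b \<in> l1_set" "l1_dist a b < e / 4"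
        and v: "v \<in> lip_space" "\<bar>v ?k - u ?k\<bar> < e / 4"
        using y by (cases y) auto
      have "l1_dist (\<lambda>n. l1_dense i n + a n) (\<lambda>n. l1_dense i n + b n) = l1_dist a b"
        by (simp add: l1_dist_def)
      then have "\<bar>lip_ext v (\<lambda>n. l1_dense i n + a n) m - lip_ext v (\<lambda>n. l1_dense i n + b n) m\<bar> < e / 4"
        using lip_ext_lipschitz[OF v(1) qa[OF a] qa[OF b(1)], of m] b(2) by linarith
      moreover have "\<bar>lip_ext v (\<lambda>n. l1_dense i n + a n) m - v ?k\<bar> < e / 4"
        using lip_ext_near[OF v(1) qa[OF a], of m j] j by linarith
      moreover have "\<bar>lip_ext u (\<lambda>n. l1_dense i n + a n) m - u ?k\<bar> < e / 4"
        using lip_ext_near[OF u qa[OF a], of m j] j by linarith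
      ultimately have "\<bar>lip_action a u p - lip_action b v p\<bar> < e"
        unfolding act[OF u] act[OF v(1)] using v(2) by linarith
      then show ?thesis by (simp add: y z dist_real_def)
    qed
    ultimately show "\<exists>U. openin ?X U \<and> z \<in> U \<and>
      (\<forall>y\<in>U. (case y of (a, u) \<Rightarrow> lip_action a u) p \<in> Met_TC.mball ((case z of (a, u) \<Rightarrow> lip_action a u) p) e)"
      by blast
  qed
  then have "continuous_map ?X euclidean (\<lambda>(a, u). lip_action a u)"
    unfolding euclidean_product_topology[symmetric] continuous_map_componentwise_UNIV by blast
  moreover have "(\<lambda>(a, u). lip_action a u) \<in> topspace ?X \<rightarrow> lip_space"
    unfolding top by (auto simp: lip_action_def lip_translate_in)
  ultimately show "continuous_map ?X lip_topology (\<lambda>(a, u). lip_action a u)"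
    unfolding lip_topology_def by (simp add: continuous_map_in_subtopology Pi_iff image_subset_iff)
qed

lemma polish_lip_topology: "polish_topology lip_topology"
  unfolding polish_topology_def
proof
  have 1: "closed {u :: nat \<Rightarrow> real. 0 \<le> u p \<and> u p \<le> 1}" for p
    by (intro closed_Collect_conj closed_Collect_le continuous_intros continuous_on_product_coordinates)
  have 2: "closed {u :: nat \<Rightarrow> real. \<bar>u k - u l\<bar> \<le> r}" for k l r
    by (intro closed_Collect_le continuous_intros continuous_on_product_coordinates)
  have "closed lip_space"
    unfolding lip_space_def by (rule closed_Collect_conj) (rule closed_Collect_all 1 2)+
  then show "completely_metrizable_space lip_topology"
    unfolding lip_topology_def
    by (intro completely_metrizable_space_closedin completely_metrizable_space_euclidean) simp
  obtain D where D: "countable D" "D \<subseteq> lip_space" "lip_space \<subseteq> closure D"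
    using separable[of lip_space] by metis
  have "top_of_set lip_space closure_of D = lip_space \<inter> closure (lip_space \<inter> D)"
    by (simp add: closure_of_subtopology)
  also have "lip_space \<inter> D = D" using D(2) by blast
  finally have "top_of_set lip_space closure_of D = lip_space" using D(3) by blast
  then show "separable_space lip_topology"
    unfolding separable_space_def lip_topology_def using D by (intro exI[of _ D]) simp
qed

section \<open>Borel maps into the Lipschitz space and the reduction\<close>

lemma measurable_lip_space:
  assumes "\<And>x. x \<in> space X \<Longrightarrow> f x \<in> lip_space" "\<And>p. (\<lambda>x. f x p) \<in> borel_measurable X"
  shows "f \<in> X \<rightarrow>\<^sub>M borel_of lip_topology"
  unfolding borel_of_def
proof (rule measurable_measure_of)
  have f: "f \<in> X \<rightarrow>\<^sub>M borel" using assms(2) by (rule measurable_coordinatewise_then_product)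
  fix U assume "U \<in> {U. openin lip_topology U}"
  then obtain V where V: "open V" "U = lip_space \<inter> V"
    unfolding lip_topology_def openin_open by blast
  have "f -` U \<inter> space X = f -` V \<inter> space X" using V(2) assms(1) by blast
  then show "f -` U \<inter> space X \<in> sets X" using measurable_sets[OF f, of V] V(1) by simp
next
  show "{U. openin lip_topology U} \<subseteq> Pow (topspace lip_topology)" using openin_subset by blast
  show "f \<in> space X \<rightarrow> topspace lip_topology" using assms(1) by simp
qed

lemma borel_measurable_l1_dist:
  assumes "\<And>x. x \<in> space X \<Longrightarrow> h x \<in> l1_set" "\<And>l. (\<lambda>x. h x l) \<in> borel_measurable X" "a \<in> l1_set"
  shows "(\<lambda>x. l1_dist a (h x)) \<in> borel_measurable X"
proof -
  have "l1_dist a (h x) = (\<Sum>l. \<bar>a l - h x l\<bar>)" if "x \<in> space X" for x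
  proof -
    have "(\<lambda>l. \<bar>a l - h x l\<bar>) summable_on UNIV"
      using l1_set_diff[OF assms(3) assms(1)[OF that]] by (simp add: l1_set_def)
    then have "((\<lambda>l. \<bar>a l - h x l\<bar>) has_sum l1_dist a (h x)) UNIV"
      unfolding l1_dist_def l1_norm_def by (rule has_sum_infsum)
    then show ?thesis by (intro sums_unique has_sum_imp_sums)
  qed
  moreover have "(\<lambda>x. \<Sum>l. \<bar>a l - h x l\<bar>) \<in> borel_measurable X"
    using assms(2) by (intro borel_measurable_suminf borel_measurable_abs borel_measurable_diff) auto
  ultimately show ?thesis by (simp cong: measurable_cong)
qed

lemma cINF_diff_le:
  fixes F G :: "'i \<Rightarrow> real"
  assumes "I \<noteq> {}" "\<And>i. i \<in> I \<Longrightarrow> F i \<le> G i + d" "\<And>i. i \<in> I \<Longrightarrow> 0 \<le> F i"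
  shows "(INF i\<in>I. F i) \<le> (INF i\<in>I. G i) + d"
proof -
  have "(INF i\<in>I. F i) - d \<le> (INF i\<in>I. G i)"
  proof (rule cINF_greatest[OF assms(1)])
    fix i assume i: "i \<in> I"
    have "(INF i\<in>I. F i) \<le> F i" using i assms(3) by (intro cINF_lower bdd_belowI2) auto
    then show "(INF i\<in>I. F i) - d \<le> G i" using assms(2)[OF i] by linarith
  qed
  then show ?thesis by simp
qed

text \<open>A class is mapped to the distance functions of its image \<open>{c x y | y. (x, y) \<in> E}\<close> intersected
  with the members of a separating family; changing the base point translates this image.\<close>

theorem classifiable_of_separated_cocycle:
  fixes X :: "'a measure" and c :: "'a \<Rightarrow> 'a \<Rightarrow> nat \<Rightarrow> real"
  assumes X: "standard_borel X" and E: "equiv (space X) E"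
    and g: "\<And>n. g n \<in> X \<rightarrow>\<^sub>M X" "\<And>x. x \<in> space X \<Longrightarrow> E `` {x} = range (\<lambda>n::nat. g n x)"
    and c: "\<And>x y. (x, y) \<in> E \<Longrightarrow> c x y \<in> l1_set"
    and coc: "\<And>x y z. (x, y) \<in> E \<Longrightarrow> (y, z) \<in> E \<Longrightarrow> c x z = (\<lambda>n. c x y n + c y z n)"
    and sep: "\<And>x y. (x, y) \<in> E \<Longrightarrow> x \<noteq> y \<Longrightarrow> 1 / 2 \<le> l1_norm (c x y)"
    and meas: "\<And>n l. (\<lambda>x. c x (g n x) l) \<in> borel_measurable X"
  shows "classifiable_by X E l1_group l1_topology"
proof -
  obtain \<S> where \<S>: "countable \<S>" "\<S> \<subseteq> sets X"
    "\<And>x y. x \<in> space X \<Longrightarrow> y \<in> space X \<Longrightarrow> x \<noteq> y \<Longrightarrow> \<exists>S\<in>\<S>. x \<in> S \<and> y \<notin> S"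
    using standard_borel_separating[OF X] by metis
  define S where "S = from_nat_into (insert (space X) \<S>)"
  have rS: "range S = insert (space X) \<S>"
    unfolding S_def using \<S>(1) by (intro range_from_nat_into) auto
  have Sm: "S m \<in> sets X" for m
  proof -
    have "S m \<in> insert (space X) \<S>" using rS by blast
    then show ?thesis using \<S>(2) by auto
  qed
  \<comment> \<open>The full space as a label produces a near point before any separating set is
    consulted.\<close>
  obtain m0 where m0: "S m0 = space X" using rS by (metis insertI1 rangeE)
  have Ssep: "\<exists>m. x \<in> S m \<and> y \<notin> S m" if "x \<in> space X" "y \<in> space X" "x \<noteq> y" for x y
  proof -
    from \<S>(3)[OF that] obtain T where T: "T \<in> \<S>" "x \<in> T" "y \<notin> T" by blast
    then obtain m where "T = S m" using rS by (metis insertI2 rangeE)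
    then show ?thesis using T by blast
  qed
  have Esp: "x \<in> space X" "y \<in> space X" if "(x, y) \<in> E" for x y
    using E that unfolding equiv_def refl_on_def by blast+
  have Er: "(x, x) \<in> E" if "x \<in> space X" for x using equiv_class_self[OF E that] by blast
  have Ec: "E `` {x} = E `` {y}" if "(x, y) \<in> E" for x y using equiv_class_eq[OF E that] .
  have Es: "(y, x) \<in> E" if "(x, y) \<in> E" for x y using E that by (meson equiv_def symD)
  have Et: "(x, z) \<in> E" if "(x, y) \<in> E" "(y, z) \<in> E" for x y z using E that by (meson equiv_def transD)
  have c0: "c x x = (\<lambda>n. 0)" if "x \<in> space X" for x
  proof -
    have "c x x n = c x x n + c x x n" for n using coc[OF Er[OF that] Er[OF that]] by (rule fun_cong)
    then show ?thesis by auto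
  qed
  have cdist: "l1_dist (\<lambda>n. b n + c x x' n) (c x y) = l1_dist b (c x' y)"
    if "(x, x') \<in> E" "(x', y) \<in> E" for b x x' y
    using coc[OF that] by (simp add: l1_dist_def algebra_simps)
  \<comment> \<open>Points outside \<open>S m\<close> get the largest value of the truncated
    distance, so they act as if absent; the infimum stays in the unit interval even if no point of
    the class lies in \<open>S m\<close>.\<close>
  define W where "W x a m y = (if y \<in> S m then min 1 (l1_dist a (c x y)) else 1)" for x a m y
  define D where "D x a m = (INF y\<in>E `` {x}. W x a m y)" for x a m
  have W0: "0 \<le> W x a m y" "W x a m y \<le> 1" for x a m y by (auto simp: W_def l1.nonneg)
  have ne: "E `` {x} \<noteq> {}" if "x \<in> space X" for x using Er[OF that] by blast
  have Dle: "D x a m \<le> W x a m y" if "(x, y) \<in> E" for x a m y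
    unfolding D_def using that W0 by (intro cINF_lower bdd_belowI2[where m = 0]) auto
  have D0: "0 \<le> D x a m" "D x a m \<le> 1" if x: "x \<in> space X" for x a m
  proof -
    show "0 \<le> D x a m" unfolding D_def using ne[OF x] W0 by (intro cINF_greatest) auto
    show "D x a m \<le> 1" using Dle[OF Er[OF x], of a m] W0(2)[of x a m x] by linarith
  qed
  have Dlt: "\<exists>y. (x, y) \<in> E \<and> W x a m y < e" if x: "x \<in> space X" and "D x a m < e" for x a m e
  proof (rule ccontr)
    assume "\<not> ?thesis"
    then have "e \<le> D x a m" unfolding D_def using ne[OF x] by (intro cINF_greatest) (auto simp: not_less)
    then show False using that by simp
  qed
  have Dlip: "\<bar>D x a m - D x b m\<bar> \<le> l1_dist a b"
    if x: "x \<in> space X" and a: "a \<in> l1_set" and b: "b \<in> l1_set" for x a b m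
  proof -
    have W: "W x a m y \<le> W x b m y + l1_dist a b" if "y \<in> E `` {x}" "a \<in> l1_set" "b \<in> l1_set" for a b y
    proof -
      have "l1_dist a (c x y) \<le> l1_dist a b + l1_dist b (c x y)" using that c by (intro l1.triangle) auto
      moreover have "min 1 p \<le> min 1 r + q" if "p \<le> q + r" "0 \<le> q" for p q r :: real
        using that by (auto simp: min_def)
      ultimately have "min 1 (l1_dist a (c x y)) \<le> min 1 (l1_dist b (c x y)) + l1_dist a b" by simp
      then show ?thesis by (simp add: W_def)
    qed
    have "D x a m \<le> D x b m + l1_dist a b" "D x b m \<le> D x a m + l1_dist b a"
      unfolding D_def using ne[OF x] W W0 a b by (auto intro!: cINF_diff_le)
    then show ?thesis using l1.commute[of a b] by linarith
  qed
  define f where "f x p = (case prod_decode p of (i, m) \<Rightarrow> D x (l1_dense i) m)" for x p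
  have fe: "f x (prod_encode (i, m)) = D x (l1_dense i) m" for x i m by (simp add: f_def)
  have flip: "f x \<in> lip_space" if "x \<in> space X" for x
    unfolding lip_space_def using D0[OF that] Dlip[OF that] by (simp add: fe) (simp add: f_def split: prod.split)
  have fext: "lip_ext (f x) a m = D x a m" if "x \<in> space X" "a \<in> l1_set" for x a m
    using Dlip[OF that(1)] by (intro lip_ext_unique[OF flip[OF that(1)] that(2)]) (auto simp: fe)
  have fm: "f \<in> X \<rightarrow>\<^sub>M borel_of lip_topology"
  proof (rule measurable_lip_space[OF flip])
    fix p
    obtain i m where p: "p = prod_encode (i, m)" by (metis prod_decode_inverse surj_pair)
    have "f x p = (INF n. if g n x \<in> S m then min 1 (l1_dist (l1_dense i) (c x (g n x))) else 1)"
      if "x \<in> space X" for x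
      unfolding p fe D_def W_def g(2)[OF that] image_image ..
    moreover have "(\<lambda>x. INF n. if g n x \<in> S m then min 1 (l1_dist (l1_dense i) (c x (g n x))) else 1) \<in> borel_measurable X"
    proof (rule borel_measurable_cINF_real)
      fix n
      have "g n -` S m \<inter> space X \<in> sets X" using g(1) Sm by (rule measurable_sets)
      moreover have "g n -` S m \<inter> space X = {x \<in> space X. g n x \<in> S m}" by blast
      ultimately have "{x \<in> space X. g n x \<in> S m} \<in> sets X" by simp
      moreover have "(\<lambda>x. l1_dist (l1_dense i) (c x (g n x))) \<in> borel_measurable X"
        using g(2) by (intro borel_measurable_l1_dist c meas) auto
      ultimately show "(\<lambda>x. if g n x \<in> S m then min 1 (l1_dist (l1_dense i) (c x (g n x))) else 1) \<in> borel_measurable X"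
        by (intro measurable_If borel_measurable_min) auto
    qed simp
    ultimately show "(\<lambda>x. f x p) \<in> borel_measurable X" by (simp cong: measurable_cong)
  qed
  have fwd: "f x' = lip_translate (c x x') (f x)" if "(x, x') \<in> E" for x x'
  proof
    fix p
    obtain i m where p: "p = prod_encode (i, m)" by (metis prod_decode_inverse surj_pair)
    have "lip_translate (c x x') (f x) p = D x (\<lambda>n. l1_dense i n + c x x' n) m"
      using that by (simp add: lip_translate_def p fext Esp c l1_set_add)
    also have "\<dots> = D x' (l1_dense i) m"
      unfolding D_def Ec[OF that] W_def using cdist[OF that] by (intro INF_cong) auto
    finally show "f x' p = lip_translate (c x x') (f x) p" by (simp add: p fe)
  qed
  have bwd: "(x, x') \<in> E"
    if x: "x \<in> space X" "x' \<in> space X" and t: "t \<in> l1_set" "f x' = lip_translate t (f x)" for x x' t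
  proof -
    have zero: "(\<lambda>n. 0) \<in> l1_set" by (simp add: l1_set_def)
    have D': "D x' (\<lambda>n. 0) m = D x t m" for m
      using lip_ext_translate[OF flip[OF x(1)] t(1) zero, of m] fext[OF x(2) zero, of m] fext[OF x(1) t(1), of m] t(2)
      by simp
    \<comment> \<open>The image seen from \<open>x'\<close> contains 0, the value of
      \<open>c x' x'\<close>. Hence for every label of \<open>x'\<close> the class of
      \<open>x\<close> has a point with that label whose image is within \<open>1 / 4\<close> of
      \<open>t\<close>. Two such points have images less than \<open>1 / 2\<close> apart, so they
      coincide, and one point carries all labels of \<open>x'\<close>.\<close>
    have near: "\<exists>y. (x, y) \<in> E \<and> y \<in> S m \<and> l1_dist t (c x y) < 1 / 4" if "x' \<in> S m" for m
    proof -
      have "D x' (\<lambda>n. 0) m \<le> 0"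
        using Dle[OF Er[OF x(2)], of "\<lambda>n. 0" m] that c0[OF x(2)] zero by (simp add: W_def)
      then have "D x t m < 1 / 4" using D'[of m] by simp
      then obtain y where "(x, y) \<in> E" "W x t m y < 1 / 4" using Dlt[OF x(1)] by blast
      then show ?thesis by (intro exI[of _ y]) (auto simp: W_def split: if_splits)
    qed
    obtain y where y: "(x, y) \<in> E" "l1_dist t (c x y) < 1 / 4" using near[of m0] x(2) m0 by auto
    have "x' = y"
    proof (rule ccontr)
      assume "x' \<noteq> y"
      then obtain m where m: "x' \<in> S m" "y \<notin> S m" using Ssep[OF x(2) Esp(2)[OF y(1)]] by blast
      then obtain z where z: "(x, z) \<in> E" "z \<in> S m" "l1_dist t (c x z) < 1 / 4" using near by blast
      have yz: "(y, z) \<in> E" using Et[OF Es[OF y(1)] z(1)] .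
      have "y \<noteq> z" using m z by blast
      then have "1 / 2 \<le> l1_norm (c y z)" using sep[OF yz] by blast
      also have "l1_norm (c y z) = l1_dist (c x z) (c x y)"
        using coc[OF y(1) yz] by (simp add: l1_dist_def)
      also have "\<dots> \<le> l1_dist (c x z) t + l1_dist t (c x y)" using c y z t by (intro l1.triangle) auto
      finally show False using y(2) z(3) l1.commute[of t "c x z"] by linarith
    qed
    then show ?thesis using y by simp
  qed
  have "borel_reduction X E (borel_of lip_topology) (orbit_equiv l1_group (topspace lip_topology) lip_action) f"
    unfolding borel_reduction_def
  proof (intro conjI fm ballI)
    fix x x' assume x: "x \<in> space X" "x' \<in> space X"
    have "(f x, f x') \<in> orbit_equiv l1_group (topspace lip_topology) lip_action \<longleftrightarrow>
        (\<exists>t\<in>l1_set. f x' = lip_translate t (f x))"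
      using flip[OF x(1)] by (auto simp: orbit_equiv_def orbit_def l1_group_def lip_action_def)
    also have "\<dots> \<longleftrightarrow> (x, x') \<in> E" using fwd bwd[OF x] c by blast
    finally show "(x, x') \<in> E \<longleftrightarrow> (f x, f x') \<in> orbit_equiv l1_group (topspace lip_topology) lip_action" by blast
  qed
  then show ?thesis
    unfolding classifiable_by_def using polish_group_l1 polish_lip_topology lip_continuous_action by blast
qed

section \<open>Walks in acyclic graphs\<close>

text \<open>Kept general because it measures both the length of a walk and, one coordinate of
  \<open>l1\<close> at a time, its contribution to the cocycle.\<close>

fun walk_sum :: "('a \<Rightarrow> 'a \<Rightarrow> 'b::comm_monoid_add) \<Rightarrow> 'a list \<Rightarrow> 'b" where
  "walk_sum f (x # y # p) = f x y + walk_sum f (y # p)"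
| "walk_sum f _ = 0"

definition walk :: "('a \<times> 'a) set \<Rightarrow> 'a \<Rightarrow> 'a list \<Rightarrow> 'a \<Rightarrow> bool" where
  "walk R x p y \<longleftrightarrow> p \<noteq> [] \<and> hd p = x \<and> last p = y \<and> successively (\<lambda>a b. (a, b) \<in> R) p"

lemma walk_sum_append: "walk_sum f (p @ x # q) = walk_sum f (p @ [x]) + walk_sum f (x # q)"
proof (induction p)
  case (Cons a p)
  then show ?case by (cases p) (simp_all add: add.assoc)
qed simp

lemma walk_sum_nth: "walk_sum f p = (\<Sum>i<length p - 1. f (p ! i) (p ! Suc i))"
  by (induction f p rule: walk_sum.induct) (simp_all add: sum.lessThan_Suc_shift del: sum.lessThan_Suc)

lemma walk_append:
  "walk R x (p @ z # q) y \<longleftrightarrow> walk R x (p @ [z]) z \<and> walk R z (z # q) y"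
proof -
  have "successively P (p @ z # q) \<longleftrightarrow> successively P (p @ [z]) \<and> successively P (z # q)" for P
    by (auto simp: successively_append_iff)
  moreover have "hd (p @ z # q) = hd (p @ [z])" by (cases p) auto
  ultimately show ?thesis by (auto simp: walk_def)
qed

lemma walk_single [simp]: "walk R x [x] x"
  by (simp add: walk_def)

lemma walk_Cons: "walk R x (x # z # q) y \<longleftrightarrow> (x, z) \<in> R \<and> walk R z (z # q) y"
  by (auto simp: walk_def)

lemma walk_join: "walk R x (p @ [z]) z \<Longrightarrow> walk R z (z # q) y \<Longrightarrow> walk R x (p @ z # q) y"
  by (rule walk_append[THEN iffD2]) (rule conjI)

lemma walk_first: "walk R x p y \<Longrightarrow> \<exists>q. p = x # q"
  by (cases p) (auto simp: walk_def)

lemma walk_last: "walk R x p y \<Longrightarrow> \<exists>q. p = q @ [y]"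
  unfolding walk_def by (metis append_butlast_last_id)

lemma walk_rev: "sym R \<Longrightarrow> walk R x p y \<Longrightarrow> walk R y (rev p) x"
  unfolding walk_def
  by (auto simp: successively_rev hd_rev last_rev elim!: successively_mono dest: symD)

lemma rtrancl_imp_walk: "(x, y) \<in> R\<^sup>* \<Longrightarrow> \<exists>p. walk R x p y"
proof (induction rule: converse_rtrancl_induct)
  case base
  show ?case by (rule exI[of _ "[y]"]) simp
next
  case (step x z)
  then obtain q where q: "walk R z (z # q) y" using walk_first by metis
  then show ?case using step(1) by (intro exI[of _ "x # z # q"]) (simp add: walk_Cons)
qed

lemma walk_imp_rtrancl: "walk R x p y \<Longrightarrow> v \<in> set p \<Longrightarrow> (x, v) \<in> R\<^sup>*"
proof (induction p arbitrary: x)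
  case (Cons a p)
  then have [simp]: "a = x" by (simp add: walk_def)
  show ?case
  proof (cases p)
    case Nil then show ?thesis using Cons by simp
  next
    case (Cons b q)
    have "(x, b) \<in> R" "walk R b p y" using \<open>walk R x (a # p) y\<close> Cons by (auto simp: walk_Cons)
    then show ?thesis using Cons.IH[of b] \<open>v \<in> set (a # p)\<close>
      by (auto intro: converse_rtrancl_into_rtrancl)
  qed
qed (simp add: walk_def)

lemma walk_distinct:
  assumes "walk R x p y"
  shows "\<exists>q. walk R x q y \<and> distinct q"
  using assms
proof (induction "length p" arbitrary: p rule: less_induct)
  case less
  show ?case
  proof (cases "distinct p")
    case False
    then obtain xs ys zs v where p: "p = xs @ [v] @ ys @ [v] @ zs" using not_distinct_decomp by blast
    have "walk R x (xs @ [v]) v" "walk R v (v # ys @ v # zs) y"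
      using less(2) walk_append[of R x xs v "ys @ v # zs" y] p by auto
    moreover have "walk R v (v # zs) y"
      using calculation(2) walk_append[of R v "v # ys" v zs y] by simp
    ultimately have "walk R x (xs @ v # zs) y" by (blast intro: walk_join)
    then show ?thesis using less(1)[of "xs @ v # zs"] p by simp
  qed (use less in blast)
qed

text \<open>A closed walk either repeats an interior vertex and splits into two shorter closed walks, or
  it traverses a cycle, which acyclicity excludes beyond length two.\<close>

lemma walk_sum_closed:
  fixes f :: "'a \<Rightarrow> 'a \<Rightarrow> 'b::ab_group_add"
  assumes R: "irrefl R" "acyclic_graph R" and f: "\<And>x y. f y x = - f x y"
  shows "walk R x p x \<Longrightarrow> walk_sum f p = 0"
proof (induction "length p" arbitrary: p x rule: less_induct)
  case less
  obtain b where p: "p = b @ [x]" using walk_last[OF less(2)] by blast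
  show ?case
  proof (cases "distinct b")
    case False
    then obtain xs ys zs v where b: "b = xs @ [v] @ ys @ [v] @ zs" using not_distinct_decomp by blast
    have 1: "walk R x (xs @ [v]) v" "walk R v (v # ys @ v # zs @ [x]) x"
      using less(2) walk_append[of R x xs v "ys @ v # zs @ [x]" x] p b by auto
    have 2: "walk R v (v # ys @ [v]) v" "walk R v (v # zs @ [x]) x"
      using 1(2) walk_append[of R v "v # ys" v "zs @ [x]" x] by auto
    have "walk R x (xs @ v # zs @ [x]) x" using 1(1) 2(2) by (rule walk_join)
    then have "walk_sum f (xs @ v # zs @ [x]) = 0" using less(1)[of "xs @ v # zs @ [x]" x] p b by simp
    then have s1: "walk_sum f (xs @ [v]) + walk_sum f (v # zs @ [x]) = 0"
      using walk_sum_append[of f xs v "zs @ [x]"] by simp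
    have s2: "walk_sum f (v # ys @ [v]) = 0" using less(1)[OF _ 2(1)] p b by simp
    have "walk_sum f p = walk_sum f (xs @ [v]) + walk_sum f (v # ys @ v # zs @ [x])"
      using walk_sum_append[of f xs v "ys @ v # zs @ [x]"] by (simp add: p b)
    also have "walk_sum f (v # ys @ v # zs @ [x]) = walk_sum f (v # ys @ [v]) + walk_sum f (v # zs @ [x])"
      using walk_sum_append[of f "v # ys" v "zs @ [x]"] by simp
    finally show ?thesis using s1 s2 by simp
  next
    case True
    \<comment> \<open>\<open>b\<close> omits the repeated end point. One vertex gives a loop,
      excluded by \<open>irrefl\<close>; two give an edge traversed forth and back, cancelled by
      antisymmetry; three or more distinct vertices form a \<open>graph_cycle\<close>.\<close>
    consider "length b = 0" | "length b = 1" | "length b = 2" | "3 \<le> length b" by linarith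
    then show ?thesis
    proof cases
      case 1 then show ?thesis by (simp add: p)
    next
      case 2
      then obtain u where "b = [u]" by (auto simp: length_Suc_conv)
      then have "(x, x) \<in> R" using less(2) by (auto simp: p walk_def)
      then show ?thesis using R(1) by (auto simp: irrefl_def)
    next
      case 3
      then obtain u v where b: "b = [u, v]" by (auto simp: length_Suc_conv numeral_2_eq_2)
      then have "u = x" using less(2) by (simp add: p walk_def)
      then show ?thesis using f[of v u] by (simp add: p b)
    next
      case 4
      then have "b \<noteq> []" by auto
      then have "hd b = x" "successively (\<lambda>x y. (x, y) \<in> R) b" "(last b, x) \<in> R"
        using less(2) by (auto simp: p walk_def successively_append_iff)
      then have "graph_cycle R b" using True 4 by (simp add: graph_cycle_def)
      then show ?thesis using R(2) by (auto simp: acyclic_graph_def)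
    qed
  qed
qed

lemma walk_sum_rev:
  fixes f :: "'a \<Rightarrow> 'a \<Rightarrow> 'b::ab_group_add"
  assumes f: "\<And>x y. f y x = - f x y"
  shows "walk_sum f (rev p) = - walk_sum f p"
proof (induction p rule: induct_list012)
  case (3 x y p)
  have "walk_sum f (rev (x # y # p)) = walk_sum f (rev (y # p)) + walk_sum f [y, x]"
    using walk_sum_append[of f "rev p" y "[x]"] by simp
  then show ?case using 3(2) f[of y x] by simp
qed simp_all

text \<open>One walk followed by the reverse of the other is closed, so its sum vanishes.\<close>

lemma walk_sum_unique:
  fixes f :: "'a \<Rightarrow> 'a \<Rightarrow> 'b::ab_group_add"
  assumes R: "sym R" "irrefl R" "acyclic_graph R" and f: "\<And>x y. f y x = - f x y"
    and pq: "walk R x p y" "walk R x q y"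
  shows "walk_sum f p = walk_sum f q"
proof -
  obtain p' where p': "p = p' @ [y]" using walk_last[OF pq(1)] by blast
  obtain q' where q': "rev q = y # q'" using walk_first[OF walk_rev[OF R(1) pq(2)]] by blast
  have "walk R x (p' @ y # q') x"
    using pq(1) walk_rev[OF R(1) pq(2)] unfolding p' q' by (rule walk_join)
  then have "walk_sum f (p' @ y # q') = 0" using walk_sum_closed[where f = f, OF R(2,3) f] by blast
  then have "walk_sum f p + walk_sum f (rev q) = 0"
    using walk_sum_append[of f p' y q'] by (simp add: p' q')
  then show ?thesis using walk_sum_rev[where f = f, OF f, of q] by simp
qed

section \<open>Countable colourings\<close>

lemma measurable_nat_Collect:
  fixes h :: "'a \<Rightarrow> nat"
  assumes "h \<in> X \<rightarrow>\<^sub>M count_space UNIV"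
  shows "{x \<in> space X. P (h x)} \<in> sets X"
proof -
  have "h -` {n. P n} \<inter> space X \<in> sets X" using assms by (rule measurable_sets) simp
  moreover have "h -` {n. P n} \<inter> space X = {x \<in> space X. P (h x)}" by blast
  ultimately show ?thesis by (rule subst[rotated])
qed

lemma measurable_LEAST:
  assumes "\<And>n::nat. {x \<in> space X. P n x} \<in> sets X"
  shows "(\<lambda>x. LEAST n. P n x) \<in> X \<rightarrow>\<^sub>M count_space UNIV"
  using assms by (intro measurable_Least) (simp add: pred_def)

text \<open>Inequality of two points is witnessed by a member of a countable separating family, so
  the complement is a countable union of measurable sets.\<close>

lemma sets_Collect_eq:
  assumes X: "standard_borel X" and h: "h \<in> Y \<rightarrow>\<^sub>M X" "h' \<in> Y \<rightarrow>\<^sub>M X"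
  shows "{x \<in> space Y. h x = h' x} \<in> sets Y"
proof -
  obtain \<S> where \<S>: "countable \<S>" "\<S> \<subseteq> sets X"
    "\<And>x y. x \<in> space X \<Longrightarrow> y \<in> space X \<Longrightarrow> x \<noteq> y \<Longrightarrow> \<exists>S\<in>\<S>. x \<in> S \<and> y \<notin> S"
    using standard_borel_separating[OF X] by metis
  have "(\<Union>S\<in>\<S>. (h -` S \<inter> space Y) - (h' -` S \<inter> space Y)) \<in> sets Y"
  proof (rule sets.countable_UN'[OF \<S>(1)])
    show "(\<lambda>S. (h -` S \<inter> space Y) - (h' -` S \<inter> space Y)) ` \<S> \<subseteq> sets Y"
      using measurable_sets[OF h(1)] measurable_sets[OF h(2)] \<S>(2) by blast
  qed
  then have "space Y - (\<Union>S\<in>\<S>. (h -` S \<inter> space Y) - (h' -` S \<inter> space Y)) \<in> sets Y"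
    by (rule sets.compl_sets)
  moreover have "space Y - (\<Union>S\<in>\<S>. (h -` S \<inter> space Y) - (h' -` S \<inter> space Y)) = {x \<in> space Y. h x = h' x}"
  proof (intro equalityI subsetI)
    fix x assume x: "x \<in> space Y - (\<Union>S\<in>\<S>. (h -` S \<inter> space Y) - (h' -` S \<inter> space Y))"
    then have xY: "x \<in> space Y" by simp
    have "h x = h' x"
    proof (rule ccontr)
      assume "h x \<noteq> h' x"
      from \<S>(3)[OF measurable_space[OF h(1) xY] measurable_space[OF h(2) xY] this]
      show False using x by blast
    qed
    then show "x \<in> {x \<in> space Y. h x = h' x}" using x by blast
  qed auto
  ultimately show ?thesis by simp
qed

text \<open>The color of \<open>x\<close> is the first set of a separating algebra containing \<open>x\<close> but no neighbor of \<open>x\<close>.\<close>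

lemma locally_finite_colouring:
  assumes X: "standard_borel X" and H: "\<And>x. x \<in> space X \<Longrightarrow> finite (H x)" "\<And>x. x \<in> space X \<Longrightarrow> H x \<subseteq> space X"
    and m: "\<And>S. S \<in> sets X \<Longrightarrow> {x \<in> space X. \<exists>y\<in>H x. y \<noteq> x \<and> y \<in> S} \<in> sets X"
  obtains \<kappa> :: "'a \<Rightarrow> nat" where "\<kappa> \<in> X \<rightarrow>\<^sub>M count_space UNIV"
    "\<And>x y. x \<in> space X \<Longrightarrow> y \<in> H x \<Longrightarrow> y \<noteq> x \<Longrightarrow> \<kappa> x \<noteq> \<kappa> y"
proof -
  obtain \<S> where \<S>: "countable \<S>" "\<S> \<subseteq> sets X"
    "\<And>x y. x \<in> space X \<Longrightarrow> y \<in> space X \<Longrightarrow> x \<noteq> y \<Longrightarrow> \<exists>S\<in>\<S>. x \<in> S \<and> y \<notin> S"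
    using standard_borel_separating[OF X] by metis
  \<comment> \<open>Closing under finite intersections lets one set exclude all of the finitely many
    neighbours of a point at once; \<open>space X\<close> takes care of the empty
    intersection.\<close>
  define \<A> where "\<A> = (\<lambda>\<G>. \<Inter>(insert (space X) \<G>)) ` {\<G>. finite \<G> \<and> \<G> \<subseteq> \<S>}"
  have cA: "countable \<A>"
    unfolding \<A>_def using countable_Collect_finite_subset[OF \<S>(1)] by (intro countable_image) (simp add: conj_commute)
  have Am: "\<A> \<subseteq> sets X"
  proof
    fix A assume "A \<in> \<A>"
    then obtain \<G> where G: "finite \<G>" "\<G> \<subseteq> \<S>" "A = \<Inter>(insert (space X) \<G>)" unfolding \<A>_def by blast
    have "(\<Inter>S\<in>insert (space X) \<G>. S) \<in> sets X"
      using G(1,2) \<S>(2) by (intro sets.finite_INT) auto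
    then show "A \<in> sets X" using G(3) by simp
  qed
  have "\<A> \<noteq> {}" unfolding \<A>_def by blast
  define A where "A = from_nat_into \<A>"
  have rA: "range A = \<A>" unfolding A_def using \<open>\<A> \<noteq> {}\<close> cA by (rule range_from_nat_into)
  have Anm: "A n \<in> sets X" for n using rA Am by blast
  define P where "P n x \<longleftrightarrow> x \<in> A n \<and> \<not> (\<exists>y\<in>H x. y \<noteq> x \<and> y \<in> A n)" for n x
  define \<kappa> where "\<kappa> x = (LEAST n. P n x)" for x
  have "\<exists>n. P n x" if x: "x \<in> space X" for x
  proof -
    have "\<forall>y\<in>H x - {x}. \<exists>S. S \<in> \<S> \<and> x \<in> S \<and> y \<notin> S"
      using \<S>(3)[OF x] H(2)[OF x] by blast
    from bchoice[OF this] obtain s where s: "\<forall>y\<in>H x - {x}. s y \<in> \<S> \<and> x \<in> s y \<and> y \<notin> s y" ..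
    have "\<Inter>(insert (space X) (s ` (H x - {x}))) \<in> \<A>"
      unfolding \<A>_def using s H(1)[OF x] by (intro imageI) auto
    then obtain n where n: "A n = \<Inter>(insert (space X) (s ` (H x - {x})))" using rA by (metis rangeE)
    have "P n x" unfolding P_def n using s x by auto
    then show ?thesis by blast
  qed
  then have \<kappa>: "P (\<kappa> x) x" if "x \<in> space X" for x
    unfolding \<kappa>_def using LeastI_ex[of "\<lambda>n. P n x"] that by blast
  show ?thesis
  proof (rule that)
    have "{x \<in> space X. P n x} \<in> sets X" for n
    proof -
      have "{x \<in> space X. P n x} = A n - {x \<in> space X. \<exists>y\<in>H x. y \<noteq> x \<and> y \<in> A n}"
        using sets.sets_into_space[OF Anm[of n]] unfolding P_def by blast
      also have "\<dots> \<in> sets X" by (rule sets.Diff[OF Anm m[OF Anm]])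
      finally show ?thesis .
    qed
    then show "\<kappa> \<in> X \<rightarrow>\<^sub>M count_space UNIV" unfolding \<kappa>_def by (rule measurable_LEAST)
    fix x y assume x: "x \<in> space X" and y: "y \<in> H x" "y \<noteq> x"
    show "\<kappa> x \<noteq> \<kappa> y"
    proof
      assume eq: "\<kappa> x = \<kappa> y"
      have "y \<in> A (\<kappa> y)" using \<kappa>[of y] H(2)[OF x] y(1) unfolding P_def by blast
      then show False using \<kappa>[OF x] y unfolding P_def eq by blast
    qed
  qed
qed

section \<open>The cocycle of a treeing\<close>

text \<open>In \<open>conn\<close> the point \<open>x\<close> is confined to the space because
  \<open>R\<^sup>*\<close> is reflexive everywhere, \<open>E\<close> only on
  \<open>space X\<close>.\<close>

locale treeing =
  fixes X :: "'a measure" and E R :: "('a \<times> 'a) set" and g :: "nat \<Rightarrow> 'a \<Rightarrow> 'a"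
  assumes X: "standard_borel X" and E: "equiv (space X) E"
    and R: "R \<in> sets (X \<Otimes>\<^sub>M X)" "sym R" "irrefl R" "acyclic_graph R"
    and conn: "\<And>x y. x \<in> space X \<Longrightarrow> (x, y) \<in> E \<longleftrightarrow> (x, y) \<in> R\<^sup>*"
    and g: "\<And>n. g n \<in> X \<rightarrow>\<^sub>M X" "\<And>x. x \<in> space X \<Longrightarrow> E `` {x} = range (\<lambda>n. g n x)"
begin

lemma E_space: "(x, y) \<in> E \<Longrightarrow> x \<in> space X \<and> y \<in> space X"
  using E unfolding equiv_def refl_on_def by blast

lemma E_sym: "(x, y) \<in> E \<Longrightarrow> (y, x) \<in> E"
  using E unfolding equiv_def by (blast dest: symD)

lemma g_space: "x \<in> space X \<Longrightarrow> g n x \<in> space X"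
  using g(1) by (rule measurable_space)

lemma E_imp_walk:
  assumes "(x, y) \<in> E"
  shows "\<exists>p. walk R x p y"
  using conn[of x y] E_space[OF assms] assms by (intro rtrancl_imp_walk) simp

lemma walk_imp_E: "walk R x p y \<Longrightarrow> x \<in> space X \<Longrightarrow> v \<in> set p \<Longrightarrow> (x, v) \<in> E"
  using conn[of x v] walk_imp_rtrancl[of R x p y v] by simp

lemma walk_end_imp_E:
  assumes "walk R x p y" "x \<in> space X"
  shows "(x, y) \<in> E"
proof (rule walk_imp_E[OF assms])
  show "y \<in> set p" using walk_last[OF assms(1)] by auto
qed

text \<open>Quantification over walks from \<open>x\<close> thereby becomes quantification over the
  countably many lists of indices, on which the measurability of balls and of the cocycle
  rests.\<close>

lemma walk_enum:
  assumes "walk R x p y" "x \<in> space X"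
  obtains ks where "p = map (\<lambda>k. g k x) ks"
proof -
  have "\<forall>v\<in>set p. \<exists>k. v = g k x"
    using walk_imp_E[OF assms] g(2)[OF assms(2)] by blast
  then show ?thesis using that by (metis ex_map_conv)
qed

lemma g_comp: "(\<lambda>x. g i (g j x)) \<in> X \<rightarrow>\<^sub>M X"
  using measurable_compose[OF g(1) g(1)] .

text \<open>Within the class of \<open>u\<close>, at most \<open>N + 1\<close> vertices have length
  at most \<open>N + 1\<close> from \<open>u\<close>, whatever the degree of the graph. Bounding the
  indices from both ends makes the length symmetric, and the summand 1 lets every step of a walk
  cost at least 1.\<close>

definition len :: "'a \<Rightarrow> 'a \<Rightarrow> real" where
  "len u v = 1 + real (LEAST n. (\<exists>i\<le>n. v = g i u) \<and> (\<exists>j\<le>n. u = g j v))"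

lemma len_ge_1: "1 \<le> len u v"
  by (simp add: len_def)

lemma len_bound:
  assumes "(u, v) \<in> E" "len u v \<le> real (Suc N)"
  shows "\<exists>i\<le>N. v = g i u"
proof -
  obtain i where i: "v = g i u" using g(2)[of u] assms(1) E_space by blast
  obtain j where j: "u = g j v" using g(2)[of v] E_sym[OF assms(1)] E_space by blast
  let ?P = "\<lambda>n. (\<exists>i\<le>n. v = g i u) \<and> (\<exists>j\<le>n. u = g j v)"
  have "?P (max i j)" using i j by (auto intro: max.cobounded1 max.cobounded2)
  then have "?P (LEAST n. ?P n)" by (rule LeastI)
  moreover have "(LEAST n. ?P n) \<le> N" using assms(2) by (simp add: len_def)
  moreover define K where "K = (LEAST n. ?P n)"
  ultimately obtain i where "i \<le> K" "v = g i u" "K \<le> N" by blast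
  then show ?thesis by (intro exI[of _ i]) simp
qed

definition nbhd :: "nat \<Rightarrow> 'a \<Rightarrow> 'a set" where
  "nbhd N x = {y. \<exists>p. walk R x p y \<and> walk_sum len p \<le> real N}"

lemma walk_sum_len_nonneg: "0 \<le> walk_sum len p"
proof (induction p rule: induct_list012)
  case (3 x y p)
  then show ?case using len_ge_1[of x y] by simp
qed simp_all

text \<open>Induction on the radius: the first edge of a walk of length at most \<open>N + 1\<close>
  leads to one of \<open>g 0 x\<close>, ..., \<open>g N x\<close>, and since it costs at least 1,
  length at most \<open>N\<close> remains.\<close>

lemma finite_nbhd:
  assumes "x \<in> space X"
  shows "finite (nbhd N x)"
  using assms
proof (induction N arbitrary: x)
  case 0
  have "nbhd 0 x \<subseteq> {x}"
  proof
    fix y assume "y \<in> nbhd 0 x"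
    then obtain p where p: "walk R x p y" "walk_sum len p \<le> 0" by (auto simp: nbhd_def)
    obtain q where q: "p = x # q" using walk_first[OF p(1)] by blast
    show "y \<in> {x}"
    proof (cases q)
      case Nil then show ?thesis using p q by (simp add: walk_def)
    next
      case (Cons z r)
      then have "len x z + walk_sum len q \<le> 0" using p q by simp
      then show ?thesis using len_ge_1[of x z] walk_sum_len_nonneg[of q] by linarith
    qed
  qed
  then show ?case by (rule finite_subset) simp
next
  case (Suc N)
  have "nbhd (Suc N) x \<subseteq> insert x (\<Union>i\<le>N. nbhd N (g i x))"
  proof
    fix y assume "y \<in> nbhd (Suc N) x"
    then obtain p where p: "walk R x p y" "walk_sum len p \<le> real (Suc N)" by (auto simp: nbhd_def)
    obtain q where q: "p = x # q" using walk_first[OF p(1)] by blast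
    show "y \<in> insert x (\<Union>i\<le>N. nbhd N (g i x))"
    proof (cases q)
      case Nil then show ?thesis using p q by (simp add: walk_def)
    next
      case (Cons z r)
      then have s: "len x z + walk_sum len q \<le> real (Suc N)" using p q by simp
      have w: "walk R z q y" using p(1) q Cons by (simp add: walk_Cons)
      have "(x, z) \<in> E" using walk_imp_E[OF p(1) Suc.prems, of z] q Cons by simp
      moreover have "len x z \<le> real (Suc N)" using s walk_sum_len_nonneg[of q] by linarith
      ultimately obtain i where i: "i \<le> N" "z = g i x" using len_bound by blast
      have "walk_sum len q \<le> real N" using s len_ge_1[of x z] by simp
      then have "y \<in> nbhd N z" using w unfolding nbhd_def by blast
      then show ?thesis using i by blast
    qed
  qed
  moreover have "finite (insert x (\<Union>i\<le>N. nbhd N (g i x)))"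
    using Suc.IH g_space[OF Suc.prems] by simp
  ultimately show ?case by (rule finite_subset)
qed

lemma nbhd_space:
  assumes "x \<in> space X"
  shows "nbhd N x \<subseteq> space X"
proof
  fix y assume "y \<in> nbhd N x"
  then obtain p where "walk R x p y" unfolding nbhd_def by blast
  from E_space[OF walk_end_imp_E[OF this assms]] show "y \<in> space X" ..
qed

section \<open>Measurability of lengths, walks and balls\<close>

lemma measurable_len: "(\<lambda>x. len (g i x) (g j x)) \<in> borel_measurable X"
proof -
  have "{x \<in> space X. (\<exists>a\<in>{..n}. g j x = g a (g i x)) \<and> (\<exists>b\<in>{..n}. g i x = g b (g j x))} \<in> sets X" for n
    by (intro sets.sets_Collect_conj sets.sets_Collect_finite_Ex sets_Collect_eq[OF X] g(1) g_comp) auto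
  then have "(\<lambda>x. LEAST n. (\<exists>a\<in>{..n}. g j x = g a (g i x)) \<and> (\<exists>b\<in>{..n}. g i x = g b (g j x)))
      \<in> X \<rightarrow>\<^sub>M count_space UNIV"
    by (rule measurable_LEAST)
  then have "(\<lambda>x. real (LEAST n. (\<exists>a\<in>{..n}. g j x = g a (g i x)) \<and> (\<exists>b\<in>{..n}. g i x = g b (g j x))))
      \<in> borel_measurable X"
    by (rule measurable_compose) simp
  from borel_measurable_add[OF borel_measurable_const this, of 1]
  show ?thesis unfolding len_def Bex_def atMost_iff .
qed

lemma measurable_edge: "{x \<in> space X. (g i x, g j x) \<in> R} \<in> sets X"
proof -
  have "(\<lambda>x. (g i x, g j x)) \<in> X \<rightarrow>\<^sub>M X \<Otimes>\<^sub>M X" using g(1) g(1) by (rule measurable_Pair)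
  then have "(\<lambda>x. (g i x, g j x)) -` R \<inter> space X \<in> sets X" using R(1) by (rule measurable_sets)
  moreover have "(\<lambda>x. (g i x, g j x)) -` R \<inter> space X = {x \<in> space X. (g i x, g j x) \<in> R}" by blast
  ultimately show ?thesis by simp
qed

lemma measurable_walk_sum:
  fixes f :: "'a \<Rightarrow> 'a \<Rightarrow> real"
  assumes "\<And>i j. (\<lambda>x. f (g i x) (g j x)) \<in> borel_measurable X"
  shows "(\<lambda>x. walk_sum f (map (\<lambda>k. g k x) ks)) \<in> borel_measurable X"
proof (induction ks rule: induct_list012)
  case (3 i j ks)
  then show ?case using assms by (simp add: borel_measurable_add)
qed simp_all

lemma measurable_walk:
  assumes h: "h \<in> X \<rightarrow>\<^sub>M X"
  shows "{x \<in> space X. walk R x (map (\<lambda>k. g k x) ks) (h x)} \<in> sets X"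
proof (cases "ks = []")
  case False
  have succ: "{x \<in> space X. successively (\<lambda>a b. (a, b) \<in> R) (map (\<lambda>k. g k x) ks)} \<in> sets X" for ks
  proof (induction ks rule: induct_list012)
    case (3 i j ks)
    from sets.sets_Collect_conj[OF 3(2) measurable_edge[of i j]] show ?case by simp
  qed simp_all
  have "{x \<in> space X. g (hd ks) x = x \<and> g (last ks) x = h x \<and>
      successively (\<lambda>a b. (a, b) \<in> R) (map (\<lambda>k. g k x) ks)} \<in> sets X"
    by (intro sets.sets_Collect_conj succ sets_Collect_eq[OF X g(1) measurable_ident_sets[OF refl]] sets_Collect_eq[OF X g(1) h])
  then show ?thesis using False by (simp add: walk_def hd_map last_map)
qed (simp add: walk_def)

lemma measurable_nbhd:
  assumes S: "S \<in> sets X"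
  shows "{x \<in> space X. \<exists>y\<in>nbhd N x. y \<noteq> x \<and> y \<in> S} \<in> sets X"
proof -
  define Q where "Q n ks x \<longleftrightarrow> walk R x (map (\<lambda>k. g k x) ks) (g n x) \<and>
    walk_sum len (map (\<lambda>k. g k x) ks) \<le> real N \<and> \<not> (g n x = x) \<and> g n x \<in> S" for n ks x
  have "{x \<in> space X. walk_sum len (map (\<lambda>k. g k x) ks) \<le> real N} \<in> sets X" for ks
    using measurable_walk_sum[where f = len, OF measurable_len, of ks] by (rule borel_measurable_le) simp
  moreover have "{x \<in> space X. g n x \<in> S} \<in> sets X" for n
  proof -
    have "g n -` S \<inter> space X \<in> sets X" using g(1) S by (rule measurable_sets)
    moreover have "g n -` S \<inter> space X = {x \<in> space X. g n x \<in> S}" by blast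
    ultimately show ?thesis by simp
  qed
  moreover have "{x \<in> space X. \<not> (g n x = x)} \<in> sets X" for n
    by (intro sets.sets_Collect_neg sets_Collect_eq[OF X g(1) measurable_ident_sets[OF refl]])
  ultimately have "{x \<in> space X. Q n ks x} \<in> sets X" for n ks
    unfolding Q_def by (intro sets.sets_Collect_conj measurable_walk g(1))
  then have "{x \<in> space X. \<exists>n ks. Q n ks x} \<in> sets X"
    by (intro sets.sets_Collect_countable_Ex)
  moreover have "(\<exists>n ks. Q n ks x) \<longleftrightarrow> (\<exists>y\<in>nbhd N x. y \<noteq> x \<and> y \<in> S)" if x: "x \<in> space X" for x
  proof
    assume "\<exists>n ks. Q n ks x"
    then show "\<exists>y\<in>nbhd N x. y \<noteq> x \<and> y \<in> S" unfolding Q_def nbhd_def by blast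
  next
    assume "\<exists>y\<in>nbhd N x. y \<noteq> x \<and> y \<in> S"
    then obtain y p where y: "y \<noteq> x" "y \<in> S" "walk R x p y" "walk_sum len p \<le> real N"
      unfolding nbhd_def by blast
    obtain ks where ks: "p = map (\<lambda>k. g k x) ks" using walk_enum[OF y(3) x] by blast
    obtain n where n: "y = g n x" using walk_end_imp_E[OF y(3) x] g(2)[OF x] by blast
    show "\<exists>n ks. Q n ks x"
      using y unfolding ks n by (intro exI[of _ n] exI[of _ ks]) (simp add: Q_def)
  qed
  ultimately show ?thesis by (simp cong: conj_cong)
qed

definition colour :: "nat \<Rightarrow> 'a \<Rightarrow> nat" where
  "colour k = (SOME \<kappa>. \<kappa> \<in> X \<rightarrow>\<^sub>M count_space UNIV \<and>
     (\<forall>x\<in>space X. \<forall>y\<in>nbhd (2 ^ k) x. y \<noteq> x \<longrightarrow> \<kappa> x \<noteq> \<kappa> y))"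

lemma colour:
  "colour k \<in> X \<rightarrow>\<^sub>M count_space UNIV"
  "x \<in> space X \<Longrightarrow> y \<in> nbhd (2 ^ k) x \<Longrightarrow> y \<noteq> x \<Longrightarrow> colour k x \<noteq> colour k y"
proof -
  have "\<exists>\<kappa> :: 'a \<Rightarrow> nat. \<kappa> \<in> X \<rightarrow>\<^sub>M count_space UNIV \<and>
     (\<forall>x\<in>space X. \<forall>y\<in>nbhd (2 ^ k) x. y \<noteq> x \<longrightarrow> \<kappa> x \<noteq> \<kappa> y)"
  proof (rule locally_finite_colouring[OF X, of "nbhd (2 ^ k)"])
    show "{x \<in> space X. \<exists>y\<in>nbhd (2 ^ k) x. y \<noteq> x \<and> y \<in> S} \<in> sets X" if "S \<in> sets X" for S
      using that by (rule measurable_nbhd)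
  qed (auto intro: finite_nbhd dest: nbhd_space)
  from someI_ex[OF this, folded colour_def]
  show "colour k \<in> X \<rightarrow>\<^sub>M count_space UNIV"
    "x \<in> space X \<Longrightarrow> y \<in> nbhd (2 ^ k) x \<Longrightarrow> y \<noteq> x \<Longrightarrow> colour k x \<noteq> colour k y" by blast+
qed

text \<open>The coordinate \<open>(k, a, b)\<close> of \<open>l1\<close> records the edges from color \<open>a\<close> to color \<open>b\<close> at scale \<open>k\<close>.\<close>

definition half_edge :: "'a \<Rightarrow> 'a \<Rightarrow> nat \<Rightarrow> real" where
  "half_edge u v l = (case prod_decode l of (k, ab) \<Rightarrow>
     if prod_decode ab = (colour k u, colour k v) then len u v / 2 ^ k else 0)"

text \<open>Antisymmetrised so that traversing an edge forth and back cancels, as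
  \<open>walk_sum_unique\<close> demands.\<close>

definition edge :: "nat \<Rightarrow> 'a \<Rightarrow> 'a \<Rightarrow> real" where
  "edge l u v = half_edge u v l - half_edge v u l"

text \<open>Each scale \<open>k\<close> contributes a single coordinate \<open>h k\<close>, and the
  values there form a geometric series.\<close>

lemma half_edge_l1: "half_edge u v \<in> l1_set"
proof -
  define h where "h k = prod_encode (k, prod_encode (colour k u, colour k v))" for k
  have "inj h" by (rule injI) (simp add: h_def)
  have hh: "half_edge u v (h k) = len u v * (1 / 2) ^ k" for k
    by (simp add: half_edge_def h_def power_divide)
  have out: "half_edge u v l = 0" if "l \<notin> range h" for l
  proof (rule ccontr)
    obtain k ab where l: "prod_decode l = (k, ab)" by (cases "prod_decode l")
    assume "half_edge u v l \<noteq> 0"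
    then have "prod_decode ab = (colour k u, colour k v)" by (simp add: half_edge_def l split: if_splits)
    then have "l = h k" unfolding h_def by (metis l prod_decode_inverse)
    then show False using that by blast
  qed
  have "summable (\<lambda>k. len u v * (1 / 2) ^ k)" by (intro summable_mult summable_geometric) simp
  then have "(\<lambda>k. len u v * (1 / 2) ^ k) summable_on UNIV"
    using len_ge_1[of u v] by (intro summable_nonneg_imp_summable_on) auto
  then have "((\<lambda>l. \<bar>half_edge u v l\<bar>) \<circ> h) summable_on UNIV"
    using len_ge_1[of u v] by (simp add: o_def hh)
  then have "(\<lambda>l. \<bar>half_edge u v l\<bar>) summable_on range h"
    using summable_on_reindex[OF \<open>inj h\<close>] by blast
  then have "(\<lambda>l. \<bar>half_edge u v l\<bar>) summable_on UNIV"
    by (subst summable_on_cong_neutral[where T = UNIV and S = "range h" and g = "\<lambda>l. \<bar>half_edge u v l\<bar>", symmetric])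
      (auto simp: out)
  then show ?thesis by (simp add: l1_set_def)
qed

section \<open>Summation of edge weights along walks\<close>

lemma edge_antisym: "edge l v u = - edge l u v"
  by (simp add: edge_def)

lemma walk_sum_edge_l1: "(\<lambda>l. walk_sum (edge l) p) \<in> l1_set"
proof (induction p rule: induct_list012)
  case (3 x y p)
  have "(\<lambda>l. edge l x y) \<in> l1_set" unfolding edge_def by (intro l1_set_diff half_edge_l1)
  then show ?case using l1_set_add[OF _ 3(2)] by simp
qed (simp_all add: l1_set_def)

text \<open>By \<open>cocycle_eq\<close> the choice of the walk does not matter. If no walk exists,
  an unspecified list is summed, and the result still lies in \<open>l1_set\<close>.\<close>

definition cocycle :: "'a \<Rightarrow> 'a \<Rightarrow> nat \<Rightarrow> real" where
  "cocycle x y l = walk_sum (edge l) (SOME p. walk R x p y)"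

lemma cocycle_eq: "walk R x p y \<Longrightarrow> cocycle x y l = walk_sum (edge l) p"
  unfolding cocycle_def
  by (rule walk_sum_unique[OF R(2-4) edge_antisym someI])

lemma cocycle_l1: "cocycle x y \<in> l1_set"
  unfolding cocycle_def by (rule walk_sum_edge_l1)

lemma cocycle_add:
  assumes "(x, y) \<in> E" "(y, z) \<in> E"
  shows "cocycle x z = (\<lambda>l. cocycle x y l + cocycle y z l)"
proof
  fix l
  obtain p where p: "walk R x p y" using E_imp_walk assms by blast
  obtain q where q: "walk R y q z" using E_imp_walk assms by blast
  obtain p' where p': "p = p' @ [y]" using walk_last[OF p] by blast
  obtain q' where q': "q = y # q'" using walk_first[OF q] by blast
  have "walk R x (p' @ y # q') z" using p q unfolding p' q' by (rule walk_join)
  then have "cocycle x z l = walk_sum (edge l) (p' @ y # q')" by (rule cocycle_eq)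
  also have "\<dots> = walk_sum (edge l) p + walk_sum (edge l) q"
    unfolding p' q' by (rule walk_sum_append)
  finally show "cocycle x z l = cocycle x y l + cocycle y z l"
    using cocycle_eq[OF p] cocycle_eq[OF q] by simp
qed

text \<open>A scale comparable to the length of the path sees all its vertices in different colors, so
  its edges contribute to different coordinates and do not cancel.\<close>

lemma cocycle_separated:
  assumes xy: "(x, y) \<in> E" "x \<noteq> y"
  shows "1 / 2 \<le> l1_norm (cocycle x y)"
proof -
  obtain p where p: "walk R x p y" "distinct p" using E_imp_walk[OF xy(1)] walk_distinct by metis
  have x: "x \<in> space X" using E_space xy by blast
  define m where "m = length p - 1"
  define W where "W = walk_sum len p"
  have W: "W = (\<Sum>i<m. len (p ! i) (p ! Suc i))" unfolding W_def m_def by (rule walk_sum_nth)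
  have "length p \<noteq> 0" using p(1) by (simp add: walk_def)
  then have lp: "length p = Suc m" by (simp add: m_def)
  have "m \<noteq> 0"
  proof
    assume "m = 0"
    then obtain u where "p = [u]" using lp by (auto simp: length_Suc_conv)
    then show False using p(1) xy(2) by (auto simp: walk_def)
  qed
  then have "1 \<le> real m" by simp
  also have "real m = (\<Sum>i<m. 1)" by simp
  also have "\<dots> \<le> W" unfolding W by (rule sum_mono) (rule len_ge_1)
  finally have W1: "1 \<le> W" .
  \<comment> \<open>For the least such \<open>k\<close>, minimality gives the second bound if
    \<open>k\<close> is positive, and \<open>1 \<le> W\<close> gives it for \<open>k = 0\<close>.
    This factor 2 is the origin of the constant \<open>1 / 2\<close>.\<close>
  obtain k where k: "W \<le> 2 ^ k" "2 ^ k \<le> 2 * W"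
  proof -
    define k where "k = (LEAST k. W \<le> 2 ^ k)"
    obtain n where "W < 2 ^ n" using real_arch_pow[of 2 W] by auto
    then have k: "W \<le> 2 ^ k" unfolding k_def using LeastI[of "\<lambda>k. W \<le> 2 ^ k" n] by simp
    have "2 ^ k \<le> 2 * W"
    proof (cases k)
      case (Suc j)
      then have "\<not> W \<le> 2 ^ j" using not_less_Least[of j "\<lambda>k. W \<le> 2 ^ k"] unfolding k_def by simp
      then show ?thesis by (simp add: Suc)
    qed (use W1 in simp)
    then show ?thesis using k that by blast
  qed
  let ?c = "colour k"
  \<comment> \<open>The segment of \<open>p\<close> between two of its vertices is a walk of length
    at most \<open>W\<close>, so the later vertex lies in the ball of radius \<open>2 ^ k\<close>
    around the earlier one.\<close>
  have ne: "?c (p ! i) \<noteq> ?c (p ! j)" if ij: "i < j" "j < length p" for i j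
  proof -
    define p1 where "p1 = take i p"
    define p2 where "p2 = take (j - Suc i) (drop (Suc i) p)"
    define p3 where "p3 = drop (Suc j) p"
    have d1: "p = p1 @ p ! i # drop (Suc i) p" unfolding p1_def using ij by (simp add: id_take_nth_drop)
    have d2: "drop (Suc i) p = p2 @ p ! j # p3"
      using id_take_nth_drop[of "j - Suc i" "drop (Suc i) p"] ij unfolding p2_def p3_def by simp
    have dp: "p = p1 @ p ! i # p2 @ p ! j # p3" using d1 unfolding d2 .
    have w1: "walk R x (p1 @ [p ! i]) (p ! i)" "walk R (p ! i) (p ! i # p2 @ p ! j # p3) y"
      using p(1) walk_append[of R x p1 "p ! i" "p2 @ p ! j # p3" y] dp by auto
    have w2: "walk R (p ! i) (p ! i # p2 @ [p ! j]) (p ! j)"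
      using w1(2) walk_append[of R "p ! i" "p ! i # p2" "p ! j" p3 y] by simp
    have "W = walk_sum len (p1 @ [p ! i]) + walk_sum len (p ! i # p2 @ p ! j # p3)"
      unfolding W_def by (subst dp) (rule walk_sum_append)
    moreover have "walk_sum len (p ! i # p2 @ p ! j # p3) =
        walk_sum len (p ! i # p2 @ [p ! j]) + walk_sum len (p ! j # p3)"
      using walk_sum_append[of len "p ! i # p2" "p ! j" p3] by simp
    ultimately have "walk_sum len (p ! i # p2 @ [p ! j]) \<le> W"
      using walk_sum_len_nonneg[of "p1 @ [p ! i]"] walk_sum_len_nonneg[of "p ! j # p3"] by linarith
    then have "walk_sum len (p ! i # p2 @ [p ! j]) \<le> real (2 ^ k)" using k(1) by simp
    then have "p ! j \<in> nbhd (2 ^ k) (p ! i)" unfolding nbhd_def using w2 by blast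
    moreover have "p ! j \<noteq> p ! i" using p(2) ij by (simp add: nth_eq_iff_index_eq)
    moreover have "p ! i \<in> space X" using walk_end_imp_E[OF w1(1) x] E_space by blast
    ultimately show ?thesis using colour(2) by blast
  qed
  have inj: "?c (p ! i) = ?c (p ! j) \<longleftrightarrow> i = j" if "i \<le> m" "j \<le> m" for i j
    using ne[of i j] ne[of j i] that lp by (cases i j rule: linorder_cases) auto
  define l where "l i = prod_encode (k, prod_encode (?c (p ! i), ?c (p ! Suc i)))" for i
  \<comment> \<open>Another edge could hit the coordinate \<open>l i\<close> only with the same
    colour pair. In the forward direction this forces \<open>j = i\<close>; in the backward
    direction it would require both \<open>i = Suc j\<close> and \<open>Suc i = j\<close>.\<close>
  have val: "cocycle x y (l i) = len (p ! i) (p ! Suc i) / 2 ^ k" if i: "i < m" for i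
  proof -
    have "cocycle x y (l i) = (\<Sum>j<m. edge (l i) (p ! j) (p ! Suc j))"
      unfolding cocycle_eq[OF p(1)] m_def by (rule walk_sum_nth)
    also have "\<dots> = (\<Sum>j<m. if j = i then len (p ! j) (p ! Suc j) / 2 ^ k else 0)"
    proof (rule sum.cong[OF refl])
      fix j assume "j \<in> {..<m}"
      then have j: "j \<le> m" "Suc j \<le> m" "i \<le> m" "Suc i \<le> m" using i by auto
      have "half_edge (p ! Suc j) (p ! j) (l i) = 0"
        using inj[OF j(3) j(2)] inj[OF j(4) j(1)] by (auto simp: half_edge_def l_def)
      moreover have "half_edge (p ! j) (p ! Suc j) (l i) = (if j = i then len (p ! j) (p ! Suc j) / 2 ^ k else 0)"
        using inj[OF j(3) j(1)] by (auto simp: half_edge_def l_def)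
      ultimately show "edge (l i) (p ! j) (p ! Suc j) = (if j = i then len (p ! j) (p ! Suc j) / 2 ^ k else 0)"
        by (simp add: edge_def)
    qed
    also have "\<dots> = len (p ! i) (p ! Suc i) / 2 ^ k" using i by (simp add: sum.delta)
    finally show ?thesis .
  qed
  have "inj_on l {..<m}"
  proof (rule inj_onI)
    fix i j assume "i \<in> {..<m}" "j \<in> {..<m}" "l i = l j"
    then show "i = j" using inj[of i j] by (simp add: l_def)
  qed
  then have "(\<Sum>n\<in>l ` {..<m}. \<bar>cocycle x y n\<bar>) = (\<Sum>i<m. \<bar>cocycle x y (l i)\<bar>)"
    by (simp add: sum.reindex)
  also have "\<dots> = (\<Sum>i<m. len (p ! i) (p ! Suc i) / 2 ^ k)"
  proof (rule sum.cong[OF refl])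
    fix i assume "i \<in> {..<m}"
    then show "\<bar>cocycle x y (l i)\<bar> = len (p ! i) (p ! Suc i) / 2 ^ k"
      using val[of i] len_ge_1[of "p ! i" "p ! Suc i"] by simp
  qed
  also have "\<dots> = W / 2 ^ k" unfolding W by (simp add: sum_divide_distrib)
  finally have "W / 2 ^ k \<le> l1_norm (cocycle x y)"
    using sum_le_l1_norm[OF cocycle_l1, of "l ` {..<m}" x y] by simp
  moreover have "1 / 2 \<le> W / 2 ^ k" using k(2) by (simp add: field_simps)
  ultimately show ?thesis by linarith
qed

lemma measurable_edge_weight: "(\<lambda>x. edge l (g i x) (g j x)) \<in> borel_measurable X"
proof -
  obtain k ab where l: "prod_decode l = (k, ab)" by (cases "prod_decode l")
  have "(\<lambda>x. half_edge (g i x) (g j x) l) \<in> borel_measurable X" for i j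
  proof -
    have "(\<lambda>x. colour k (g i x)) \<in> X \<rightarrow>\<^sub>M count_space UNIV" for i
      using g(1) colour(1) by (rule measurable_compose)
    then have 1: "{x \<in> space X. colour k (g i x) = n} \<in> sets X" for n i
      by (rule measurable_nat_Collect)
    have "{x \<in> space X. colour k (g i x) = fst (prod_decode ab) \<and> colour k (g j x) = snd (prod_decode ab)} \<in> sets X"
      by (intro sets.sets_Collect_conj 1)
    moreover have "prod_decode ab = (u, v) \<longleftrightarrow> u = fst (prod_decode ab) \<and> v = snd (prod_decode ab)" for u v
      by (metis fst_conv snd_conv prod.collapse)
    ultimately have "{x \<in> space X. prod_decode ab = (colour k (g i x), colour k (g j x))} \<in> sets X" by simp
    then show ?thesis
      unfolding half_edge_def l prod.case
      using measurable_len by (intro measurable_If borel_measurable_divide) auto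
  qed
  then show ?thesis unfolding edge_def by (intro borel_measurable_diff)
qed

text \<open>Since every walk gives the same sum, the arbitrary choice may be replaced by the index
  list of least code that traces a walk, and this code depends measurably on
  \<open>x\<close>.\<close>

lemma measurable_cocycle: "(\<lambda>x. cocycle x (g n x) l) \<in> borel_measurable X"
proof -
  let ?p = "\<lambda>i x. map (\<lambda>k. g k x) (from_nat i :: nat list)"
  define \<tau> where "\<tau> x = (LEAST i. walk R x (?p i x) (g n x))" for x
  have "\<tau> \<in> X \<rightarrow>\<^sub>M count_space UNIV"
    unfolding \<tau>_def by (rule measurable_LEAST) (rule measurable_walk[OF g(1)])
  moreover have "(\<lambda>x. walk_sum (edge l) (?p i x)) \<in> borel_measurable X" for i
    using measurable_edge_weight by (rule measurable_walk_sum)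
  ultimately have "(\<lambda>x. walk_sum (edge l) (?p (\<tau> x) x)) \<in> borel_measurable X"
    by (rule measurable_compose_countable[rotated])
  moreover have "cocycle x (g n x) l = walk_sum (edge l) (?p (\<tau> x) x)" if x: "x \<in> space X" for x
  proof -
    have "(x, g n x) \<in> E" using g(2)[OF x] by blast
    then obtain p where p: "walk R x p (g n x)" using E_imp_walk by blast
    obtain ks where "p = map (\<lambda>k. g k x) ks" using walk_enum[OF p x] by blast
    then have "walk R x (?p (to_nat ks) x) (g n x)" using p by simp
    then have "walk R x (?p (\<tau> x) x) (g n x)" unfolding \<tau>_def by (rule LeastI)
    then show ?thesis by (rule cocycle_eq)
  qed
  ultimately show ?thesis by (simp cong: measurable_cong)
qed

theorem classifiable_by_l1: "classifiable_by X E l1_group l1_topology"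
  using X E g cocycle_l1 cocycle_add cocycle_separated measurable_cocycle
  by (rule classifiable_of_separated_cocycle)

end

text \<open>Only partitions are compared in the hypothesis: the component of \<open>x\<close> is
  some \<open>E\<close>-class containing \<open>x\<close>, hence the class of \<open>x\<close>.
  Paths from a point of \<open>V\<close> stay in \<open>V\<close> because \<open>R\<close>
  does.\<close>

lemma graph_components_rtrancl:
  assumes E: "equiv V E" and comp: "graph_components V R = V // E" and R: "R \<subseteq> V \<times> V" and x: "x \<in> V"
  shows "(x, y) \<in> E \<longleftrightarrow> (x, y) \<in> R\<^sup>*"
proof -
  define C where "C = {y \<in> V. (x, y) \<in> R\<^sup>*}"
  have "C \<in> V // E" unfolding comp[symmetric] C_def graph_components_def using x by blast
  moreover have "x \<in> C" using x by (simp add: C_def)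
  ultimately have "C = E `` {x}" using E
    by (metis Image_singleton_iff equiv_class_eq_iff quotientE)
  moreover have "y \<in> V" if "(x, y) \<in> R\<^sup>*"
    using that x R by (induction rule: rtrancl_induct) auto
  ultimately show ?thesis unfolding C_def by blast
qed

theorem theorem1p2:
  fixes X :: "'a measure" and E :: "('a \<times> 'a) set"
  assumes "standard_borel X"
    and "countable_borel_equiv X E"
    and "treeable X E"
  shows "classifiable_by_abelian_polish_group X E \<and> classifiable_by X E l1_group l1_topology"
proof -
  have E: "equiv (space X) E" "E \<in> sets (X \<Otimes>\<^sub>M X)" and cc: "\<And>C. C \<in> space X // E \<Longrightarrow> countable C"
    using assms(2) by (auto simp: countable_borel_equiv_def borel_equiv_def)
  obtain R where R: "R \<in> sets (X \<Otimes>\<^sub>M X)" "sym R" "irrefl R" "acyclic_graph R"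
    and comp: "graph_components (space X) R = space X // E"
    using assms(3) unfolding treeable_def borel_graph_def by blast
  have Esub: "E \<subseteq> space X \<times> space X" "R \<subseteq> space X \<times> space X"
    using sets.sets_into_space[OF E(2)] sets.sets_into_space[OF R(1)] by (simp_all add: space_pair_measure)
  have "countable (E `` {x})" for x
  proof (cases "x \<in> space X")
    case True
    then show ?thesis by (intro cc quotientI)
  next
    case False
    then have "E `` {x} = {}" using Esub by blast
    then show ?thesis by simp
  qed
  moreover have "(x, x) \<in> E" if "x \<in> space X" for x using equiv_class_self[OF E(1) that] by blast
  ultimately obtain g :: "nat \<Rightarrow> 'a \<Rightarrow> 'a" where g: "\<And>n. g n \<in> X \<rightarrow>\<^sub>M X"
    "\<And>x. x \<in> space X \<Longrightarrow> E `` {x} = range (\<lambda>n. g n x)"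
    using countable_sections_enumeration[OF assms(1) E(2)] by metis
  have "treeing X E R g"
    using assms(1) E(1) R graph_components_rtrancl[OF E(1) comp Esub(2)] g by unfold_locales
  then have "classifiable_by X E l1_group l1_topology" by (rule treeing.classifiable_by_l1)
  \<comment> \<open>The abelian group witnessing the first claim is \<open>l1_group\<close>
    itself.\<close>
  then show ?thesis
    unfolding classifiable_by_abelian_polish_group_def using comm_group_l1 by blast
qed

end
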